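(* Let $(T_1,T_2)$ be a pair of pure commuting contractions on some Hilbert space $H$, both with finite defect. Let $(S_\Psi,K_\Psi)$, $S_\Psi=(S_1^\Psi,S_2^\Psi)$, be the constrained isometric co-extension of $(T_1,T_2)$ corresponding to some rational matrix-valued pure inner function $\Psi\in H^\infty(\mathbb{D};B(\mathbb{C}^d))$ (as described in the context). Then $$\sigma(S^\Psi_1,S^\Psi_2)\subset \operatorname{supp}(\operatorname{Ann}(T_1,T_2))\subset \overline{V_\Psi}=\operatorname{supp}(\operatorname{Ann}(M_z\otimes I,M_\Psi))$$ and $$\sigma(S^\Psi_1,S^\Psi_2)\cap \mathbb{D}^2=\operatorname{supp}(\operatorname{Ann}(T_1,T_2))\cap \mathbb{D}^2=Z(\operatorname{Ann}(T_1,T_2)).$$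
   Context: $\sigma(\cdot,\cdot)$ denotes the Taylor spectrum of a commuting pair. $\mathbb{D}$ is the open unit disc, $H^2$ the Hardy space on $\mathbb{D}$, and $H^\infty(\mathbb{D}^2)$, $H^\infty(\mathbb{D};B(E',E))$ are the spaces of bounded holomorphic functions (scalar, operator-valued). $H^2\otimes E$ is identified with the $E$-valued Hardy space; $M_z$ is multiplication by $z$ on $H^2$; for $\Phi\in H^\infty(\mathbb{D};B(E',E))$, $M_\Phi:H^2\otimes E'\to H^2\otimes E$ is $(M_\Phi f)(z)=\Phi(z)f(z)$, and $\Phi$ is inner if $M_\Phi$ is an isometry. A contraction $T$ is pure if $\|T^{*n}h\|\to0$ for all $h$, and has finite defect if $\operatorname{ran}(I-TT^* )$ is finite-dimensional. A rational matrix-valued pure inner function is an inner $\Psi\in H^\infty(\mathbb{D};B(\mathbb{C}^d))$ with rational entries such that $\sigma(\Psi(\lambda))\subset\mathbb{D}$ for all $\lambda\in\mathbb{D}$. Setting: $d=\dim\operatorname{ran}(I-T_1T_1^* )$; $J:H\to H^2\otimes\mathbb{C}^d$ is an isometry with $JT_1^*=(M_z\otimes I)^*J$ (the usual minimal isometric co-extension of $T_1$); $\Psi\in H^\infty(\mathbb{D};B(\mathbb{C}^d))$ is a rational matrix-valued pure inner function with $JT_2^*=M_\Psi^*J$ (such $J$ and $\Psi$ are known to exist). Put $V_\Psi=\{(z,w)\in\mathbb{D}^2:\det(\Psi(z)-wI)=0\}$. Functional calculus: for $f\in H^\infty(\mathbb{D}^2)$, let $f(M_z\otimes I,M_\Psi)$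 be the multiplication operator by the bounded function $z\mapsto f(z,\Psi(z))$, where $f(z,\Psi(z))$ is the holomorphic function $f(z,\cdot)$ of the matrix $\Psi(z)$. Put $f(T_1,T_2)=J^*f(M_z\otimes I,M_\Psi)J$, which extends the polynomial calculus. Then $\operatorname{Ann}(T_1,T_2)=\{f\in H^\infty(\mathbb{D}^2):f(T_1,T_2)=0\}$ and $\operatorname{Ann}(M_z\otimes I,M_\Psi)=\{f\in H^\infty(\mathbb{D}^2):f(M_z\otimes I,M_\Psi)=0\}$. Constrained isometric co-extension: $K_\Psi=\bigcap_{f\in\operatorname{Ann}(T_1,T_2)}\ker f(M_z\otimes I,M_\Psi)^*$, a closed subspace co-invariant for $M_z\otimes I$ and $M_\Psi$, and $S_1^\Psi=P_{K_\Psi}(M_z\otimes I)|_{K_\Psi}$, $S_2^\Psi=P_{K_\Psi}M_\Psi|_{K_\Psi}$, which are commuting contractions. For $F\subset H^\infty(\mathbb{D}^2)$, $Z(F)=\{(z,w)\in\mathbb{D}^2: f(z,w)=0\ \forall f\in F\}$. For an ideal $F\subset H^\infty(\mathbb{D}^2)$, $\operatorname{supp}(F)$ is the set of $(\lambda,\mu)\in\mathbb{C}^2$ such that $1\notin F+(z-\lambda)H^\infty(\mathbb{D}^2)+(w-\mu)H^\infty(\mathbb{D}^2)$. *)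

theory Defs
  imports
    "HOL-Analysis.Analysis"
    "Jordan_Normal_Form.Spectral_Radius"
begin

unbundle no vec_syntax
hide_const (open) Finite_Cartesian_Product.vec Determinants.det
hide_type (open) Finite_Cartesian_Product.vec

section \<open>Complex Hilbert spaces and adjoints\<close>

text \<open>
  The inner product is linear in its first argument. Positivity and definiteness of
  \<open>cinner\<close> follow from \<open>norm_eq_sqrt_cinner\<close>, and \<open>scaleC 1 x = x\<close> from
  \<open>scaleC_of_real\<close>.
\<close>

class chilbert_space = banach +
  fixes scaleC :: "complex \<Rightarrow> 'a \<Rightarrow> 'a"  (infixr \<open>*\<^sub>C\<close> 75)
    and cinner :: "'a \<Rightarrow> 'a \<Rightarrow> complex"
  assumes scaleC_add_right: "c *\<^sub>C (x + y) = c *\<^sub>C x + c *\<^sub>C y"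
    and scaleC_add_left: "(b + c) *\<^sub>C x = b *\<^sub>C x + c *\<^sub>C x"
    and scaleC_scaleC: "b *\<^sub>C (c *\<^sub>C x) = (b * c) *\<^sub>C x"
    and scaleC_of_real: "complex_of_real r *\<^sub>C x = r *\<^sub>R x"
    and cinner_commute: "cinner x y = cnj (cinner y x)"
    and cinner_add_left: "cinner (x + y) z = cinner x z + cinner y z"
    and cinner_scaleC_left: "cinner (c *\<^sub>C x) y = c * cinner x y"
    and norm_eq_sqrt_cinner: "norm x = sqrt (Re (cinner x x))"

text \<open>
  The Hardy space and its subspaces are sets carrying an inner product, not types. So the
  adjoint of \<open>A : X \<rightarrow> Y\<close> takes the carrier \<open>X\<close> and both inner products as parameters.
\<close>

definition adjoint_on ::
  "'a set \<Rightarrow> ('a \<Rightarrow> 'a \<Rightarrow> complex) \<Rightarrow> ('b \<Rightarrow> 'b \<Rightarrow> complex) \<Rightarrow> ('a \<Rightarrow> 'b) \<Rightarrow> 'b \<Rightarrow> 'a" where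
  "adjoint_on X ipX ipY A y = (THE x. x \<in> X \<and> (\<forall>u\<in>X. ipY (A u) y = ipX u x))"

abbreviation cadjoint :: "('h::chilbert_space \<Rightarrow> 'h) \<Rightarrow> 'h \<Rightarrow> 'h" where
  "cadjoint \<equiv> adjoint_on UNIV cinner cinner"

definition contraction :: "('h::chilbert_space \<Rightarrow> 'h) \<Rightarrow> bool" where
  "contraction T \<longleftrightarrow> Vector_Spaces.linear scaleC scaleC T \<and> (\<forall>x. norm (T x) \<le> norm x)"

definition pure_contraction :: "('h::chilbert_space \<Rightarrow> 'h) \<Rightarrow> bool" where
  "pure_contraction T \<longleftrightarrow>
     contraction T \<and> (\<forall>h. (\<lambda>n. norm ((cadjoint T ^^ n) h)) \<longlonglongrightarrow> 0)"

definition defect_range :: "('h::chilbert_space \<Rightarrow> 'h) \<Rightarrow> 'h set" where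
  "defect_range T = range (\<lambda>x. x - T (cadjoint T x))"

definition finite_defect :: "('h::chilbert_space \<Rightarrow> 'h) \<Rightarrow> bool" where
  "finite_defect T \<longleftrightarrow> (\<exists>B. finite B \<and> defect_range T \<subseteq> Modules.module.span scaleC B)"

definition defect_dim :: "('h::chilbert_space \<Rightarrow> 'h) \<Rightarrow> nat" where
  "defect_dim T = Vector_Spaces.vector_space.dim scaleC (defect_range T)"


section \<open>The vector-valued Hardy space\<close>

abbreviation unit_disc :: "complex set" (\<open>\<D>\<close>) where
  "\<D> \<equiv> ball 0 1"

definition taylor_coeff :: "(complex \<Rightarrow> complex) \<Rightarrow> nat \<Rightarrow> complex" where
  "taylor_coeff g n = (deriv ^^ n) g 0 / fact n"

text \<open>
  The \<open>\<complex>\<^sup>d\<close>-valued Hardy space. Its elements are functions on the disc, extended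
  by zero so that equality of elements is equality in HOL.
\<close>

definition hardy :: "nat \<Rightarrow> (complex \<Rightarrow> complex vec) set" where
  "hardy d = {f. (\<forall>z. f z \<in> carrier_vec d) \<and> (\<forall>z. z \<notin> \<D> \<longrightarrow> f z = 0\<^sub>v d) \<and>
     (\<forall>i<d. (\<lambda>z. f z $ i) holomorphic_on \<D> \<and>
            summable (\<lambda>n. (cmod (taylor_coeff (\<lambda>z. f z $ i) n))\<^sup>2))}"

definition hinner :: "nat \<Rightarrow> (complex \<Rightarrow> complex vec) \<Rightarrow> (complex \<Rightarrow> complex vec) \<Rightarrow> complex" where
  "hinner d f g =
     (\<Sum>i<d. \<Sum>n. taylor_coeff (\<lambda>z. f z $ i) n * cnj (taylor_coeff (\<lambda>z. g z $ i) n))"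

definition hnorm :: "nat \<Rightarrow> (complex \<Rightarrow> complex vec) \<Rightarrow> real" where
  "hnorm d f = sqrt (Re (hinner d f f))"

definition hadd :: "(complex \<Rightarrow> complex vec) \<Rightarrow> (complex \<Rightarrow> complex vec) \<Rightarrow> complex \<Rightarrow> complex vec" where
  "hadd f g = (\<lambda>z. f z + g z)"

definition hminus :: "(complex \<Rightarrow> complex vec) \<Rightarrow> (complex \<Rightarrow> complex vec) \<Rightarrow> complex \<Rightarrow> complex vec" where
  "hminus f g = (\<lambda>z. f z - g z)"

definition hscale :: "complex \<Rightarrow> (complex \<Rightarrow> complex vec) \<Rightarrow> complex \<Rightarrow> complex vec" where
  "hscale c f = (\<lambda>z. c \<cdot>\<^sub>v f z)"

definition hzero :: "nat \<Rightarrow> complex \<Rightarrow> complex vec" where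
  "hzero d = (\<lambda>z. 0\<^sub>v d)"

definition hproj :: "nat \<Rightarrow> (complex \<Rightarrow> complex vec) set \<Rightarrow>
    (complex \<Rightarrow> complex vec) \<Rightarrow> complex \<Rightarrow> complex vec" where
  "hproj d K f = (THE g. g \<in> K \<and> (\<forall>k\<in>K. hinner d (hminus f g) k = 0))"

abbreviation hadjoint :: "nat \<Rightarrow> ((complex \<Rightarrow> complex vec) \<Rightarrow> complex \<Rightarrow> complex vec) \<Rightarrow>
    (complex \<Rightarrow> complex vec) \<Rightarrow> complex \<Rightarrow> complex vec" where
  "hadjoint d \<equiv> adjoint_on (hardy d) (hinner d) (hinner d)"

definition mult_op :: "nat \<Rightarrow> (complex \<Rightarrow> complex mat) \<Rightarrow>
    (complex \<Rightarrow> complex vec) \<Rightarrow> complex \<Rightarrow> complex vec" where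
  "mult_op d \<Phi> f = (\<lambda>z. if z \<in> \<D> then \<Phi> z *\<^sub>v f z else 0\<^sub>v d)"

text \<open>The operator \<open>M\<^sub>z \<otimes> I\<close>.\<close>

definition shift :: "(complex \<Rightarrow> complex vec) \<Rightarrow> complex \<Rightarrow> complex vec" where
  "shift f = (\<lambda>z. z \<cdot>\<^sub>v f z)"

definition isometry_into_hardy :: "nat \<Rightarrow> ('h::chilbert_space \<Rightarrow> complex \<Rightarrow> complex vec) \<Rightarrow> bool" where
  "isometry_into_hardy d J \<longleftrightarrow>
     (\<forall>x. J x \<in> hardy d) \<and>
     (\<forall>x y. J (x + y) = hadd (J x) (J y)) \<and>
     (\<forall>c x. J (c *\<^sub>C x) = hscale c (J x)) \<and>
     (\<forall>x. hnorm d (J x) = norm x)"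


section \<open>Rational matrix-valued pure inner functions\<close>

text \<open>Boundedness is entrywise, which for \<open>d \<times> d\<close> matrices is boundedness in operator norm.\<close>

definition Hinf_mat :: "nat \<Rightarrow> (complex \<Rightarrow> complex mat) set" where
  "Hinf_mat d = {\<Phi>. (\<forall>z\<in>\<D>. \<Phi> z \<in> carrier_mat d d) \<and>
     (\<forall>i<d. \<forall>j<d. (\<lambda>z. \<Phi> z $$ (i, j)) holomorphic_on \<D> \<and>
                  bounded ((\<lambda>z. \<Phi> z $$ (i, j)) ` \<D>))}"

definition inner_function :: "nat \<Rightarrow> (complex \<Rightarrow> complex mat) \<Rightarrow> bool" where
  "inner_function d \<Phi> \<longleftrightarrow>
     \<Phi> \<in> Hinf_mat d \<and> (\<forall>f\<in>hardy d. mult_op d \<Phi> f \<in> hardy d \<and> hnorm d (mult_op d \<Phi> f) = hnorm d f)"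

definition rational_entries :: "nat \<Rightarrow> (complex \<Rightarrow> complex mat) \<Rightarrow> bool" where
  "rational_entries d \<Phi> \<longleftrightarrow>
     (\<forall>i<d. \<forall>j<d. \<exists>p q :: complex poly.
        \<forall>z\<in>\<D>. poly q z \<noteq> 0 \<and> \<Phi> z $$ (i, j) = poly p z / poly q z)"

definition rational_pure_inner :: "nat \<Rightarrow> (complex \<Rightarrow> complex mat) \<Rightarrow> bool" where
  "rational_pure_inner d \<Psi> \<longleftrightarrow>
     inner_function d \<Psi> \<and> rational_entries d \<Psi> \<and> (\<forall>z\<in>\<D>. spectrum (\<Psi> z) \<subseteq> \<D>)"

definition V_set :: "nat \<Rightarrow> (complex \<Rightarrow> complex mat) \<Rightarrow> (complex \<times> complex) set" where
  "V_set d \<Psi> = {(z, w). (z, w) \<in> \<D> \<times> \<D> \<and> det (\<Psi> z - w \<cdot>\<^sub>m 1\<^sub>m d) = 0}"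


section \<open>Bounded holomorphic functions on the bidisc\<close>

text \<open>
  Elements are functions on all of \<open>\<complex>\<^sup>2\<close>, of which only the values on
  the bidisc matter; identities between them are stated on the bidisc.
\<close>

definition Hinf2 :: "(complex \<times> complex \<Rightarrow> complex) set" where
  "Hinf2 = {f. bounded (f ` (\<D> \<times> \<D>)) \<and>
     (\<forall>p\<in>\<D> \<times> \<D>. \<exists>a b. (f has_derivative (\<lambda>(h, k). a * h + b * k)) (at p))}"

definition zero_set :: "(complex \<times> complex \<Rightarrow> complex) set \<Rightarrow> (complex \<times> complex) set" where
  "zero_set F = {p \<in> \<D> \<times> \<D>. \<forall>f\<in>F. f p = 0}"

definition supp :: "(complex \<times> complex \<Rightarrow> complex) set \<Rightarrow> (complex \<times> complex) set" where
  "supp F = {(l, m). \<not> (\<exists>f\<in>F. \<exists>g\<in>Hinf2. \<exists>h\<in>Hinf2. \<forall>z\<in>\<D>. \<forall>w\<in>\<D>.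
     1 = f (z, w) + (z - l) * g (z, w) + (w - m) * h (z, w))}"


section \<open>Functional calculus, annihilators and the constrained co-extension\<close>

text \<open>
  Holomorphic functional calculus of a \<open>d \<times> d\<close> matrix with spectrum in the disc, for
  functions holomorphic on the disc: the entrywise limit of the Taylor series at \<open>0\<close>.
\<close>

definition mat_fun :: "nat \<Rightarrow> (complex \<Rightarrow> complex) \<Rightarrow> complex mat \<Rightarrow> complex mat" where
  "mat_fun d g A = mat d d (\<lambda>(i, j). \<Sum>n. taylor_coeff g n * (A ^\<^sub>m n) $$ (i, j))"

text \<open>The operator \<open>f(M\<^sub>z \<otimes> I, M\<^sub>\<Psi>)\<close>.\<close>

definition calc_M :: "nat \<Rightarrow> (complex \<Rightarrow> complex mat) \<Rightarrow> (complex \<times> complex \<Rightarrow> complex) \<Rightarrow>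
    (complex \<Rightarrow> complex vec) \<Rightarrow> complex \<Rightarrow> complex vec" where
  "calc_M d \<Psi> f = mult_op d (\<lambda>z. mat_fun d (\<lambda>w. f (z, w)) (\<Psi> z))"

text \<open>The operator \<open>f(T\<^sub>1, T\<^sub>2)\<close>, the compression of \<open>calc_M\<close> along \<open>J\<close>.\<close>

definition calc_T :: "nat \<Rightarrow> (complex \<Rightarrow> complex mat) \<Rightarrow> ('h::chilbert_space \<Rightarrow> complex \<Rightarrow> complex vec) \<Rightarrow>
    (complex \<times> complex \<Rightarrow> complex) \<Rightarrow> 'h \<Rightarrow> 'h" where
  "calc_T d \<Psi> J f x = adjoint_on UNIV cinner (hinner d) J (calc_M d \<Psi> f (J x))"

definition Ann_M :: "nat \<Rightarrow> (complex \<Rightarrow> complex mat) \<Rightarrow> (complex \<times> complex \<Rightarrow> complex) set" where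
  "Ann_M d \<Psi> = {f \<in> Hinf2. \<forall>g\<in>hardy d. calc_M d \<Psi> f g = hzero d}"

definition Ann_T :: "nat \<Rightarrow> (complex \<Rightarrow> complex mat) \<Rightarrow> ('h::chilbert_space \<Rightarrow> complex \<Rightarrow> complex vec) \<Rightarrow>
    (complex \<times> complex \<Rightarrow> complex) set" where
  "Ann_T d \<Psi> J = {f \<in> Hinf2. \<forall>x. calc_T d \<Psi> J f x = 0}"

definition K_space :: "nat \<Rightarrow> (complex \<Rightarrow> complex mat) \<Rightarrow> ('h::chilbert_space \<Rightarrow> complex \<Rightarrow> complex vec) \<Rightarrow>
    (complex \<Rightarrow> complex vec) set" where
  "K_space d \<Psi> J = {g \<in> hardy d. \<forall>f\<in>Ann_T d \<Psi> J. hadjoint d (calc_M d \<Psi> f) g = hzero d}"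

text \<open>The operators \<open>S\<^sub>1\<close> and \<open>S\<^sub>2\<close>, meaningful on \<open>K_space\<close>.\<close>

definition S1 :: "nat \<Rightarrow> (complex \<Rightarrow> complex mat) \<Rightarrow> ('h::chilbert_space \<Rightarrow> complex \<Rightarrow> complex vec) \<Rightarrow>
    (complex \<Rightarrow> complex vec) \<Rightarrow> complex \<Rightarrow> complex vec" where
  "S1 d \<Psi> J k = hproj d (K_space d \<Psi> J) (shift k)"

definition S2 :: "nat \<Rightarrow> (complex \<Rightarrow> complex mat) \<Rightarrow> ('h::chilbert_space \<Rightarrow> complex \<Rightarrow> complex vec) \<Rightarrow>
    (complex \<Rightarrow> complex vec) \<Rightarrow> complex \<Rightarrow> complex vec" where
  "S2 d \<Psi> J k = hproj d (K_space d \<Psi> J) (mult_op d \<Psi> k)"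


section \<open>Taylor spectrum of a commuting pair\<close>

text \<open>
  Exactness of the Koszul complex \<open>0 \<rightarrow> K \<rightarrow> K \<oplus> K \<rightarrow> K \<rightarrow> 0\<close> of a pair of commuting operators
  on a subspace \<open>K\<close> of \<open>hardy d\<close>, with differentials \<open>u \<mapsto> (A u, B u)\<close> and
  \<open>(x, y) \<mapsto> A y - B x\<close>.
\<close>

definition koszul_exact :: "nat \<Rightarrow> (complex \<Rightarrow> complex vec) set \<Rightarrow>
    ((complex \<Rightarrow> complex vec) \<Rightarrow> complex \<Rightarrow> complex vec) \<Rightarrow>
    ((complex \<Rightarrow> complex vec) \<Rightarrow> complex \<Rightarrow> complex vec) \<Rightarrow> bool" where
  "koszul_exact d K A B \<longleftrightarrow>
     (\<forall>u\<in>K. A u = hzero d \<and> B u = hzero d \<longrightarrow> u = hzero d) \<and>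
     (\<forall>x\<in>K. \<forall>y\<in>K. hminus (A y) (B x) = hzero d \<longrightarrow> (\<exists>u\<in>K. A u = x \<and> B u = y)) \<and>
     (\<forall>v\<in>K. \<exists>x\<in>K. \<exists>y\<in>K. hminus (A y) (B x) = v)"

definition taylor_spectrum :: "nat \<Rightarrow> (complex \<Rightarrow> complex vec) set \<Rightarrow>
    ((complex \<Rightarrow> complex vec) \<Rightarrow> complex \<Rightarrow> complex vec) \<Rightarrow>
    ((complex \<Rightarrow> complex vec) \<Rightarrow> complex \<Rightarrow> complex vec) \<Rightarrow> (complex \<times> complex) set" where
  "taylor_spectrum d K A B =
     {(l, m). \<not> koszul_exact d K (\<lambda>k. hminus (A k) (hscale l k)) (\<lambda>k. hminus (B k) (hscale m k))}"

end

theory Submission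
  imports Defs "HOL-Complex_Analysis.Riemann_Mapping"
begin

text \<open>
  Throughout, \<open>M\<close> stands for the pair \<open>(M\<^sub>z \<otimes> I, M\<^sub>\<Psi>)\<close>, and \<open>p(z, w) = det (\<Psi>(z) - w I)\<close> is the
  function that carries the argument (\<open>det_fun\<close>); its zero set in the bidisc is \<open>V\<^sub>\<Psi>\<close>.

  The map \<open>f \<mapsto> f(M)\<close> is an algebra homomorphism from \<open>H\<^sup>\<infinity>(\<D>\<^sup>2)\<close> into the bounded multipliers of
  the Hardy space. The point that needs an idea is boundedness of \<open>z \<mapsto> f(z, \<Psi>(z))\<close>. Every \<open>\<Psi>(z)\<close>
  is a contraction with spectrum in the disc (\<open>inner_function_contractive\<close>, by testing the isometry
  \<open>M\<^sub>\<Psi>\<close> on Szego kernels). For such a matrix \<open>A\<close> the Schur algorithm, run at the eigenvalues of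
  \<open>A\<close>, expands a bounded function \<open>g\<close> along partial Blaschke products; the remainder is divisible
  by the full product, which Cayley-Hamilton annihilates at \<open>A\<close>, and Blaschke factors of a
  contraction are contractions. Hence \<open>\<parallel>g(A)\<parallel> \<le> 4\<^sup>d sup |g|\<close> (\<open>mat_act_bound\<close>).

  The space \<open>K\<^sub>\<Psi>\<close> is co-invariant, so compressing \<open>f(M)\<close> to it is again a homomorphism, and it kills
  \<open>Ann(T)\<close>. A Bezout identity \<open>1 = f + (z - l) g + (w - m) h\<close> with \<open>f \<in> Ann(T)\<close> therefore becomes
  \<open>(S\<^sub>1 - l) g(S) + (S\<^sub>2 - m) h(S) = 1\<close>, and commuting operators with such an identity have an exact
  Koszul complex (\<open>koszul_exact_of_Bezout\<close>). This is \<open>\<sigma>(S) \<subseteq> supp Ann(T)\<close>.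

  Inside the bidisc the support is the common zero set, because \<open>f - f(l, m)\<close> is always of the form
  \<open>(z - l) g + (w - m) h\<close> (\<open>Gleason_bidisc\<close>). At a common zero \<open>(l, m)\<close> of \<open>Ann(T)\<close> also \<open>p\<close>
  vanishes, since \<open>p \<in> Ann(M) \<subseteq> Ann(T)\<close> by Cayley-Hamilton. So \<open>\<Psi>(l)\<^sup>*\<close> has an eigenvector for the
  conjugate of \<open>m\<close>; tensored with the Szego kernel at \<open>l\<close> it is a joint eigenvector of the adjoints
  of \<open>M\<close> that lies in \<open>K\<^sub>\<Psi>\<close> (\<open>joint_eigenvector\<close>), and the last Koszul map misses it. Hence
  \<open>(l, m) \<in> \<sigma>(S)\<close>.

  It remains to see that \<open>supp Ann(M)\<close> is the closure of \<open>V\<^sub>\<Psi>\<close>; the inclusion of \<open>supp Ann(T)\<close> in it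
  is then monotonicity. Functions in \<open>Ann(M)\<close> vanish on \<open>V\<^sub>\<Psi>\<close>, so a Bezout identity at a limit point
  of \<open>V\<^sub>\<Psi>\<close> would give \<open>1 = 0\<close> in the limit. For the other direction, the entries of \<open>\<Psi>\<close> are rational
  and bounded, hence without poles on the closed disc, and so even at boundary points \<open>(l, m)\<close> one
  can write \<open>p = c + (z - l) g + (w - m) h\<close> (\<open>det_fun_Bezout_value\<close>). If \<open>c \<noteq> 0\<close> this is a Bezout
  identity. If \<open>c = 0\<close> then \<open>p\<close> is small near \<open>(l, m)\<close>; as \<open>p(z, \<cdot>)\<close> is, up to sign, the product
  of the \<open>w - e\<close> over the eigenvalues \<open>e\<close> of \<open>\<Psi>(z)\<close>, some eigenvalue is near \<open>m\<close>, which gives a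
  point of \<open>V\<^sub>\<Psi>\<close> near \<open>(l, m)\<close>.
\<close>

text \<open>Vectors, matrices and determinants are those whose dimension is a term, not a type.\<close>

unbundle no vec_syntax
hide_const (open) Finite_Cartesian_Product.vec Determinants.det
hide_type (open) Finite_Cartesian_Product.vec

section \<open>Division of bounded functions on the disc\<close>

text \<open>
  The closed ball of radius \<open>B\<close> of \<open>H\<^sup>\<infinity>(\<D>)\<close>. The radius is a parameter because all later estimates
  have to follow it through repeated divisions.
\<close>

definition Hinf :: "real \<Rightarrow> (complex \<Rightarrow> complex) set" where
  "Hinf B = {g. g holomorphic_on \<D> \<and> (\<forall>w\<in>\<D>. norm (g w) \<le> B)}"

lemma HinfI: "g holomorphic_on \<D> \<Longrightarrow> (\<And>w. w \<in> \<D> \<Longrightarrow> norm (g w) \<le> B) \<Longrightarrow> g \<in> Hinf B"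
  by (simp add: Hinf_def)

lemma Hinf_holo: "g \<in> Hinf B \<Longrightarrow> g holomorphic_on \<D>"
  and Hinf_bound: "g \<in> Hinf B \<Longrightarrow> w \<in> \<D> \<Longrightarrow> norm (g w) \<le> B"
  by (auto simp: Hinf_def)

lemma one_minus_cnj_mult_nonzero:
  assumes "\<mu> \<in> \<D>" "w \<in> \<D>"
  shows "1 - cnj \<mu> * w \<noteq> 0"
proof
  assume "1 - cnj \<mu> * w = 0"
  hence "norm (cnj \<mu> * w) = 1" by (metis eq_iff_diff_eq_0 norm_one)
  moreover have "norm (cnj \<mu> * w) < 1"
    using assms mult_strict_mono'[of "norm \<mu>" 1 "norm w" 1] by (simp add: norm_mult)
  ultimately show False by simp
qed

lemma norm_one_minus_cnj_mult_ge:
  assumes "\<mu> \<in> \<D>" "w \<in> \<D>"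
  shows "norm (1 - cnj \<mu> * w) \<ge> 1 - norm \<mu>"
proof -
  have "norm (1 - cnj \<mu> * w) \<ge> norm (1::complex) - norm (cnj \<mu> * w)"
    by (rule norm_triangle_ineq2)
  moreover have "norm (cnj \<mu> * w) \<le> norm \<mu> * 1"
    using assms by (simp add: norm_mult mult_left_le)
  ultimately show ?thesis by simp
qed

text \<open>
  The Schwarz lemma for \<open>g \<circ> \<phi> - g(\<mu>)\<close>, where \<open>\<phi>\<close> is the disc automorphism taking \<open>0\<close> to
  \<open>\<mu>\<close>. The difference is bounded by \<open>2 B\<close>; the factor \<open>3\<close> provides the strict inequality that
  the Schwarz lemma asks for.
\<close>

lemma Schwarz_Pick_difference:
  assumes g: "g \<in> Hinf B" and \<mu>: "\<mu> \<in> \<D>" and w: "w \<in> \<D>" and B: "0 < B"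
  shows "norm (g w - g \<mu>) * norm (1 - cnj \<mu> * w) \<le> 3 * B * norm (w - \<mu>)"
proof -
  define \<phi> where "\<phi> = Moebius_function 0 (-\<mu>)"
  define \<zeta> where "\<zeta> = Moebius_function 0 \<mu> w"
  define G where "G = (\<lambda>z. (g (\<phi> z) - g \<mu>) / (3 * B))"
  have \<mu>1: "norm \<mu> < 1" "norm w < 1" using \<mu> w by auto
  have \<phi>D: "\<phi> z \<in> \<D>" if "norm z < 1" for z
    using Moebius_function_norm_lt_1[of "-\<mu>" z 0] \<mu>1 that by (simp add: \<phi>_def)
  have "\<phi> holomorphic_on \<D>"
    unfolding \<phi>_def by (rule Moebius_function_holomorphic) (use \<mu>1 in auto)
  from holomorphic_on_compose_gen[OF this Hinf_holo[OF g]]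
  have "(g \<circ> \<phi>) holomorphic_on \<D>" using \<phi>D by (simp add: image_subset_iff)
  hence holG: "G holomorphic_on \<D>"
    unfolding G_def o_def using B by (intro holomorphic_intros) auto
  have G0: "G 0 = 0" by (simp add: G_def \<phi>_def Moebius_function_def)
  have nG: "norm (G z) < 1" if "norm z < 1" for z
  proof -
    have "norm (g (\<phi> z) - g \<mu>) \<le> norm (g (\<phi> z)) + norm (g \<mu>)" by (rule norm_triangle_ineq4)
    also have "\<dots> \<le> B + B" using Hinf_bound[OF g \<phi>D[OF that]] Hinf_bound[OF g \<mu>] by simp
    also have "\<dots> < 3 * B" using B by simp
    finally show ?thesis using B by (simp add: G_def norm_divide norm_mult)
  qed
  have \<zeta>1: "norm \<zeta> < 1"
    unfolding \<zeta>_def by (rule Moebius_function_norm_lt_1) (use \<mu>1 in auto)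
  have "norm (G \<zeta>) \<le> norm \<zeta>" by (rule Schwarz_Lemma(1)[OF holG G0 nG \<zeta>1])
  moreover have "\<phi> \<zeta> = w"
  proof -
    have a: "1 - cnj \<mu> * w \<noteq> 0" "1 - cnj \<mu> * \<mu> \<noteq> 0"
      using one_minus_cnj_mult_nonzero \<mu> w by auto
    have "1 + cnj \<mu> * ((w - \<mu>) / (1 - cnj \<mu> * w)) = (1 - cnj \<mu> * \<mu>) / (1 - cnj \<mu> * w)"
      using a by (simp add: field_simps)
    moreover have "(w - \<mu>) / (1 - cnj \<mu> * w) + \<mu> = w * (1 - cnj \<mu> * \<mu>) / (1 - cnj \<mu> * w)"
      using a by (simp add: field_simps)
    ultimately show ?thesis using a by (simp add: \<phi>_def \<zeta>_def Moebius_function_def)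
  qed
  ultimately have "norm (g w - g \<mu>) / (3 * B) \<le> norm (w - \<mu>) / norm (1 - cnj \<mu> * w)"
    using B by (simp add: G_def norm_divide norm_mult \<zeta>_def Moebius_function_def)
  thus ?thesis using B one_minus_cnj_mult_nonzero[OF \<mu> w] by (simp add: field_simps)
qed

text \<open>
  The quotient \<open>(g - g(\<mu>)) / (z - \<mu>)\<close> with its removable singularity filled in. This division is
  the only operation on functions behind Osgood's lemma, Gleason's problem, the shift of Taylor
  coefficients and the Schur algorithm below.
\<close>

definition div_quot :: "(complex \<Rightarrow> complex) \<Rightarrow> complex \<Rightarrow> complex \<Rightarrow> complex" where
  "div_quot g \<mu> z = (if z = \<mu> then deriv g \<mu> else (g z - g \<mu>) / (z - \<mu>))"

lemma div_quot_eq: "g z = g \<mu> + (z - \<mu>) * div_quot g \<mu> z"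
  by (simp add: div_quot_def)

lemma div_quot_holo: "g holomorphic_on \<D> \<Longrightarrow> div_quot g \<mu> holomorphic_on \<D>"
  using pole_lemma_open[of g \<D> \<mu>] by (simp add: div_quot_def[abs_def])

text \<open>
  One step of the Schur algorithm: \<open>g - g(\<mu>)\<close> is the Blaschke factor at \<open>\<mu>\<close> times a bounded
  function, and the bound does not depend on \<open>\<mu>\<close>.
\<close>

lemma div_quot_Blaschke_bound:
  assumes g: "g \<in> Hinf B" and \<mu>: "\<mu> \<in> \<D>" and B: "0 < B"
  shows "(\<lambda>w. (1 - cnj \<mu> * w) * div_quot g \<mu> w) \<in> Hinf (3 * B)"
proof (rule HinfI)
  let ?h = "\<lambda>w. (1 - cnj \<mu> * w) * div_quot g \<mu> w"
  show hol: "?h holomorphic_on \<D>"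
    by (intro holomorphic_intros div_quot_holo Hinf_holo[OF g])
  have 1: "norm (?h w) \<le> 3 * B" if "w \<in> \<D>" "w \<noteq> \<mu>" for w
  proof -
    have "norm (?h w) = norm (g w - g \<mu>) * norm (1 - cnj \<mu> * w) / norm (w - \<mu>)"
      using that(2) by (simp add: div_quot_def norm_mult norm_divide)
    also have "\<dots> \<le> 3 * B"
      using Schwarz_Pick_difference[OF g \<mu> that(1) B] that(2) by (subst pos_divide_le_eq) auto
    finally show ?thesis .
  qed
  fix w assume w: "w \<in> \<D>"
  have "isCont ?h w"
    using holomorphic_on_imp_continuous_on[OF hol] w
    by (simp add: continuous_on_eq_continuous_at)
  hence lim: "((\<lambda>w. norm (?h w)) \<longlongrightarrow> norm (?h w)) (at w)"
    by (intro tendsto_norm) (simp add: isCont_def)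
  show "norm (?h w) \<le> 3 * B"
  proof (cases "w = \<mu>")
    \<comment> \<open>At the removable singularity itself the bound follows by continuity.\<close>
    case True
    have "\<forall>\<^sub>F v in at w. v \<in> \<D> \<and> v \<noteq> w"
      using w eventually_at_in_open'[of \<D> w] by (auto simp: eventually_at_filter elim: eventually_mono)
    hence "\<forall>\<^sub>F v in at w. norm (?h v) \<le> 3 * B"
      using 1 True by (auto elim: eventually_mono)
    thus ?thesis by (rule tendsto_upperbound[OF lim]) auto
  qed (use 1 w in auto)
qed

lemma div_quot_Hinf:
  assumes g: "g \<in> Hinf B" and \<mu>: "\<mu> \<in> \<D>" and B: "0 < B"
  shows "div_quot g \<mu> \<in> Hinf (3 * B / (1 - norm \<mu>))"
proof (rule HinfI)
  show "div_quot g \<mu> holomorphic_on \<D>" by (rule div_quot_holo[OF Hinf_holo[OF g]])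
  fix w assume w: "w \<in> \<D>"
  have "(1 - norm \<mu>) * norm (div_quot g \<mu> w) \<le> norm (1 - cnj \<mu> * w) * norm (div_quot g \<mu> w)"
    by (intro mult_right_mono norm_one_minus_cnj_mult_ge \<mu> w) auto
  also have "\<dots> \<le> 3 * B"
    using Hinf_bound[OF div_quot_Blaschke_bound[OF assms] w] by (simp add: norm_mult)
  finally show "norm (div_quot g \<mu> w) \<le> 3 * B / (1 - norm \<mu>)"
    using \<mu> by (simp add: field_simps)
qed

text \<open>
  Dividing by \<open>w - \<mu>\<close> twice gives a Taylor estimate whose constant depends only on \<open>B\<close> and
  \<open>\<mu>\<close>. Its uniformity over a bounded family of functions is what Osgood's lemma uses.
\<close>

lemma quadratic_remainder:
  assumes g: "g \<in> Hinf B" and \<mu>: "\<mu> \<in> \<D>" and B: "0 < B" and w: "w \<in> \<D>"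
  shows "norm (g w - g \<mu> - deriv g \<mu> * (w - \<mu>)) \<le> 9 * B / (1 - norm \<mu>)\<^sup>2 * (norm (w - \<mu>))\<^sup>2"
proof -
  have pos: "0 < 3 * B / (1 - norm \<mu>)" using B \<mu> by auto
  have "g w - g \<mu> = (w - \<mu>) * div_quot g \<mu> w"
    by (subst div_quot_eq[of g w \<mu>]) simp
  also have "div_quot g \<mu> w = deriv g \<mu> + (w - \<mu>) * div_quot (div_quot g \<mu>) \<mu> w"
    by (subst div_quot_eq[of _ w \<mu>]) (simp add: div_quot_def)
  finally have "g w - g \<mu> - deriv g \<mu> * (w - \<mu>) = (w - \<mu>)\<^sup>2 * div_quot (div_quot g \<mu>) \<mu> w"
    by (simp add: algebra_simps power2_eq_square)
  hence "norm (g w - g \<mu> - deriv g \<mu> * (w - \<mu>))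
         = (norm (w - \<mu>))\<^sup>2 * norm (div_quot (div_quot g \<mu>) \<mu> w)"
    by (simp add: norm_mult norm_power)
  also have "\<dots> \<le> (norm (w - \<mu>))\<^sup>2 * (3 * (3 * B / (1 - norm \<mu>)) / (1 - norm \<mu>))"
    by (intro mult_left_mono Hinf_bound[OF div_quot_Hinf[OF div_quot_Hinf[OF g \<mu> B] \<mu> pos] w]) auto
  finally show ?thesis by (simp add: power2_eq_square mult.commute)
qed

section \<open>Bounded holomorphic functions on the bidisc\<close>

text \<open>
  Separate holomorphy is stable under all constructions below in an obvious way, Frechet
  differentiability is not; Osgood's lemma makes the two interchangeable for bounded functions.
\<close>

definition sep_Hinf :: "real \<Rightarrow> (complex \<times> complex \<Rightarrow> complex) set" where
  "sep_Hinf B = {f. (\<forall>w\<in>\<D>. (\<lambda>z. f (z, w)) \<in> Hinf B) \<and> (\<forall>z\<in>\<D>. (\<lambda>w. f (z, w)) \<in> Hinf B)}"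

text \<open>
  The difference quotients in the first variable converge uniformly in \<open>w\<close>, by the quadratic
  remainder estimate, and they are holomorphic in \<open>w\<close>.
\<close>

lemma deriv_fst_holo:
  assumes f: "f \<in> sep_Hinf B" and a: "a \<in> \<D>" and B: "0 < B"
  shows "(\<lambda>w. deriv (\<lambda>z. f (z, w)) a) holomorphic_on \<D>"
proof (rule holomorphic_uniform_sequence[OF open_ball])
  define C where "C = 9 * B / (1 - norm a)\<^sup>2"
  \<comment> \<open>steps tending to zero that stay inside the disc when started from \<open>a\<close>\<close>
  define t where "t = (\<lambda>n. complex_of_real ((1 - norm a) / real (n + 2)))"
  have t: "t n \<noteq> 0" "a + t n \<in> \<D>" for n
  proof -
    have "c / real (n + 2) < c" if "c > 0" for c :: real
      using that by (simp add: divide_less_eq)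
    hence "(1 - norm a) / real (n + 2) < 1 - norm a" using a by simp
    moreover have n: "norm (t n) = (1 - norm a) / real (n + 2)" 
      unfolding t_def norm_of_real using a by (simp add: abs_of_pos)
    ultimately show "a + t n \<in> \<D>" using norm_triangle_ineq[of a "t n"] by simp
    show "t n \<noteq> 0" unfolding t_def of_real_eq_0_iff using a by simp
  qed
  show "(\<lambda>w. (f (a + t n, w) - f (a, w)) / t n) holomorphic_on \<D>" for n
    using f a t(2)[of n] t(1)[of n] by (auto simp: sep_Hinf_def Hinf_def intro!: holomorphic_intros)
  have est: "norm ((f (a + t n, w) - f (a, w)) / t n - deriv (\<lambda>z. f (z, w)) a) \<le> C * norm (t n)"
    if w: "w \<in> \<D>" for n w
  proof -
    have "norm (f (a + t n, w) - f (a, w) - deriv (\<lambda>z. f (z, w)) a * t n) \<le> C * (norm (t n))\<^sup>2"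
      using quadratic_remainder[of "\<lambda>z. f (z, w)" B a "a + t n"] f a B t(2) w
      by (simp add: sep_Hinf_def C_def)
    moreover have "(f (a + t n, w) - f (a, w)) / t n - deriv (\<lambda>z. f (z, w)) a =
        (f (a + t n, w) - f (a, w) - deriv (\<lambda>z. f (z, w)) a * t n) / t n"
      using t(1)[of n] by (simp add: field_simps)
    ultimately show ?thesis using t(1)[of n]
      by (simp add: norm_divide divide_le_eq power2_eq_square mult.assoc)
  qed
  have lim: "(\<lambda>n. C * norm (t n)) \<longlonglongrightarrow> 0"
    unfolding t_def norm_of_real
    by (intro tendsto_mult_right_zero tendsto_rabs_zero LIMSEQ_ignore_initial_segment[OF lim_const_over_n])
  fix x assume x: "x \<in> \<D>"
  then obtain d where d: "d > 0" "cball x d \<subseteq> \<D>" using open_contains_cball[of \<D>] by (meson open_ball)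
  have "uniform_limit (cball x d) (\<lambda>n w. (f (a + t n, w) - f (a, w)) / t n)
        (\<lambda>w. deriv (\<lambda>z. f (z, w)) a) sequentially"
  proof (rule uniform_limitI)
    fix e :: real assume "e > 0"
    hence "\<forall>\<^sub>F n in sequentially. C * norm (t n) < e"
      using order_tendstoD(2)[OF lim] by auto
    thus "\<forall>\<^sub>F n in sequentially. \<forall>w\<in>cball x d.
        dist ((f (a + t n, w) - f (a, w)) / t n) (deriv (\<lambda>z. f (z, w)) a) < e"
      by eventually_elim (unfold dist_norm, use est d(2) in \<open>meson le_less_trans subsetD\<close>)
  qed
  thus "\<exists>d>0. cball x d \<subseteq> \<D> \<and> uniform_limit (cball x d) (\<lambda>n w. (f (a + t n, w) - f (a, w)) / t n)
        (\<lambda>w. deriv (\<lambda>z. f (z, w)) a) sequentially" using d by blast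
qed

text \<open>
  The increment splits into a Taylor remainder in \<open>z\<close> at height \<open>w\<close>, a Taylor remainder in
  \<open>w\<close>, and the variation of the partial derivative \<open>\<alpha>\<close> times \<open>z - a\<close>. The remainders are
  quadratic, uniformly, and \<open>\<alpha>\<close> is continuous because it is holomorphic.
\<close>

lemma Osgood_bidisc:
  assumes f: "f \<in> sep_Hinf B" and B: "0 < B"
  shows "f \<in> Hinf2"
proof -
  have "\<exists>\<alpha> \<beta>. (f has_derivative (\<lambda>(h, k). \<alpha> * h + \<beta> * k)) (at (a, b))"
    if a: "a \<in> \<D>" and b: "b \<in> \<D>" for a b
  proof -
    define \<alpha> where "\<alpha> = (\<lambda>w. deriv (\<lambda>z. f (z, w)) a)"
    define \<beta> where "\<beta> = deriv (\<lambda>w. f (a, w)) b"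
    define C where "C = 9 * B / (1 - norm a)\<^sup>2 + 9 * B / (1 - norm b)\<^sup>2"
    have C0: "9 * B / (1 - norm a)\<^sup>2 \<ge> 0" "9 * B / (1 - norm b)\<^sup>2 \<ge> 0" using B by auto
    have cont: "isCont \<alpha> b"
      using holomorphic_on_imp_continuous_on[OF deriv_fst_holo[OF f a B]] b
      by (simp add: \<alpha>_def continuous_on_eq_continuous_at)
    have main: "norm (f y - f (a, b) - (case y - (a, b) of (h, k) \<Rightarrow> \<alpha> b * h + \<beta> * k))
          \<le> (C * norm (y - (a, b)) + norm (\<alpha> (snd y) - \<alpha> b)) * norm (y - (a, b))"
      if y: "y \<in> \<D> \<times> \<D>" for y
    proof -
      obtain z w where yzw: "y = (z, w)" by (cases y)
      have zw: "z \<in> \<D>" "w \<in> \<D>" using y yzw by auto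
      let ?N = "norm (y - (a, b))"
      have h: "norm (z - a) \<le> ?N" and k: "norm (w - b) \<le> ?N"
        using norm_fst_le[of "z - a" "w - b"] norm_snd_le[of "w - b" "z - a"] by (auto simp: yzw)
      have "norm (f (z, w) - f (a, w) - \<alpha> w * (z - a)) \<le> 9 * B / (1 - norm a)\<^sup>2 * (norm (z - a))\<^sup>2"
        unfolding \<alpha>_def using f zw by (intro quadratic_remainder a B) (auto simp: sep_Hinf_def)
      also have "\<dots> \<le> 9 * B / (1 - norm a)\<^sup>2 * ?N\<^sup>2"
        by (intro mult_left_mono power_mono h C0) auto
      finally have e1: "norm (f (z, w) - f (a, w) - \<alpha> w * (z - a)) \<le> 9 * B / (1 - norm a)\<^sup>2 * ?N\<^sup>2" .
      have "norm (f (a, w) - f (a, b) - \<beta> * (w - b)) \<le> 9 * B / (1 - norm b)\<^sup>2 * (norm (w - b))\<^sup>2"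
        unfolding \<beta>_def using f zw a by (intro quadratic_remainder[where g = "\<lambda>w. f (a, w)"] b B) (auto simp: sep_Hinf_def)
      also have "\<dots> \<le> 9 * B / (1 - norm b)\<^sup>2 * ?N\<^sup>2"
        by (intro mult_left_mono power_mono k C0) auto
      finally have e2: "norm (f (a, w) - f (a, b) - \<beta> * (w - b)) \<le> 9 * B / (1 - norm b)\<^sup>2 * ?N\<^sup>2" .
      have e3: "norm ((\<alpha> w - \<alpha> b) * (z - a)) \<le> norm (\<alpha> w - \<alpha> b) * ?N"
        by (simp add: norm_mult mult_left_mono h)
      have "f y - f (a, b) - (case y - (a, b) of (h, k) \<Rightarrow> \<alpha> b * h + \<beta> * k) =
         (f (z, w) - f (a, w) - \<alpha> w * (z - a)) + (f (a, w) - f (a, b) - \<beta> * (w - b)) + (\<alpha> w - \<alpha> b) * (z - a)"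
        by (simp add: yzw algebra_simps)
      also have "norm \<dots> \<le> norm (f (z, w) - f (a, w) - \<alpha> w * (z - a))
           + norm (f (a, w) - f (a, b) - \<beta> * (w - b)) + norm ((\<alpha> w - \<alpha> b) * (z - a))"
        by (intro order_trans[OF norm_triangle_ineq] add_right_mono norm_triangle_ineq)
      also have "\<dots> \<le> (C * ?N + norm (\<alpha> w - \<alpha> b)) * ?N"
        using e1 e2 e3 unfolding C_def by (simp add: algebra_simps power2_eq_square)
      finally show ?thesis by (simp add: yzw)
    qed
    have lim: "((\<lambda>y. C * norm (y - (a, b)) + norm (\<alpha> (snd y) - \<alpha> b)) \<longlongrightarrow> 0) (nhds (a, b))"
    proof -
      define F where "F = (\<lambda>y. C * norm (y - (a, b)) + norm (\<alpha> (snd y) - \<alpha> b))"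
      have "isCont F (a, b)" unfolding F_def
        by (intro continuous_intros isCont_o2[where g = \<alpha> and f = snd]) (use cont in auto)
      hence "(F \<longlongrightarrow> F (a, b)) (nhds (a, b))"
        by (simp only: isCont_def tendsto_at_iff_tendsto_nhds)
      thus ?thesis by (simp add: F_def)
    qed
    have "(f has_derivative (\<lambda>(h, k). \<alpha> b * h + \<beta> * k)) (at (a, b))"
      unfolding has_derivative_at_alt
    proof (intro conjI allI impI)
      show "bounded_linear (\<lambda>(h, k). \<alpha> b * h + \<beta> * k)"
        unfolding case_prod_beta
        by (intro bounded_linear_add bounded_linear_const_mult bounded_linear_fst bounded_linear_snd)
      fix e :: real assume "e > 0"
      hence "\<forall>\<^sub>F y in nhds (a, b). C * norm (y - (a, b)) + norm (\<alpha> (snd y) - \<alpha> b) < e"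
        using order_tendstoD(2)[OF lim] by auto
      moreover have "\<forall>\<^sub>F y in nhds (a, b). y \<in> \<D> \<times> \<D>"
        using a b by (intro eventually_nhds_in_open open_Times) auto
      ultimately have "\<forall>\<^sub>F y in nhds (a, b). norm (f y - f (a, b) - (case y - (a, b) of (h, k) \<Rightarrow> \<alpha> b * h + \<beta> * k))
            \<le> e * norm (y - (a, b))"
      proof eventually_elim
        case (elim y)
        show ?case using main[OF elim(2)] elim(1)
          by (meson less_imp_le mult_right_mono norm_ge_zero order_trans)
      qed
      then obtain d where "d > 0" "\<And>y. dist y (a, b) < d \<Longrightarrow>
         norm (f y - f (a, b) - (case y - (a, b) of (h, k) \<Rightarrow> \<alpha> b * h + \<beta> * k)) \<le> e * norm (y - (a, b))"
        unfolding eventually_nhds_metric by auto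
      thus "\<exists>d>0. \<forall>y. norm (y - (a, b)) < d \<longrightarrow>
         norm (f y - f (a, b) - (case y - (a, b) of (h, k) \<Rightarrow> \<alpha> b * h + \<beta> * k)) \<le> e * norm (y - (a, b))"
        by (auto simp: dist_norm)
    qed
    thus ?thesis by blast
  qed
  moreover have "bounded (f ` (\<D> \<times> \<D>))"
    using f unfolding bounded_iff by (auto simp: sep_Hinf_def Hinf_def)
  ultimately show ?thesis by (auto simp: Hinf2_def)
qed

lemma Hinf2_iff_sep: "f \<in> Hinf2 \<longleftrightarrow> (\<exists>B>0. f \<in> sep_Hinf B)"
proof
  assume f: "f \<in> Hinf2"
  then obtain B where B: "B > 0" "\<And>p. p \<in> \<D> \<times> \<D> \<Longrightarrow> norm (f p) \<le> B"
    unfolding Hinf2_def bounded_pos by auto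
  have d: "\<exists>\<alpha> \<beta>. (f has_derivative (\<lambda>(h, k). \<alpha> * h + \<beta> * k)) (at (z, w))" if "z \<in> \<D>" "w \<in> \<D>" for z w
    using f that by (auto simp: Hinf2_def)
  have "(\<lambda>z. f (z, w)) field_differentiable at z" "(\<lambda>w. f (z, w)) field_differentiable at w"
    if zw: "z \<in> \<D>" "w \<in> \<D>" for z w
  proof -
    obtain \<alpha> \<beta> where ab: "(f has_derivative (\<lambda>(h, k). \<alpha> * h + \<beta> * k)) (at (z, w))" using d[OF zw] by blast
    have "((\<lambda>z. f (z, w)) has_derivative (\<lambda>h. (\<lambda>(h, k). \<alpha> * h + \<beta> * k) (h, 0))) (at z)"
      by (rule has_derivative_compose[where f = "\<lambda>z. (z, w)" and g = f])
         (auto intro!: derivative_eq_intros ab)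
    thus "(\<lambda>z. f (z, w)) field_differentiable at z"
      by (auto simp: field_differentiable_def has_field_derivative_def intro!: exI[of _ \<alpha>])
    have "((\<lambda>w. f (z, w)) has_derivative (\<lambda>k. (\<lambda>(h, k). \<alpha> * h + \<beta> * k) (0, k))) (at w)"
      by (rule has_derivative_compose[where f = "\<lambda>w. (z, w)" and g = f])
         (auto intro!: derivative_eq_intros ab)
    thus "(\<lambda>w. f (z, w)) field_differentiable at w"
      by (auto simp: field_differentiable_def has_field_derivative_def intro!: exI[of _ \<beta>])
  qed
  hence "(\<lambda>z. f (z, w)) holomorphic_on \<D>" "(\<lambda>w. f (z, w)) holomorphic_on \<D>" if "z \<in> \<D>" "w \<in> \<D>" for z w
    using that by (meson field_differentiable_at_within holomorphic_on_def)+
  hence "f \<in> sep_Hinf B"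
    unfolding sep_Hinf_def Hinf_def using B(2) centre_in_ball by (simp del: mem_ball)
  thus "\<exists>B>0. f \<in> sep_Hinf B" using B by blast
qed (use Osgood_bidisc in blast)

lemma sep_Hinf_mono: "f \<in> sep_Hinf B \<Longrightarrow> B \<le> B' \<Longrightarrow> f \<in> sep_Hinf B'"
  by (auto simp: sep_Hinf_def Hinf_def intro: order_trans)

lemma Hinf2_sepI:
  assumes "f \<in> sep_Hinf B" shows "f \<in> Hinf2"
  using Osgood_bidisc[OF sep_Hinf_mono[OF assms, of "max B 1"]] by simp

lemma Hinf2_obtain:
  assumes "f \<in> Hinf2"
  obtains B where "B > 0" "f \<in> sep_Hinf B" "\<And>z w. z \<in> \<D> \<Longrightarrow> w \<in> \<D> \<Longrightarrow> norm (f (z, w)) \<le> B"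
proof -
  obtain B where B: "B > 0" "f \<in> sep_Hinf B" using assms Hinf2_iff_sep by blast
  moreover have "\<And>z w. z \<in> \<D> \<Longrightarrow> w \<in> \<D> \<Longrightarrow> norm (f (z, w)) \<le> B"
    using B(2) by (auto simp: sep_Hinf_def Hinf_def)
  ultimately show ?thesis using that by blast
qed

lemma Hinf2_add [intro]: "f \<in> Hinf2 \<Longrightarrow> g \<in> Hinf2 \<Longrightarrow> (\<lambda>p. f p + g p) \<in> Hinf2"
  and Hinf2_mult [intro]: "f \<in> Hinf2 \<Longrightarrow> g \<in> Hinf2 \<Longrightarrow> (\<lambda>p. f p * g p) \<in> Hinf2"
proof -
  assume f: "f \<in> Hinf2" and g: "g \<in> Hinf2"
  obtain B where B: "B > 0" "f \<in> sep_Hinf B" using f Hinf2_iff_sep by blast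
  obtain C where C: "C > 0" "g \<in> sep_Hinf C" using g Hinf2_iff_sep by blast
  have "(\<lambda>p. f p + g p) \<in> sep_Hinf (B + C)"
    using B(2) C(2) by (auto simp: sep_Hinf_def Hinf_def intro!: holomorphic_intros norm_triangle_mono)
  thus "(\<lambda>p. f p + g p) \<in> Hinf2" by (rule Hinf2_sepI)
  have "(\<lambda>p. f p * g p) \<in> sep_Hinf (B * C)"
    using B C by (auto simp: sep_Hinf_def Hinf_def norm_mult intro!: holomorphic_intros mult_mono)
  thus "(\<lambda>p. f p * g p) \<in> Hinf2" by (rule Hinf2_sepI)
qed

lemma Hinf2_const [intro]: "(\<lambda>p. c) \<in> Hinf2"
  by (rule Hinf2_sepI[of _ "norm c"]) (auto simp: sep_Hinf_def Hinf_def)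

lemma Hinf2_uminus [intro]: "f \<in> Hinf2 \<Longrightarrow> (\<lambda>p. - f p) \<in> Hinf2"
  using Hinf2_mult[OF Hinf2_const[of "-1"], of f] by simp

lemma Hinf2_diff [intro]: "f \<in> Hinf2 \<Longrightarrow> g \<in> Hinf2 \<Longrightarrow> (\<lambda>p. f p - g p) \<in> Hinf2"
  using Hinf2_add[of f "\<lambda>p. - g p"] by auto

lemma Hinf2_fst_comp: "g \<in> Hinf B \<Longrightarrow> (\<lambda>p. g (fst p)) \<in> Hinf2"
  by (rule Hinf2_sepI[of _ B]) (auto simp: sep_Hinf_def Hinf_def)

lemma Hinf2_snd_comp: "g \<in> Hinf B \<Longrightarrow> (\<lambda>p. g (snd p)) \<in> Hinf2"
  by (rule Hinf2_sepI[of _ B]) (auto simp: sep_Hinf_def Hinf_def)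

lemma Hinf2_fst [intro]: "fst \<in> Hinf2" and Hinf2_snd [intro]: "snd \<in> Hinf2"
  using Hinf2_fst_comp[of "\<lambda>z. z" 1] Hinf2_snd_comp[of "\<lambda>z. z" 1] by (auto simp: Hinf_def less_imp_le)

lemma Hinf2_swap: "f \<in> Hinf2 \<Longrightarrow> (\<lambda>(z, w). f (w, z)) \<in> Hinf2"
  unfolding Hinf2_iff_sep by (auto simp: sep_Hinf_def)

lemma Hinf2_sum [intro]: "(\<And>i. i \<in> A \<Longrightarrow> f i \<in> Hinf2) \<Longrightarrow> (\<lambda>p. \<Sum>i\<in>A. f i p) \<in> Hinf2"
  by (induction A rule: infinite_finite_induct) auto

lemma Hinf2_prod [intro]: "(\<And>i. i \<in> A \<Longrightarrow> f i \<in> Hinf2) \<Longrightarrow> (\<lambda>p. \<Prod>i\<in>A. f i p) \<in> Hinf2"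
  by (induction A rule: infinite_finite_induct) auto

text \<open>
  Both directions of separate holomorphy are at hand: in \<open>z\<close> by removal of the singularity, in
  \<open>w\<close> for \<open>z = l\<close> because the partial derivative is holomorphic.
\<close>

lemma Hinf2_div_quot_fst:
  assumes f: "f \<in> Hinf2" and l: "l \<in> \<D>"
  shows "(\<lambda>(z, w). div_quot (\<lambda>z. f (z, w)) l z) \<in> Hinf2"
proof -
  obtain B where B: "B > 0" "f \<in> sep_Hinf B" by (rule Hinf2_obtain[OF f])
  have 1: "div_quot (\<lambda>z. f (z, w)) l \<in> Hinf (3 * B / (1 - norm l))" if "w \<in> \<D>" for w
    using B(2) that by (intro div_quot_Hinf l B) (auto simp: sep_Hinf_def)
  have "(\<lambda>w. div_quot (\<lambda>z. f (z, w)) l z) holomorphic_on \<D>" if z: "z \<in> \<D>" for z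
  proof (cases "z = l")
    case True
    thus ?thesis using deriv_fst_holo[OF B(2) l B(1)] by (simp add: div_quot_def)
  next
    case False
    thus ?thesis using B(2) z l by (auto simp: div_quot_def sep_Hinf_def Hinf_def intro!: holomorphic_intros)
  qed
  hence "(\<lambda>(z, w). div_quot (\<lambda>z. f (z, w)) l z) \<in> sep_Hinf (3 * B / (1 - norm l))"
    using 1 by (auto simp: sep_Hinf_def Hinf_def)
  thus ?thesis by (rule Hinf2_sepI)
qed

lemma Hinf2_div_quot_snd:
  assumes f: "f \<in> Hinf2" and m: "m \<in> \<D>"
  shows "(\<lambda>(z, w). div_quot (\<lambda>w. f (z, w)) m w) \<in> Hinf2"
  using Hinf2_swap[OF Hinf2_div_quot_fst[OF Hinf2_swap[OF f] m]] by (simp add: case_prod_unfold)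

text \<open>
  Gleason's problem for the bidisc: move first from \<open>z\<close> to \<open>l\<close> along the slice at height \<open>w\<close>,
  then from \<open>w\<close> to \<open>m\<close> along the slice over \<open>l\<close>, and divide each increment.
\<close>

lemma Gleason_bidisc:
  assumes f: "f \<in> Hinf2" and l: "l \<in> \<D>" and m: "m \<in> \<D>"
  obtains g h where "g \<in> Hinf2" "h \<in> Hinf2"
    "\<And>z w. z \<in> \<D> \<Longrightarrow> w \<in> \<D> \<Longrightarrow> f (z, w) = f (l, m) + (z - l) * g (z, w) + (w - m) * h (z, w)"
proof (rule that[OF Hinf2_div_quot_fst[OF f l]])
  obtain B where B: "B > 0" "f \<in> sep_Hinf B" by (rule Hinf2_obtain[OF f])
  have "(\<lambda>w. f (l, w)) \<in> Hinf B" using B(2) l by (auto simp: sep_Hinf_def)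
  from Hinf2_snd_comp[OF div_quot_Hinf[OF this m B(1)]]
  show "(\<lambda>p. div_quot (\<lambda>w. f (l, w)) m (snd p)) \<in> Hinf2" .
  show "f (z, w) = f (l, m) + (z - l) * (\<lambda>(z, w). div_quot (\<lambda>z. f (z, w)) l z) (z, w)
      + (w - m) * div_quot (\<lambda>w. f (l, w)) m (snd (z, w))" for z w
    using div_quot_eq[of "\<lambda>z. f (z, w)" z l] div_quot_eq[of "\<lambda>w. f (l, w)" w m] by simp
qed

section \<open>Taylor coefficients\<close>

lemma taylor_coeff_cong:
  assumes "f holomorphic_on \<D>" "\<And>z. z \<in> \<D> \<Longrightarrow> f z = g z"
  shows "taylor_coeff f n = taylor_coeff g n"
proof -
  have "g holomorphic_on \<D>" using assms holomorphic_cong by blast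
  thus ?thesis unfolding taylor_coeff_def
    using higher_deriv_transform_within_open[of f \<D> g 0 n] assms by simp
qed

lemma taylor_sums:
  assumes "f holomorphic_on \<D>" "z \<in> \<D>"
  shows "(\<lambda>n. taylor_coeff f n * z ^ n) sums f z"
  using holomorphic_power_series[OF assms] by (simp add: taylor_coeff_def)

lemma taylor_coeff_add:
  assumes "f holomorphic_on \<D>" "g holomorphic_on \<D>"
  shows "taylor_coeff (\<lambda>z. f z + g z) n = taylor_coeff f n + taylor_coeff g n"
  using higher_deriv_add[OF assms, of 0 n] by (simp add: taylor_coeff_def add_divide_distrib)

lemma taylor_coeff_mult:
  assumes "f holomorphic_on \<D>" "g holomorphic_on \<D>"
  shows "taylor_coeff (\<lambda>z. f z * g z) n = (\<Sum>i\<le>n. taylor_coeff f i * taylor_coeff g (n - i))"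
proof -
  have "taylor_coeff (\<lambda>z. f z * g z) n =
      (\<Sum>i\<le>n. of_nat (n choose i) * (deriv ^^ i) f 0 * (deriv ^^ (n - i)) g 0 / fact n)"
    using higher_deriv_mult[OF assms, of 0 n]
    by (simp add: taylor_coeff_def atMost_atLeast0 sum_divide_distrib)
  also have "\<dots> = (\<Sum>i\<le>n. taylor_coeff f i * taylor_coeff g (n - i))"
  proof (rule sum.cong[OF refl])
    fix i assume "i \<in> {..n}"
    hence "of_nat (n choose i) = (fact n / (fact i * fact (n - i)) :: complex)"
      by (intro binomial_fact) simp
    thus "of_nat (n choose i) * (deriv ^^ i) f 0 * (deriv ^^ (n - i)) g 0 / fact n =
        taylor_coeff f i * taylor_coeff g (n - i)"
      by (simp add: taylor_coeff_def)
  qed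
  finally show ?thesis .
qed

lemma taylor_coeff_const: "taylor_coeff (\<lambda>z. c) n = (if n = 0 then c else 0)"
  by (simp add: taylor_coeff_def)

lemma taylor_coeff_ident: "taylor_coeff (\<lambda>z. z) n = (if n = 1 then 1 else 0)"
  by (simp add: taylor_coeff_def)

lemma taylor_coeff_cmult:
  assumes "f holomorphic_on \<D>"
  shows "taylor_coeff (\<lambda>z. c * f z) n = c * taylor_coeff f n"
  using higher_deriv_cmult[OF assms, of 0 n c] by (simp add: taylor_coeff_def)

lemma taylor_coeff_ident_mult:
  assumes "f holomorphic_on \<D>"
  shows "taylor_coeff (\<lambda>z. z * f z) n = (if n = 0 then 0 else taylor_coeff f (n - 1))"
proof -
  have "taylor_coeff (\<lambda>z. z * f z) n = (\<Sum>i\<le>n. taylor_coeff (\<lambda>z. z) i * taylor_coeff f (n - i))"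
    by (intro taylor_coeff_mult assms holomorphic_intros)
  also have "\<dots> = (\<Sum>i\<le>n. if i = 1 then taylor_coeff f (n - 1) else 0)"
    by (intro sum.cong refl) (simp add: taylor_coeff_ident)
  also have "\<dots> = (if n = 0 then 0 else taylor_coeff f (n - 1))"
    by (cases n) (auto simp: sum.delta)
  finally show ?thesis .
qed

text \<open>
  Division by the coordinate shifts the coefficients, so a statement about all Taylor coefficients
  reduces by induction to the constant term.
\<close>

lemma taylor_coeff_Suc:
  assumes g: "g holomorphic_on \<D>"
  shows "taylor_coeff g (Suc n) = taylor_coeff (div_quot g 0) n"
proof -
  have "taylor_coeff g (Suc n) = taylor_coeff (\<lambda>w. g 0 + w * div_quot g 0 w) (Suc n)"
    by (rule taylor_coeff_cong[OF g], rule trans[OF div_quot_eq[of g _ 0]]) simp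
  also have "\<dots> = taylor_coeff (div_quot g 0) n"
    using div_quot_holo[OF g, of 0]
    by (subst taylor_coeff_add) (auto simp: taylor_coeff_const taylor_coeff_ident_mult intro!: holomorphic_intros)
  finally show ?thesis .
qed

lemma taylor_coeff_dilate:
  assumes g: "g holomorphic_on \<D>" and \<rho>: "norm \<rho> \<le> 1"
  shows "taylor_coeff (\<lambda>w. g (\<rho> * w)) n = \<rho> ^ n * taylor_coeff g n"
proof -
  have "\<rho> * w \<in> \<D>" if "w \<in> \<D>" for w
    using that \<rho> mult_left_le_one_le[of "norm w" "norm \<rho>"] by (simp add: norm_mult)
  from higher_deriv_compose_linear[OF g open_ball[of 0 1] open_ball[of 0 1] _ this, of 0 n]
  show ?thesis by (simp add: taylor_coeff_def)
qed

lemma norm_taylor_coeff_le: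
  assumes g: "g \<in> Hinf B" and r: "0 < r" "r < 1"
  shows "norm (taylor_coeff g n) \<le> B / r ^ n"
proof -
  have sub: "cball 0 r \<subseteq> \<D>" using r by auto
  have "norm ((deriv ^^ n) g 0) \<le> fact n * B / r ^ n"
  proof (rule Cauchy_inequality)
    show "g holomorphic_on ball 0 r" using Hinf_holo[OF g] sub by (meson ball_subset_cball holomorphic_on_subset subset_trans)
    show "continuous_on (cball 0 r) g"
      using Hinf_holo[OF g] sub by (meson holomorphic_on_imp_continuous_on holomorphic_on_subset)
    show "norm (g x) \<le> B" if "norm (0 - x) = r" for x using Hinf_bound[OF g, of x] that r by simp
  qed (use r in auto)
  from divide_right_mono[OF this, of "fact n"] show ?thesis by (simp add: taylor_coeff_def norm_divide)
qed

lemma taylor_coeff_summable: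
  assumes g: "g holomorphic_on \<D>" and r: "0 \<le> r" "r < 1"
  shows "summable (\<lambda>n. norm (taylor_coeff g n) * r ^ n)"
proof -
  define s where "s = complex_of_real ((1 + r) / 2)"
  have "summable (\<lambda>n. taylor_coeff g n * s ^ n)"
    using taylor_sums[OF g, of s] r by (auto simp: s_def sums_iff simp del: of_real_add of_real_divide)
  hence "summable (\<lambda>n. norm (taylor_coeff g n * complex_of_real r ^ n))"
    by (rule powser_insidea) (use r in \<open>simp add: s_def del: of_real_add of_real_divide\<close>)
  thus ?thesis using r by (simp add: norm_mult norm_power)
qed

section \<open>The functional calculus of a matrix with spectrum in the disc\<close>

text \<open>
  A Schur stable matrix is one whose spectral radius is less than one, so that the Taylor series of
  any function holomorphic on the disc converges at it.
\<close>

definition Schur_stable :: "nat \<Rightarrow> complex mat \<Rightarrow> bool" where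
  "Schur_stable d A \<longleftrightarrow> A \<in> carrier_mat d d \<and> spectrum A \<subseteq> \<D>"

lemma mat_mult_entry:
  assumes "A \<in> carrier_mat d d" "B \<in> carrier_mat d d" "i < d" "j < d"
  shows "(A * B) $$ (i, j) = (\<Sum>l<d. A $$ (i, l) * B $$ (l, j))"
  using assms by (simp add: scalar_prod_def atLeast0LessThan)

lemma mat_vec_entry:
  assumes "A \<in> carrier_mat d d" "x \<in> carrier_vec d" "i < d"
  shows "(A *\<^sub>v x) $ i = (\<Sum>j<d. A $$ (i, j) * x $ j)"
  using assms by (simp add: scalar_prod_def atLeast0LessThan)

lemma smult_mat_vec:
  assumes "(A :: complex mat) \<in> carrier_mat d d" "x \<in> carrier_vec d"
  shows "(c \<cdot>\<^sub>m A) *\<^sub>v x = c \<cdot>\<^sub>v (A *\<^sub>v x)"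
  using assms by (intro eq_vecI) (auto simp: scalar_prod_def sum_distrib_left mult_ac)

lemma pow_smult_mat:
  assumes "(A :: complex mat) \<in> carrier_mat d d"
  shows "(c \<cdot>\<^sub>m A) ^\<^sub>m n = c ^ n \<cdot>\<^sub>m (A ^\<^sub>m n)"
proof (induction n)
  case 0
  show ?case using assms by (intro eq_matI) auto
next
  case (Suc n)
  have P: "A ^\<^sub>m n \<in> carrier_mat d d" using assms by simp
  have "(c \<cdot>\<^sub>m A) ^\<^sub>m Suc n = (c ^ n \<cdot>\<^sub>m (A ^\<^sub>m n)) * (c \<cdot>\<^sub>m A)" using Suc by simp
  also have "\<dots> = c \<cdot>\<^sub>m (c ^ n \<cdot>\<^sub>m (A ^\<^sub>m n * A))"
    using P assms by (simp add: mult_smult_assoc_mat[of _ d d _ d] mult_smult_distrib[of _ d d _ d])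
  also have "\<dots> = c ^ Suc n \<cdot>\<^sub>m (A ^\<^sub>m Suc n)"
    by (intro eq_matI) auto
  finally show ?case .
qed

lemma pow_mat_add:
  assumes "(A :: complex mat) \<in> carrier_mat d d"
  shows "A ^\<^sub>m (m + n) = A ^\<^sub>m m * A ^\<^sub>m n"
proof (induction n)
  case (Suc n)
  thus ?case using assms by (simp add: assoc_mult_mat[of _ d d _ d _ d])
qed (use assms in simp)

text \<open>
  Divide \<open>A\<close> by a number \<open>r\<close> strictly between its spectral radius and \<open>1\<close>. The quotient still
  has spectral radius less than one, hence bounded powers by its Jordan normal form.
\<close>

lemma Schur_stable_power_decay:
  assumes "Schur_stable d A"
  obtains C r where "0 < r" "r < 1" "0 \<le> C"
    "\<And>n i j. i < d \<Longrightarrow> j < d \<Longrightarrow> norm ((A ^\<^sub>m n) $$ (i, j)) \<le> C * r ^ n"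
proof (cases "d = 0")
  case True
  thus ?thesis using that[of "1/2" 0] by simp
next
  case False
  have A: "A \<in> carrier_mat d d" and sp: "spectrum A \<subseteq> \<D>" using assms by (auto simp: Schur_stable_def)
  note mx = spectral_radius_mem_max[OF A] 
  have \<rho>: "0 \<le> spectral_radius A" "spectral_radius A < 1" using mx(1) False sp by auto
  \<comment> \<open>midpoint between the spectral radius and one\<close>
  define r where "r = (1 + spectral_radius A) / 2"
  have r: "0 < r" "r < 1" "spectral_radius A < r" using \<rho> by (auto simp: r_def)
  define B where "B = complex_of_real (1 / r) \<cdot>\<^sub>m A"
  have B: "B \<in> carrier_mat d d" using A by (simp add: B_def)
  have "spectral_radius B < 1"
  proof -
    obtain k where k: "k \<in> spectrum B" "spectral_radius B = norm k"
      using spectral_radius_mem_max(1)[OF B] False by auto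
    then obtain v where v: "v \<in> carrier_vec d" "v \<noteq> 0\<^sub>v d" "B *\<^sub>v v = k \<cdot>\<^sub>v v"
      using B by (auto simp: spectrum_def eigenvalue_def eigenvector_def)
    have "complex_of_real (1 / r) \<cdot>\<^sub>v (A *\<^sub>v v) = k \<cdot>\<^sub>v v"
      using v(1,3) A by (simp add: B_def smult_mat_vec)
    hence "complex_of_real r \<cdot>\<^sub>v (complex_of_real (1 / r) \<cdot>\<^sub>v (A *\<^sub>v v)) = complex_of_real r \<cdot>\<^sub>v (k \<cdot>\<^sub>v v)"
      by simp
    hence "A *\<^sub>v v = (complex_of_real r * k) \<cdot>\<^sub>v v"
      using r by (simp add: smult_smult_assoc)
    hence "complex_of_real r * k \<in> spectrum A"
      using v(1,2) A by (auto simp: spectrum_def eigenvalue_def eigenvector_def)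
    hence "norm (complex_of_real r * k) \<le> spectral_radius A" using mx(2) False by auto
    hence "r * norm k \<le> spectral_radius A" using r by (simp add: norm_mult)
    hence "r * norm k < r * 1" using r by linarith
    hence "norm k < 1" using r(1) by (simp only: mult_less_cancel_left_pos)
    thus ?thesis using k(2) by simp
  qed
  moreover have "\<exists>n_as. jordan_nf B n_as"
    using char_poly_factorized[OF B] jordan_nf_exists[OF B] by blast
  ultimately obtain c where c: "\<And>k. norm_bound (B ^\<^sub>m k) c"
    using spectral_radius_jnf_norm_bound_less_1[OF B] by blast
  have bd: "norm ((A ^\<^sub>m n) $$ (i, j)) \<le> max c 0 * r ^ n" if "i < d" "j < d" for n i j
  proof -
    have P: "A ^\<^sub>m n \<in> carrier_mat d d" using A by simp
    hence "norm ((B ^\<^sub>m n) $$ (i, j)) = (1 / r) ^ n * norm ((A ^\<^sub>m n) $$ (i, j))"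
      using that r A by (simp add: B_def pow_smult_mat[OF A] norm_mult norm_power norm_divide)
    hence "norm ((A ^\<^sub>m n) $$ (i, j)) = r ^ n * norm ((B ^\<^sub>m n) $$ (i, j))"
      using r by (simp add: field_simps)
    moreover have "norm ((B ^\<^sub>m n) $$ (i, j)) \<le> c"
      using c[of n] that B by (simp add: norm_bound_def)
    ultimately have "norm ((A ^\<^sub>m n) $$ (i, j)) \<le> c * r ^ n"
      using r mult_right_mono[of "norm ((B ^\<^sub>m n) $$ (i, j))" c "r ^ n"] by (simp add: mult.commute)
    thus ?thesis using r by (meson max.cobounded1 mult_right_mono order_trans zero_le_power less_imp_le)
  qed
  show ?thesis using that[OF r(1,2) _ bd] by simp
qed

lemma mat_fun_carrier [simp]: "mat_fun d g A \<in> carrier_mat d d"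
  by (simp add: mat_fun_def)

lemma mat_fun_dim [simp]: "dim_row (mat_fun d g A) = d" "dim_col (mat_fun d g A) = d"
  by (simp_all add: mat_fun_def)

lemma mat_fun_entry:
  "i < d \<Longrightarrow> j < d \<Longrightarrow> mat_fun d g A $$ (i, j) = (\<Sum>n. taylor_coeff g n * (A ^\<^sub>m n) $$ (i, j))"
  by (simp add: mat_fun_def)

lemma mat_fun_summable:
  assumes "Schur_stable d A" "g holomorphic_on \<D>" "i < d" "j < d"
  shows "summable (\<lambda>n. norm (taylor_coeff g n * (A ^\<^sub>m n) $$ (i, j)))"
proof -
  obtain C r where C: "0 < r" "r < 1" "0 \<le> C"
    "\<And>n i j. i < d \<Longrightarrow> j < d \<Longrightarrow> norm ((A ^\<^sub>m n) $$ (i, j)) \<le> C * r ^ n"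
    by (rule Schur_stable_power_decay[OF assms(1)]) blast
  have "summable (\<lambda>n. C * (norm (taylor_coeff g n) * r ^ n))"
    using C by (intro summable_mult taylor_coeff_summable assms) auto
  thus ?thesis
  proof (rule summable_comparison_test[rotated], intro exI[of _ 0] allI impI)
    fix n
    show "norm (norm (taylor_coeff g n * (A ^\<^sub>m n) $$ (i, j))) \<le> C * (norm (taylor_coeff g n) * r ^ n)"
      using mult_left_mono[OF C(4)[OF assms(3,4), of n] norm_ge_zero[of "taylor_coeff g n"]]
      by (simp add: norm_mult mult_ac)
  qed
qed

lemma mat_fun_cong:
  assumes "f holomorphic_on \<D>" "\<And>w. w \<in> \<D> \<Longrightarrow> f w = g w"
  shows "mat_fun d f A = mat_fun d g A"
  using taylor_coeff_cong[OF assms] by (simp add: mat_fun_def)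

lemma mat_fun_add:
  assumes A: "Schur_stable d A" and f: "f holomorphic_on \<D>" and g: "g holomorphic_on \<D>"
  shows "mat_fun d (\<lambda>w. f w + g w) A = mat_fun d f A + mat_fun d g A"
proof (rule eq_matI)
  fix i j assume "i < dim_row (mat_fun d f A + mat_fun d g A)" "j < dim_col (mat_fun d f A + mat_fun d g A)"
  hence ij: "i < d" "j < d" by auto
  show "mat_fun d (\<lambda>w. f w + g w) A $$ (i, j) = (mat_fun d f A + mat_fun d g A) $$ (i, j)"
    using ij suminf_add[OF summable_norm_cancel[OF mat_fun_summable[OF A f ij]]
        summable_norm_cancel[OF mat_fun_summable[OF A g ij]]]
    by (simp add: mat_fun_entry taylor_coeff_add[OF f g] algebra_simps)
qed auto

text \<open>
  The Cauchy product of the two series, entry by entry; absolute convergence comes from the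
  geometric decay of the powers.
\<close>

lemma mat_fun_mult:
  assumes A: "Schur_stable d A" and f: "f holomorphic_on \<D>" and g: "g holomorphic_on \<D>"
  shows "mat_fun d (\<lambda>w. f w * g w) A = mat_fun d f A * mat_fun d g A"
proof (rule eq_matI)
  fix i j assume "i < dim_row (mat_fun d f A * mat_fun d g A)" "j < dim_col (mat_fun d f A * mat_fun d g A)"
  hence ij: "i < d" "j < d" by auto
  have Ad: "A \<in> carrier_mat d d" using A by (simp add: Schur_stable_def)
  let ?a = "\<lambda>l n. taylor_coeff f n * (A ^\<^sub>m n) $$ (i, l)"
  let ?b = "\<lambda>l n. taylor_coeff g n * (A ^\<^sub>m n) $$ (l, j)"
  have "(\<lambda>k. \<Sum>l<d. \<Sum>m\<le>k. ?a l m * ?b l (k - m)) sums (\<Sum>l<d. (\<Sum>n. ?a l n) * (\<Sum>n. ?b l n))"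
    by (intro sums_sum Cauchy_product_sums mat_fun_summable[OF A f] mat_fun_summable[OF A g] ij) auto
  also have "(\<lambda>k. \<Sum>l<d. \<Sum>m\<le>k. ?a l m * ?b l (k - m)) =
      (\<lambda>k. taylor_coeff (\<lambda>w. f w * g w) k * (A ^\<^sub>m k) $$ (i, j))"
  proof
    fix k
    have "(\<Sum>l<d. \<Sum>m\<le>k. ?a l m * ?b l (k - m)) = (\<Sum>m\<le>k. \<Sum>l<d. ?a l m * ?b l (k - m))"
      by (rule sum.swap)
    also have "\<dots> = (\<Sum>m\<le>k. taylor_coeff f m * taylor_coeff g (k - m) * (A ^\<^sub>m k) $$ (i, j))"
    proof (rule sum.cong[OF refl])
      fix m assume "m \<in> {..k}"
      hence "A ^\<^sub>m k = A ^\<^sub>m m * A ^\<^sub>m (k - m)" using pow_mat_add[OF Ad, of m "k - m"] by simp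
      hence "(A ^\<^sub>m k) $$ (i, j) = (\<Sum>l<d. (A ^\<^sub>m m) $$ (i, l) * (A ^\<^sub>m (k - m)) $$ (l, j))"
        using mat_mult_entry[OF _ _ ij, of "A ^\<^sub>m m" "A ^\<^sub>m (k - m)"] Ad by simp
      thus "(\<Sum>l<d. ?a l m * ?b l (k - m)) = taylor_coeff f m * taylor_coeff g (k - m) * (A ^\<^sub>m k) $$ (i, j)"
        by (simp add: sum_distrib_left mult_ac)
    qed
    also have "\<dots> = taylor_coeff (\<lambda>w. f w * g w) k * (A ^\<^sub>m k) $$ (i, j)"
      by (simp add: taylor_coeff_mult[OF f g] sum_distrib_right)
    finally show "(\<Sum>l<d. \<Sum>m\<le>k. ?a l m * ?b l (k - m)) = \<dots>" .
  qed
  finally have "(\<Sum>n. taylor_coeff (\<lambda>w. f w * g w) n * (A ^\<^sub>m n) $$ (i, j)) = (\<Sum>l<d. (\<Sum>n. ?a l n) * (\<Sum>n. ?b l n))"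
    by (simp add: sums_iff)
  thus "mat_fun d (\<lambda>w. f w * g w) A $$ (i, j) = (mat_fun d f A * mat_fun d g A) $$ (i, j)"
    using ij by (simp add: mat_fun_entry mat_mult_entry[OF mat_fun_carrier mat_fun_carrier ij])
qed auto

lemma mat_fun_const:
  assumes "A \<in> carrier_mat d d"
  shows "mat_fun d (\<lambda>w. c) A = c \<cdot>\<^sub>m 1\<^sub>m d"
proof (rule eq_matI)
  fix i j assume "i < dim_row (c \<cdot>\<^sub>m 1\<^sub>m d)" "j < dim_col (c \<cdot>\<^sub>m 1\<^sub>m d)"
  hence ij: "i < d" "j < d" by auto
  have "(\<Sum>n. taylor_coeff (\<lambda>w. c) n * (A ^\<^sub>m n) $$ (i, j)) =
        (\<Sum>n\<in>{0}. taylor_coeff (\<lambda>w. c) n * (A ^\<^sub>m n) $$ (i, j))"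
    by (rule suminf_finite) (auto simp: taylor_coeff_const)
  thus "mat_fun d (\<lambda>w. c) A $$ (i, j) = (c \<cdot>\<^sub>m 1\<^sub>m d) $$ (i, j)"
    using ij assms by (simp add: mat_fun_entry taylor_coeff_const)
qed auto

lemma mat_fun_ident:
  assumes "A \<in> carrier_mat d d"
  shows "mat_fun d (\<lambda>w. w) A = A"
proof (rule eq_matI)
  fix i j assume "i < dim_row A" "j < dim_col A"
  hence ij: "i < d" "j < d" using assms by auto
  have "(\<Sum>n. taylor_coeff (\<lambda>w. w) n * (A ^\<^sub>m n) $$ (i, j)) =
        (\<Sum>n\<in>{1}. taylor_coeff (\<lambda>w. w) n * (A ^\<^sub>m n) $$ (i, j))"
    by (rule suminf_finite) (auto simp: taylor_coeff_ident)
  thus "mat_fun d (\<lambda>w. w) A $$ (i, j) = A $$ (i, j)"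
    using ij assms by (simp add: mat_fun_entry taylor_coeff_ident)
qed (use assms in auto)

text \<open>
  The action on vectors. In this form the homomorphism laws become rewriting of function composition
  and no matrix products remain.
\<close>

definition mat_act :: "nat \<Rightarrow> complex mat \<Rightarrow> (complex \<Rightarrow> complex) \<Rightarrow> complex vec \<Rightarrow> complex vec" where
  "mat_act d A g x = mat_fun d g A *\<^sub>v x"

lemma mat_act_carrier [simp]: "mat_act d A g x \<in> carrier_vec d"
  by (auto simp: mat_act_def intro: mult_mat_vec_carrier[of _ d d] carrier_vecI)

lemma mat_act_dim [simp]: "dim_vec (mat_act d A g x) = d"
  by (simp add: mat_act_def)

lemma mat_act_cong:
  assumes "f holomorphic_on \<D>" "\<And>w. w \<in> \<D> \<Longrightarrow> f w = g w"
  shows "mat_act d A f x = mat_act d A g x"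
  using mat_fun_cong[OF assms] by (simp add: mat_act_def)

lemma mat_act_mult:
  assumes "Schur_stable d A" "f holomorphic_on \<D>" "g holomorphic_on \<D>" "x \<in> carrier_vec d"
  shows "mat_act d A (\<lambda>w. f w * g w) x = mat_act d A f (mat_act d A g x)"
  using assms by (simp add: mat_act_def mat_fun_mult assoc_mult_mat_vec[of _ d d _ d])

lemma mat_act_add:
  assumes "Schur_stable d A" "f holomorphic_on \<D>" "g holomorphic_on \<D>" "x \<in> carrier_vec d"
  shows "mat_act d A (\<lambda>w. f w + g w) x = mat_act d A f x + mat_act d A g x"
  using assms by (simp add: mat_act_def mat_fun_add add_mult_distrib_mat_vec[of _ d d])

lemma mat_act_const:
  assumes "Schur_stable d A" "x \<in> carrier_vec d"
  shows "mat_act d A (\<lambda>w. c) x = c \<cdot>\<^sub>v x"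
  using assms by (simp add: mat_act_def Schur_stable_def mat_fun_const smult_mat_vec[of _ d])

lemma mat_act_ident:
  assumes "Schur_stable d A" "x \<in> carrier_vec d"
  shows "mat_act d A (\<lambda>w. w) x = A *\<^sub>v x"
  using assms by (simp add: mat_act_def Schur_stable_def mat_fun_ident)

lemma mat_act_zero: "mat_act d A g (0\<^sub>v d) = 0\<^sub>v d"
  by (rule eq_vecI) (auto simp: mat_act_def scalar_prod_def)

lemma mat_act_shift:
  assumes "Schur_stable d A" "x \<in> carrier_vec d"
  shows "mat_act d A (\<lambda>w. w - \<mu>) x = A *\<^sub>v x - \<mu> \<cdot>\<^sub>v x"
proof -
  have "mat_act d A (\<lambda>w. w + (- \<mu>)) x = A *\<^sub>v x + (- \<mu>) \<cdot>\<^sub>v x"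
    using assms by (subst mat_act_add) (auto simp: mat_act_const mat_act_ident intro!: holomorphic_intros)
  also have "\<dots> = A *\<^sub>v x - \<mu> \<cdot>\<^sub>v x"
    using assms by (intro eq_vecI) (auto simp: Schur_stable_def)
  finally show ?thesis by simp
qed

section \<open>The Cayley-Hamilton theorem in factored form\<close>

definition root_prod :: "complex list \<Rightarrow> complex \<Rightarrow> complex" where
  "root_prod es w = (\<Prod>e\<leftarrow>es. w - e)"

lemma root_prod_simps [simp]:
  "root_prod [] = (\<lambda>w. 1)" "root_prod (e # es) = (\<lambda>w. (w - e) * root_prod es w)"
  by (auto simp: root_prod_def fun_eq_iff)

lemma root_prod_holo: "root_prod es holomorphic_on S"
  by (induction es) (auto intro!: holomorphic_intros)

lemma root_prod_append: "root_prod (xs @ ys) w = root_prod xs w * root_prod ys w"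
  by (simp add: root_prod_def)

text \<open>
  Bring \<open>A\<close> to upper triangular form \<open>B\<close> by a Schur decomposition. If \<open>y\<close> is supported on the
  first \<open>k + 1\<close> coordinates, then \<open>(B - e\<^sub>k) y\<close> is supported on the first \<open>k\<close>; so the factors
  for \<open>e\<^sub>k, \<dots>, e\<^sub>0\<close>, applied one after the other, annihilate \<open>y\<close>.
\<close>

lemma Cayley_Hamilton_roots:
  assumes A: "Schur_stable d A" and c: "char_poly A = (\<Prod>e\<leftarrow>es. [:- e, 1:])" and x: "x \<in> carrier_vec d"
  shows "mat_act d A (root_prod es) x = 0\<^sub>v d"
proof -
  have Ad: "A \<in> carrier_mat d d" using A by (simp add: Schur_stable_def)
  obtain B P Q where sd: "schur_decomposition A es = (B, P, Q)" by (cases "schur_decomposition A es")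
  have sim: "similar_mat_wit A B P Q" and ut: "upper_triangular B" and diag: "diag_mat B = es"
    using schur_decomposition[OF Ad c sd] by auto
  note wit = similar_mat_witD2[OF Ad sim]
  have B: "B \<in> carrier_mat d d" and P: "P \<in> carrier_mat d d" and Q: "Q \<in> carrier_mat d d"
    and PQ: "P * Q = 1\<^sub>m d" and QP: "Q * P = 1\<^sub>m d" and AB: "A = P * B * Q"
    using wit by auto
  have len: "length es = d" using diag B by (auto simp: diag_mat_def)
  have ent: "B $$ (i, i) = es ! i" if "i < d" for i
    using diag B that by (auto simp: diag_mat_def)
  have AP: "A *\<^sub>v (P *\<^sub>v y) = P *\<^sub>v (B *\<^sub>v y)" if y: "y \<in> carrier_vec d" for y
  proof -
    have "A * P = P * B"
      using B P Q QP AB by (simp add: assoc_mult_mat[of _ d d _ d _ d])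
    thus ?thesis using Ad B P y by (metis assoc_mult_mat_vec)
  qed
  have key: "k \<le> d \<Longrightarrow> y \<in> carrier_vec d \<Longrightarrow> (\<And>i. k \<le> i \<Longrightarrow> i < d \<Longrightarrow> y $ i = 0) \<Longrightarrow>
      mat_act d A (root_prod (take k es)) (P *\<^sub>v y) = 0\<^sub>v d" for k y
  proof (induction k arbitrary: y)
    case 0
    hence "y = 0\<^sub>v d" by (intro eq_vecI) auto
    hence "P *\<^sub>v y = 0\<^sub>v d" using P by (intro eq_vecI) (auto simp: scalar_prod_def)
    thus ?case by (simp add: mat_act_zero)
  next
    case (Suc k)
    have k: "k < d" using Suc.prems by simp
    define y' where "y' = B *\<^sub>v y - (es ! k) \<cdot>\<^sub>v y"
    have y': "y' \<in> carrier_vec d" using B Suc.prems by (auto simp: y'_def)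
    have z: "y' $ i = 0" if i: "k \<le> i" "i < d" for i
    proof -
      have "(B *\<^sub>v y) $ i = (\<Sum>j<d. B $$ (i, j) * y $ j)"
        using mat_vec_entry[OF B Suc.prems(2) i(2)] .
      also have "\<dots> = (\<Sum>j<d. if j = i then es ! i * y $ i else 0)"
      proof (rule sum.cong[OF refl])
        fix j assume "j \<in> {..<d}"
        moreover have "B $$ (i, j) = 0" if "j < i" using ut that i B by (auto simp: upper_triangular_def)
        moreover have "y $ j = 0" if "j > i" "j < d" using Suc.prems(3)[of j] that i by simp
        ultimately show "B $$ (i, j) * y $ j = (if j = i then es ! i * y $ i else 0)"
          using ent[OF i(2)] by (cases j i rule: linorder_cases) auto
      qed
      also have "\<dots> = es ! i * y $ i" using i by simp
      finally have "(B *\<^sub>v y) $ i = es ! i * y $ i" .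
      moreover have "es ! i * y $ i = es ! k * y $ i"
        using Suc.prems(3)[of i] i by (cases "i = k") auto
      ultimately show ?thesis using i Suc.prems(2) B by (simp add: y'_def)
    qed
    have "mat_act d A (root_prod (take (Suc k) es)) (P *\<^sub>v y) =
        mat_act d A (\<lambda>w. root_prod (take k es) w * (w - es ! k)) (P *\<^sub>v y)"
      using k len by (intro mat_act_cong root_prod_holo) (simp add: take_Suc_conv_app_nth root_prod_append)
    also have "\<dots> = mat_act d A (root_prod (take k es)) (mat_act d A (\<lambda>w. w - es ! k) (P *\<^sub>v y))"
      using P Suc.prems by (intro mat_act_mult A root_prod_holo holomorphic_intros) auto
    also have "mat_act d A (\<lambda>w. w - es ! k) (P *\<^sub>v y) = P *\<^sub>v y'"
    proof -
      have "mat_act d A (\<lambda>w. w - es ! k) (P *\<^sub>v y) = P *\<^sub>v (B *\<^sub>v y) - (es ! k) \<cdot>\<^sub>v (P *\<^sub>v y)"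
        using P Suc.prems by (subst mat_act_shift[OF A]) (auto simp: AP)
      also have "\<dots> = P *\<^sub>v y'"
        unfolding y'_def using P B Suc.prems(2)
        by (simp add: mult_minus_distrib_mat_vec[of _ d d] mult_mat_vec[of _ d d])
      finally show ?thesis .
    qed
    also have "mat_act d A (root_prod (take k es)) (P *\<^sub>v y') = 0\<^sub>v d"
      using k y' z by (intro Suc.IH) auto
    finally show ?case .
  qed
  have "P *\<^sub>v (Q *\<^sub>v x) = x" using P Q PQ x by (simp add: assoc_mult_mat_vec[of _ d d _ d, symmetric])
  moreover have "mat_act d A (root_prod (take d es)) (P *\<^sub>v (Q *\<^sub>v x)) = 0\<^sub>v d"
    using Q x by (intro key) auto
  ultimately show ?thesis using len by simp
qed

lemma Schur_stable_char_poly: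
  assumes "Schur_stable d A"
  obtains es where "char_poly A = (\<Prod>e\<leftarrow>es. [:- e, 1:])" "length es = d" "set es \<subseteq> \<D>"
proof -
  have A: "A \<in> carrier_mat d d" using assms by (simp add: Schur_stable_def)
  obtain es where es: "char_poly A = (\<Prod>e\<leftarrow>es. [:- e, 1:])" "length es = d"
    using char_poly_factorized[OF A] by blast
  have "e \<in> \<D>" if "e \<in> set es" for e
  proof -
    have "poly (char_poly A) e = 0" unfolding es(1) using linear_poly_root[OF that] by simp
    thus ?thesis using assms spectrum_root_char_poly[OF A] by (auto simp: Schur_stable_def)
  qed
  thus ?thesis using that es by blast
qed

text \<open>
  The sign \<open>(-1)\<^sup>d\<close> is the difference between \<open>det (A - w)\<close> and the monic characteristic polynomial.
\<close>

lemma det_shift_root_prod: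
  assumes A: "A \<in> carrier_mat d d" and c: "char_poly A = (\<Prod>e\<leftarrow>es. [:- e, 1:])"
  shows "det (A - w \<cdot>\<^sub>m 1\<^sub>m d) = (-1) ^ d * root_prod es w"
proof -
  have cm: "char_matrix A w = A - w \<cdot>\<^sub>m 1\<^sub>m d"
    using A by (intro eq_matI) (auto simp: char_matrix_def)
  have "root_prod es w = poly (char_poly A) w"
    unfolding c by (induction es) (auto simp: algebra_simps)
  also have "\<dots> = det (- char_matrix A w)" by (rule char_poly_matrix[OF A])
  also have "- char_matrix A w = (-1) \<cdot>\<^sub>m (A - w \<cdot>\<^sub>m 1\<^sub>m d)"
    unfolding cm using A by (intro eq_matI) auto
  also have "det \<dots> = (-1) ^ d * det (A - w \<cdot>\<^sub>m 1\<^sub>m d)" using A by simp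
  finally have "(-1) ^ d * root_prod es w = ((-1) ^ d * (-1) ^ d) * det (A - w \<cdot>\<^sub>m 1\<^sub>m d)" by simp
  moreover have "(-1) ^ d * (-1) ^ d = (1::complex)" by (simp flip: power_add)
  ultimately show ?thesis by simp
qed

section \<open>A von Neumann type inequality for matrices\<close>

definition vnorm :: "complex vec \<Rightarrow> real" where
  "vnorm x = L2_set (\<lambda>i. cmod (x $ i)) {..<dim_vec x}"

lemma vnorm_nonneg [simp]: "0 \<le> vnorm x" by (simp add: vnorm_def L2_set_nonneg)

lemma vnorm_add:
  assumes "x \<in> carrier_vec d" "y \<in> carrier_vec d"
  shows "vnorm (x + y) \<le> vnorm x + vnorm y"
proof -
  have "vnorm (x + y) \<le> L2_set (\<lambda>i. cmod (x $ i) + cmod (y $ i)) {..<d}"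
    unfolding vnorm_def using assms by (auto intro!: L2_set_mono norm_triangle_ineq)
  also have "\<dots> \<le> vnorm x + vnorm y"
    unfolding vnorm_def using assms L2_set_triangle_ineq[of "\<lambda>i. cmod (x $ i)" "\<lambda>i. cmod (y $ i)" "{..<d}"] by simp
  finally show ?thesis .
qed

lemma vnorm_smult: "vnorm (c \<cdot>\<^sub>v x) = cmod c * vnorm x"
proof -
  have "vnorm (c \<cdot>\<^sub>v x) = L2_set (\<lambda>i. cmod c * cmod (x $ i)) {..<dim_vec x}"
    unfolding vnorm_def by (rule L2_set_cong) (auto simp: norm_mult)
  thus ?thesis by (simp add: vnorm_def L2_set_right_distrib)
qed

lemma norm_entry_le_vnorm: "i < dim_vec x \<Longrightarrow> cmod (x $ i) \<le> vnorm x"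
  unfolding vnorm_def by (rule member_le_L2_set) auto

lemma vnorm_zero [simp]: "vnorm (0\<^sub>v d) = 0"
  by (simp add: vnorm_def L2_set_def)

definition contractive :: "nat \<Rightarrow> complex mat \<Rightarrow> bool" where
  "contractive d A \<longleftrightarrow> A \<in> carrier_mat d d \<and> (\<forall>x\<in>carrier_vec d. vnorm (A *\<^sub>v x) \<le> vnorm x)"

text \<open>
  Summed over coordinates with \<open>a = A u\<close>, this identity says that a Blaschke factor of a contraction
  is a contraction.
\<close>

lemma Blaschke_identity:
  fixes a u \<mu> :: complex
  shows "(cmod (a - \<mu> * u))\<^sup>2 - (cmod (u - cnj \<mu> * a))\<^sup>2 = (1 - (cmod \<mu>)\<^sup>2) * ((cmod a)\<^sup>2 - (cmod u)\<^sup>2)"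
proof -
  have "complex_of_real ((cmod (a - \<mu> * u))\<^sup>2 - (cmod (u - cnj \<mu> * a))\<^sup>2) =
     complex_of_real ((1 - (cmod \<mu>)\<^sup>2) * ((cmod a)\<^sup>2 - (cmod u)\<^sup>2))"
    unfolding of_real_diff of_real_mult complex_norm_square of_real_1 by (simp add: algebra_simps)
  thus ?thesis by (simp only: of_real_eq_iff)
qed

lemma contractive_Blaschke:
  assumes A: "contractive d A" and u: "u \<in> carrier_vec d" and \<mu>: "\<mu> \<in> \<D>"
  shows "vnorm (A *\<^sub>v u - \<mu> \<cdot>\<^sub>v u) \<le> vnorm (u - cnj \<mu> \<cdot>\<^sub>v (A *\<^sub>v u))"
proof -
  define a where "a = A *\<^sub>v u"
  have a: "a \<in> carrier_vec d" using A u by (auto simp: a_def contractive_def)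
  have sq: "(vnorm v)\<^sup>2 = (\<Sum>i<d. (cmod (v $ i))\<^sup>2)" if "v \<in> carrier_vec d" for v
    using that by (simp add: vnorm_def L2_set_def sum_nonneg)
  have "vnorm a \<le> vnorm u" using A u by (auto simp: a_def contractive_def)
  hence le: "(\<Sum>i<d. (cmod (a $ i))\<^sup>2) \<le> (\<Sum>i<d. (cmod (u $ i))\<^sup>2)"
    using power_mono[of "vnorm a" "vnorm u" 2] sq[OF a] sq[OF u] by simp
  have "(vnorm (a - \<mu> \<cdot>\<^sub>v u))\<^sup>2 - (vnorm (u - cnj \<mu> \<cdot>\<^sub>v a))\<^sup>2 =
        (\<Sum>i<d. (cmod (a $ i - \<mu> * u $ i))\<^sup>2 - (cmod (u $ i - cnj \<mu> * a $ i))\<^sup>2)"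
    using a u by (subst (1 2) sq) (auto simp: sum_subtractf)
  also have "\<dots> = (1 - (cmod \<mu>)\<^sup>2) * ((\<Sum>i<d. (cmod (a $ i))\<^sup>2) - (\<Sum>i<d. (cmod (u $ i))\<^sup>2))"
    by (simp only: Blaschke_identity sum_distrib_left[symmetric] sum_subtractf)
  also have "\<dots> \<le> 0"
    using \<mu> le by (intro mult_nonneg_nonpos) (auto simp: power_le_one)
  finally have "(vnorm (a - \<mu> \<cdot>\<^sub>v u))\<^sup>2 \<le> (vnorm (u - cnj \<mu> \<cdot>\<^sub>v a))\<^sup>2" by linarith
  hence "vnorm (a - \<mu> \<cdot>\<^sub>v u) \<le> vnorm (u - cnj \<mu> \<cdot>\<^sub>v a)"
    by (rule power2_le_imp_le) (rule vnorm_nonneg)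
  thus ?thesis by (simp only: a_def)
qed

text \<open>
  The Schur algorithm, by induction on the list of points. With \<open>b\<close> the Blaschke factor at \<open>\<mu>\<close>,
  write \<open>g = g(\<mu>) + h b\<close> with \<open>|h| \<le> 3 B\<close>. The vector \<open>y = b(A) x\<close> is no longer than \<open>x\<close> and is
  annihilated by the remaining factors, so the induction hypothesis applies to \<open>h\<close> and \<open>y\<close>. The
  constant satisfies \<open>1 + 3 \<cdot> 4\<^sup>n \<le> 4\<^sup>n\<^sup>+\<^sup>1\<close>.
\<close>

lemma mat_act_bound_aux:
  assumes A: "Schur_stable d A" "contractive d A"
  shows "set es \<subseteq> \<D> \<Longrightarrow> g \<in> Hinf B \<Longrightarrow> 0 < B \<Longrightarrow> x \<in> carrier_vec d \<Longrightarrow>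
     mat_act d A (root_prod es) x = 0\<^sub>v d \<Longrightarrow> vnorm (mat_act d A g x) \<le> 4 ^ length es * B * vnorm x"
proof (induction es arbitrary: g B x)
  case Nil
  hence "x = 0\<^sub>v d" using mat_act_const[OF A(1), of x 1] by simp
  thus ?case by (simp add: mat_act_zero)
next
  case (Cons \<mu> es)
  have \<mu>: "\<mu> \<in> \<D>" and es: "set es \<subseteq> \<D>" using Cons.prems by auto
  note g = Hinf_holo[OF Cons.prems(2)]
  have nz: "1 - cnj \<mu> * w \<noteq> 0" if "w \<in> \<D>" for w using one_minus_cnj_mult_nonzero[OF \<mu> that] .
  define r where "r = (\<lambda>w. 1 / (1 - cnj \<mu> * w))"
  define h where "h = (\<lambda>w. (1 - cnj \<mu> * w) * div_quot g \<mu> w)"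
  have hol: "r holomorphic_on \<D>" "h holomorphic_on \<D>" "(\<lambda>w. w - \<mu>) holomorphic_on \<D>"
    "(\<lambda>w. 1 - cnj \<mu> * w) holomorphic_on \<D>" "root_prod es holomorphic_on \<D>"
    unfolding r_def h_def using nz by (auto intro!: holomorphic_intros div_quot_holo g root_prod_holo)
  have h: "h \<in> Hinf (3 * B)" unfolding h_def by (rule div_quot_Blaschke_bound[OF Cons.prems(2) \<mu> Cons.prems(3)])
  \<comment> \<open>\<open>u\<close> solves \<open>(1 - cnj \<mu> A) u = x\<close>, so that \<open>y = (A - \<mu>) u\<close> is the Blaschke factor applied to \<open>x\<close>\<close>
  define u where "u = mat_act d A r x"
  define y where "y = mat_act d A (\<lambda>w. w - \<mu>) u"
  have u: "u \<in> carrier_vec d" and y: "y \<in> carrier_vec d" by (auto simp: u_def y_def)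
  have "mat_act d A (\<lambda>w. 1 - cnj \<mu> * w) u = mat_act d A (\<lambda>w. (1 - cnj \<mu> * w) * r w) x"
    unfolding u_def using hol A Cons.prems by (simp add: mat_act_mult)
  also have "\<dots> = mat_act d A (\<lambda>w. 1) x"
    using nz hol by (intro mat_act_cong holomorphic_intros) (auto simp: r_def)
  also have "\<dots> = x" using mat_act_const[OF A(1) Cons.prems(4), of 1] by simp
  finally have xu: "mat_act d A (\<lambda>w. 1 - cnj \<mu> * w) u = x" .
  have "mat_act d A (\<lambda>w. 1 - cnj \<mu> * w) u = mat_act d A (\<lambda>w. (1 + (- cnj \<mu>) * w)) u" by simp
  also have "\<dots> = u - cnj \<mu> \<cdot>\<^sub>v (A *\<^sub>v u)"
  proof -
    have "mat_act d A (\<lambda>w. (- cnj \<mu>) * w) u = (- cnj \<mu>) \<cdot>\<^sub>v (A *\<^sub>v u)"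
      using A u by (subst mat_act_mult) (auto simp: mat_act_ident mat_act_const Schur_stable_def intro!: holomorphic_intros)
    moreover have "mat_act d A (\<lambda>w. 1) u = u" using mat_act_const[OF A(1) u, of 1] by simp
    moreover have "mat_act d A (\<lambda>w. (1 + (- cnj \<mu>) * w)) u = mat_act d A (\<lambda>w. 1) u + mat_act d A (\<lambda>w. (- cnj \<mu>) * w) u"
      by (rule mat_act_add[OF A(1) _ _ u]) (auto intro!: holomorphic_intros)
    ultimately have "mat_act d A (\<lambda>w. (1 + (- cnj \<mu>) * w)) u = u + (- cnj \<mu>) \<cdot>\<^sub>v (A *\<^sub>v u)"
      by (simp only:)
    also have "\<dots> = u - cnj \<mu> \<cdot>\<^sub>v (A *\<^sub>v u)" using A(1) u by (intro eq_vecI) (auto simp: Schur_stable_def)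
    finally show ?thesis .
  qed
  finally have "vnorm y \<le> vnorm x"
    using contractive_Blaschke[OF A(2) u \<mu>] xu by (simp add: y_def mat_act_shift[OF A(1) u])
  have "mat_act d A (root_prod es) y = mat_act d A (\<lambda>w. root_prod es w * ((w - \<mu>) * r w)) x"
    unfolding y_def u_def using hol A Cons.prems(4) by (simp add: mat_act_mult holomorphic_intros)
  also have "\<dots> = mat_act d A (\<lambda>w. r w * root_prod (\<mu> # es) w) x"
    using hol by (intro mat_act_cong holomorphic_intros) (auto simp: mult_ac)
  also have "\<dots> = mat_act d A r (mat_act d A (root_prod (\<mu> # es)) x)"
    using hol A Cons.prems(4) by (intro mat_act_mult root_prod_holo) auto
  also have "\<dots> = 0\<^sub>v d" using Cons.prems(5) by (simp add: mat_act_zero)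
  finally have IH: "vnorm (mat_act d A h y) \<le> 4 ^ length es * (3 * B) * vnorm y"
    using Cons.IH[OF es h _ y] Cons.prems(3) by simp
  have gw: "g w = g \<mu> + h w * ((w - \<mu>) * r w)" if "w \<in> \<D>" for w
    using nz[OF that] by (subst div_quot_eq[of g w \<mu>]) (simp add: h_def r_def)
  have "mat_act d A g x = mat_act d A (\<lambda>w. g \<mu> + h w * ((w - \<mu>) * r w)) x"
    by (rule mat_act_cong[OF g gw])
  also have "\<dots> = g \<mu> \<cdot>\<^sub>v x + mat_act d A h y"
    using hol A Cons.prems(4) by (simp add: mat_act_add mat_act_mult mat_act_const holomorphic_intros y_def u_def)
  finally have "vnorm (mat_act d A g x) \<le> vnorm (g \<mu> \<cdot>\<^sub>v x) + vnorm (mat_act d A h y)"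
    using vnorm_add[of "g \<mu> \<cdot>\<^sub>v x" d "mat_act d A h y"] Cons.prems(4) by simp
  also have "vnorm (g \<mu> \<cdot>\<^sub>v x) \<le> B * vnorm x"
    unfolding vnorm_smult by (intro mult_right_mono Hinf_bound[OF Cons.prems(2) \<mu>]) auto
  also have "vnorm (mat_act d A h y) \<le> 4 ^ length es * (3 * B) * vnorm x"
    by (rule order_trans[OF IH mult_left_mono[OF \<open>vnorm y \<le> vnorm x\<close>]]) (use Cons.prems(3) in simp)
  also have "B * vnorm x + 4 ^ length es * (3 * B) * vnorm x \<le> 4 ^ length (\<mu> # es) * B * vnorm x"
  proof -
    have "1 * (B * vnorm x) \<le> 4 ^ length es * (B * vnorm x)"
      using Cons.prems(3) by (intro mult_right_mono) auto
    thus ?thesis by (simp add: algebra_simps)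
  qed
  finally show ?case by simp
qed

text \<open>
  A substitute for von Neumann's inequality: the constant is not one, but it depends on the size of
  the matrix only, which is all that boundedness of \<open>z \<mapsto> f(z, \<Psi>(z))\<close> requires.
\<close>

lemma mat_act_bound:
  assumes A: "Schur_stable d A" "contractive d A" and g: "g \<in> Hinf B" "0 < B" and x: "x \<in> carrier_vec d"
  shows "vnorm (mat_act d A g x) \<le> 4 ^ d * B * vnorm x"
proof -
  obtain es where es: "char_poly A = (\<Prod>e\<leftarrow>es. [:- e, 1:])" "length es = d" "set es \<subseteq> \<D>"
    by (rule Schur_stable_char_poly[OF A(1)])
  show ?thesis
    using mat_act_bound_aux[OF A es(3) g x Cayley_Hamilton_roots[OF A(1) es(1) x]] es(2) by simp
qed

lemma vnorm_unit_vec: "j < d \<Longrightarrow> vnorm (unit_vec d j) = 1"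
proof -
  assume j: "j < d"
  have "(\<Sum>i<d. (cmod (unit_vec d j $ i))\<^sup>2) = (\<Sum>i<d. if i = j then 1 else 0)"
    by (intro sum.cong) (auto simp: unit_vec_def)
  thus ?thesis using j by (simp add: vnorm_def L2_set_def)
qed

lemma mat_fun_entry_bound:
  assumes A: "Schur_stable d A" "contractive d A" and g: "g \<in> Hinf B" "0 < B" and ij: "i < d" "j < d"
  shows "cmod (mat_fun d g A $$ (i, j)) \<le> 4 ^ d * B"
proof -
  have e: "unit_vec d j \<in> carrier_vec d" by simp
  have "mat_act d A g (unit_vec d j) $ i = mat_fun d g A $$ (i, j)"
    unfolding mat_act_def using ij
    by (subst mat_vec_entry[OF mat_fun_carrier e ij(1)]) (simp add: unit_vec_def if_distrib cong: if_cong)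
  thus ?thesis
    using mat_act_bound[OF A g e] vnorm_unit_vec[OF ij(2)] norm_entry_le_vnorm[of i "mat_act d A g (unit_vec d j)"] ij by simp
qed

text \<open>
  Divide: \<open>g(A) = g(\<mu>) + (A - \<mu>) q(A)\<close>, and a left eigenvector annihilates \<open>A - \<mu>\<close> from the left.
\<close>

lemma mat_fun_left_eigenvector:
  assumes A: "Schur_stable d A" and v: "v \<in> carrier_vec d" and \<mu>: "\<mu> \<in> \<D>" and g: "g holomorphic_on \<D>"
    and ev: "\<And>j. j < d \<Longrightarrow> (\<Sum>i<d. v $ i * A $$ (i, j)) = \<mu> * v $ j" and j: "j < d"
  shows "(\<Sum>i<d. v $ i * mat_fun d g A $$ (i, j)) = g \<mu> * v $ j"
proof -
  have Ad: "A \<in> carrier_mat d d" using A by (simp add: Schur_stable_def)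
  define M where "M = mat_fun d (div_quot g \<mu>) A"
  have M: "M \<in> carrier_mat d d" by (simp add: M_def)
  have "mat_fun d g A = mat_fun d (\<lambda>w. g \<mu> + (w + (-\<mu>)) * div_quot g \<mu> w) A"
    by (rule mat_fun_cong[OF g]) (subst div_quot_eq[of g _ \<mu>], simp)
  also have "\<dots> = g \<mu> \<cdot>\<^sub>m 1\<^sub>m d + (A + (-\<mu>) \<cdot>\<^sub>m 1\<^sub>m d) * M"
    unfolding M_def using A Ad div_quot_holo[OF g]
    by (subst mat_fun_add mat_fun_mult mat_fun_const | intro holomorphic_intros | simp add: mat_fun_ident)+
  finally have eq: "mat_fun d g A = g \<mu> \<cdot>\<^sub>m 1\<^sub>m d + (A + (-\<mu>) \<cdot>\<^sub>m 1\<^sub>m d) * M" .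
  have ent: "mat_fun d g A $$ (i, j) = (if i = j then g \<mu> else 0) +
      (\<Sum>l<d. (A $$ (i, l) - (if i = l then \<mu> else 0)) * M $$ (l, j))" if i: "i < d" for i
  proof -
    have "((A + (-\<mu>) \<cdot>\<^sub>m 1\<^sub>m d) * M) $$ (i, j) = (\<Sum>l<d. (A + (-\<mu>) \<cdot>\<^sub>m 1\<^sub>m d) $$ (i, l) * M $$ (l, j))"
      using Ad M i j by (intro mat_mult_entry) auto
    also have "\<dots> = (\<Sum>l<d. (A $$ (i, l) - (if i = l then \<mu> else 0)) * M $$ (l, j))"
      using Ad i by (intro sum.cong) auto
    finally show ?thesis unfolding eq using i j Ad M by simp
  qed
  have "(\<Sum>i<d. v $ i * mat_fun d g A $$ (i, j)) =
     (\<Sum>i<d. (if i = j then g \<mu> * v $ j else 0)) +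
     (\<Sum>i<d. \<Sum>l<d. v $ i * (A $$ (i, l) - (if i = l then \<mu> else 0)) * M $$ (l, j))"
    unfolding sum.distrib[symmetric]
  proof (rule sum.cong[OF refl])
    fix i assume "i \<in> {..<d}"
    hence i: "i < d" by simp
    show "v $ i * mat_fun d g A $$ (i, j) = (if i = j then g \<mu> * v $ j else 0) +
        (\<Sum>l<d. v $ i * (A $$ (i, l) - (if i = l then \<mu> else 0)) * M $$ (l, j))"
      unfolding ent[OF i] distrib_left sum_distrib_left mult.assoc by simp
  qed
  also have "(\<Sum>i<d. \<Sum>l<d. v $ i * (A $$ (i, l) - (if i = l then \<mu> else 0)) * M $$ (l, j)) =
     (\<Sum>l<d. (\<Sum>i<d. v $ i * (A $$ (i, l) - (if i = l then \<mu> else 0))) * M $$ (l, j))"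
    by (subst sum.swap) (simp add: sum_distrib_right)
  also have "\<dots> = 0"
  proof (rule sum.neutral, intro ballI)
    fix l assume l: "l \<in> {..<d}"
    have "(\<Sum>i<d. v $ i * (A $$ (i, l) - (if i = l then \<mu> else 0))) =
       (\<Sum>i<d. v $ i * A $$ (i, l)) - (\<Sum>i<d. if i = l then \<mu> * v $ l else 0)"
      unfolding sum_subtractf[symmetric] by (intro sum.cong refl) (auto simp: algebra_simps)
    thus "(\<Sum>i<d. v $ i * (A $$ (i, l) - (if i = l then \<mu> else 0))) * M $$ (l, j) = 0"
      using l ev[of l] by simp
  qed
  finally show ?thesis using j by simp
qed

lemma contractive_pow:
  assumes "contractive d A"
  shows "contractive d (A ^\<^sub>m n)"
proof (induction n)
  case 0
  show ?case using assms carrier_matD(1)[of A d d] by (auto simp: contractive_def)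
next
  case (Suc n)
  have A: "A \<in> carrier_mat d d" "A ^\<^sub>m n \<in> carrier_mat d d" using assms by (auto simp: contractive_def)
  show ?case unfolding contractive_def
  proof (intro conjI ballI)
    show "A ^\<^sub>m Suc n \<in> carrier_mat d d" using mult_carrier_mat[OF A(2,1)] by simp
    fix x :: "complex vec" assume x: "x \<in> carrier_vec d"
    have "A ^\<^sub>m Suc n *\<^sub>v x = A ^\<^sub>m n *\<^sub>v (A *\<^sub>v x)" using A x by (simp add: assoc_mult_mat_vec[of _ d d _ d])
    moreover have "A *\<^sub>v x \<in> carrier_vec d" using A x by simp
    ultimately show "vnorm (A ^\<^sub>m Suc n *\<^sub>v x) \<le> vnorm x"
      using Suc assms x unfolding contractive_def by (metis order_trans)
  qed
qed

lemma contractive_entry: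
  assumes "contractive d A" "i < d" "j < d"
  shows "cmod (A $$ (i, j)) \<le> 1"
proof -
  have A: "A \<in> carrier_mat d d" using assms by (simp add: contractive_def)
  have "(A *\<^sub>v unit_vec d j) $ i = A $$ (i, j)"
    using assms A by (subst mat_vec_entry[OF A]) (simp_all add: unit_vec_def if_distrib cong: if_cong)
  moreover have "cmod ((A *\<^sub>v unit_vec d j) $ i) \<le> vnorm (A *\<^sub>v unit_vec d j)"
    using A assms by (intro norm_entry_le_vnorm) simp
  moreover have "vnorm (A *\<^sub>v unit_vec d j) \<le> vnorm (unit_vec d j)"
    using assms(1) unfolding contractive_def by auto
  ultimately show ?thesis using vnorm_unit_vec[OF assms(3)] by simp
qed

section \<open>Holomorphic dependence of the calculus on the matrix\<close>

text \<open>
  Each coefficient in \<open>w\<close> is the constant term of a function obtained from \<open>f\<close> by repeated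
  division, which stays in \<open>H\<^sup>\<infinity>(\<D>\<^sup>2)\<close>.
\<close>

lemma taylor_coeff_param_holo:
  "f \<in> Hinf2 \<Longrightarrow> (\<lambda>z. taylor_coeff (\<lambda>w. f (z, w)) n) holomorphic_on \<D>"
proof (induction n arbitrary: f)
  case 0
  thus ?case by (auto simp: taylor_coeff_def Hinf2_iff_sep sep_Hinf_def Hinf_def)
next
  case (Suc n)
  have "(\<lambda>z. taylor_coeff (\<lambda>w. (\<lambda>(z, w). div_quot (\<lambda>w. f (z, w)) 0 w) (z, w)) n) holomorphic_on \<D>"
    by (rule Suc.IH[OF Hinf2_div_quot_snd[OF Suc.prems]]) simp
  moreover have "taylor_coeff (\<lambda>w. f (z, w)) (Suc n) = taylor_coeff (div_quot (\<lambda>w. f (z, w)) 0) n"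
    if "z \<in> \<D>" for z
    using Suc.prems that by (intro taylor_coeff_Suc) (auto simp: Hinf2_iff_sep sep_Hinf_def Hinf_def)
  ultimately show ?case
    by (subst holomorphic_cong[OF refl]) auto
qed

lemma pow_entry_holo:
  assumes "\<Psi> \<in> Hinf_mat d" "i < d" "j < d"
  shows "(\<lambda>z. (\<Psi> z ^\<^sub>m n) $$ (i, j)) holomorphic_on \<D>"
  using assms(2,3)
proof (induction n arbitrary: i j)
  case 0
  have "(\<lambda>z. if i = j then 1 else 0 :: complex) holomorphic_on \<D>" by (intro holomorphic_intros)
  moreover have "dim_row (\<Psi> z) = d" if "z \<in> \<D>" for z using assms(1) that by (auto simp: Hinf_mat_def)
  ultimately show ?case using 0 by (subst holomorphic_cong[OF refl]) auto
next
  case (Suc n)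
  have "(\<lambda>z. \<Sum>l<d. (\<Psi> z ^\<^sub>m n) $$ (i, l) * \<Psi> z $$ (l, j)) holomorphic_on \<D>"
    using Suc assms(1) by (intro holomorphic_intros) (auto simp: Hinf_mat_def)
  moreover have "(\<Psi> z ^\<^sub>m Suc n) $$ (i, j) = (\<Sum>l<d. (\<Psi> z ^\<^sub>m n) $$ (i, l) * \<Psi> z $$ (l, j))"
    if "z \<in> \<D>" for z
  proof -
    have P: "\<Psi> z \<in> carrier_mat d d" using assms(1) that by (auto simp: Hinf_mat_def)
    show ?thesis using mat_mult_entry[OF _ P Suc.prems, of "\<Psi> z ^\<^sub>m n"] P by simp
  qed
  ultimately show ?case by (subst holomorphic_cong[OF refl]) auto
qed

text \<open>
  For the dilation \<open>f(z, r w)\<close> the series converges uniformly in \<open>z\<close>: the coefficients gain a factor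
  \<open>r\<^sup>n\<close>, and the powers of a contraction have bounded entries.
\<close>

lemma dilated_calculus_holo:
  assumes \<Psi>: "\<Psi> \<in> Hinf_mat d" "\<And>z. z \<in> \<D> \<Longrightarrow> contractive d (\<Psi> z)"
    and f: "f \<in> sep_Hinf B" "0 < B" and ij: "i < d" "j < d" and r: "0 \<le> r" "r < 1"
  shows "(\<lambda>z. mat_fun d (\<lambda>w. f (z, of_real r * w)) (\<Psi> z) $$ (i, j)) holomorphic_on \<D>"
proof (rule holomorphic_uniform_sequence[OF open_ball])
  \<comment> \<open>Cauchy's estimate is used on the circle of radius \<open>s\<close>, strictly between \<open>r\<close> and one.\<close>
  define s where "s = (1 + r) / 2"
  have s: "0 < s" "s < 1" "r < s" using r by (auto simp: s_def)
  let ?u = "\<lambda>n z. of_real r ^ n * taylor_coeff (\<lambda>w. f (z, w)) n * (\<Psi> z ^\<^sub>m n) $$ (i, j)"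
  have f2: "f \<in> Hinf2" by (rule Hinf2_sepI[OF f(1)])
  show "(\<lambda>z. \<Sum>n<N. ?u n z) holomorphic_on \<D>" for N
    by (intro holomorphic_intros taylor_coeff_param_holo[OF f2] pow_entry_holo[OF \<Psi>(1)] ij)
  fix x assume "x \<in> \<D>"
  then obtain e where e: "e > 0" "cball x e \<subseteq> \<D>" using open_contains_cball[of \<D>] by (meson open_ball)
  have bd: "norm (?u n z) \<le> B * (r / s) ^ n" if z: "z \<in> cball x e" for n z
  proof -
    have zD: "z \<in> \<D>" using e z by auto
    have g: "(\<lambda>w. f (z, w)) \<in> Hinf B" using f(1) zD by (simp add: sep_Hinf_def)
    have "norm (?u n z) \<le> r ^ n * (B / s ^ n) * 1"
      unfolding norm_mult
      using norm_taylor_coeff_le[OF g s(1,2), of n] contractive_entry[OF contractive_pow[OF \<Psi>(2)[OF zD]] ij, of n] r f(2) s(1)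
      by (intro mult_mono) (auto simp: norm_power)
    thus ?thesis by (simp add: power_divide mult_ac)
  qed
  have sm: "summable (\<lambda>n. B * (r / s) ^ n)"
    using r s by (intro summable_mult summable_geometric) simp
  have ul: "uniform_limit (cball x e) (\<lambda>N z. \<Sum>n<N. ?u n z) (\<lambda>z. \<Sum>n. ?u n z) sequentially"
    by (rule Weierstrass_m_test[OF bd sm])
  have eq: "(\<Sum>n. ?u n z) = mat_fun d (\<lambda>w. f (z, of_real r * w)) (\<Psi> z) $$ (i, j)" if "z \<in> cball x e" for z
  proof -
    have "(\<lambda>w. f (z, w)) holomorphic_on \<D>" using f(1) e that by (auto simp: sep_Hinf_def Hinf_def)
    from taylor_coeff_dilate[OF this, of "of_real r"] show ?thesis using r ij by (simp add: mat_fun_entry)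
  qed
  have "uniform_limit (cball x e) (\<lambda>N z. \<Sum>n<N. ?u n z)
      (\<lambda>z. mat_fun d (\<lambda>w. f (z, of_real r * w)) (\<Psi> z) $$ (i, j)) sequentially"
    by (rule iffD1[OF uniform_limit_cong'[OF refl eq] ul])
  thus "\<exists>e>0. cball x e \<subseteq> \<D> \<and> uniform_limit (cball x e) (\<lambda>N z. \<Sum>n<N. ?u n z)
      (\<lambda>z. mat_fun d (\<lambda>w. f (z, of_real r * w)) (\<Psi> z) $$ (i, j)) sequentially"
    using e by blast
qed

text \<open>
  Boundedness is the von Neumann type inequality. For holomorphy, the dilations \<open>f(z, \<rho> w)\<close> give
  holomorphic functions with the same bound, and they converge pointwise as \<open>\<rho> \<rightarrow> 1\<close> by Tannery's
  theorem. By Montel's theorem the pointwise limit of a bounded sequence of holomorphic functions is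
  holomorphic.
\<close>

lemma calculus_Hinf_mat:
  assumes \<Psi>: "\<Psi> \<in> Hinf_mat d" "\<And>z. z \<in> \<D> \<Longrightarrow> contractive d (\<Psi> z)" "\<And>z. z \<in> \<D> \<Longrightarrow> Schur_stable d (\<Psi> z)"
    and f: "f \<in> Hinf2"
  shows "(\<lambda>z. mat_fun d (\<lambda>w. f (z, w)) (\<Psi> z)) \<in> Hinf_mat d"
proof -
  obtain B where B: "B > 0" "f \<in> sep_Hinf B" by (rule Hinf2_obtain[OF f])
  have main: "(\<lambda>z. mat_fun d (\<lambda>w. f (z, w)) (\<Psi> z) $$ (i, j)) holomorphic_on \<D>
      \<and> bounded ((\<lambda>z. mat_fun d (\<lambda>w. f (z, w)) (\<Psi> z) $$ (i, j)) ` \<D>)"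
    if ij: "i < d" "j < d" for i j
  proof
    have g: "(\<lambda>w. f (z, w)) \<in> Hinf B" if "z \<in> \<D>" for z using B(2) that by (simp add: sep_Hinf_def)
    show "bounded ((\<lambda>z. mat_fun d (\<lambda>w. f (z, w)) (\<Psi> z) $$ (i, j)) ` \<D>)"
      unfolding bounded_iff
      by (intro exI[of _ "4 ^ d * B"] ballI, elim imageE)
         (simp add: mat_fun_entry_bound[OF \<Psi>(3) \<Psi>(2) g B(1) ij])
    define \<rho> where "\<rho> = (\<lambda>k. 1 - 1 / real (k + 2))"
    have \<rho>: "0 \<le> \<rho> k" "\<rho> k < 1" for k by (auto simp: \<rho>_def)
    define F where "F = (\<lambda>k z. mat_fun d (\<lambda>w. f (z, of_real (\<rho> k) * w)) (\<Psi> z) $$ (i, j))"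
    have Fh: "F k holomorphic_on \<D>" for k
      unfolding F_def by (rule dilated_calculus_holo[OF \<Psi>(1,2) B(2,1) ij \<rho>])
    have Fb: "norm (F k z) \<le> 4 ^ d * B" if z: "z \<in> \<D>" for k z
    proof -
      have "of_real (\<rho> k) * w \<in> \<D>" if "w \<in> \<D>" for w
        using that \<rho>[of k] mult_left_le_one_le[of "norm w" "\<rho> k"] by (simp add: norm_mult)
      hence "(\<lambda>w. f (z, of_real (\<rho> k) * w)) \<in> Hinf B"
        using holomorphic_on_compose_gen[of "\<lambda>w. of_real (\<rho> k) * w" \<D> "\<lambda>w. f (z, w)" \<D>] g[OF z]
        by (auto simp: Hinf_def o_def image_subset_iff intro!: holomorphic_intros)
      thus ?thesis unfolding F_def by (rule mat_fun_entry_bound[OF \<Psi>(3)[OF z] \<Psi>(2)[OF z] _ B(1) ij])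
    qed
    have Fl: "(\<lambda>k. F k z) \<longlonglongrightarrow> mat_fun d (\<lambda>w. f (z, w)) (\<Psi> z) $$ (i, j)" if z: "z \<in> \<D>" for z
    proof -
      let ?c = "\<lambda>n. taylor_coeff (\<lambda>w. f (z, w)) n * (\<Psi> z ^\<^sub>m n) $$ (i, j)"
      have hol: "(\<lambda>w. f (z, w)) holomorphic_on \<D>" using g[OF z] by (rule Hinf_holo)
      have "\<rho> \<longlonglongrightarrow> 1 - 0" unfolding \<rho>_def
        by (intro tendsto_intros LIMSEQ_ignore_initial_segment[OF lim_const_over_n])
      hence \<rho>1: "(\<lambda>k. complex_of_real (\<rho> k)) \<longlonglongrightarrow> 1" using tendsto_of_real by fastforce
      have "(\<lambda>k. \<Sum>n. of_real (\<rho> k) ^ n * ?c n) \<longlonglongrightarrow> (\<Sum>n. ?c n)"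
      proof (rule conjunct2[OF conjunct2[OF tannerys_theorem[where M = "\<lambda>n. norm (?c n)"]]])
        show "(\<lambda>k. of_real (\<rho> k) ^ n * ?c n) \<longlonglongrightarrow> ?c n" for n
          using tendsto_mult[OF tendsto_power[OF \<rho>1, of n] tendsto_const[of "?c n"]] by simp
        have "norm (of_real (\<rho> k) ^ n * ?c n) \<le> norm (?c n)" for n k
          using \<rho>[of k] mult_right_mono[of "\<rho> k ^ n" 1 "norm (?c n)"] power_le_one[of "\<rho> k" n]
          by (simp add: norm_mult norm_power)
        thus "\<forall>\<^sub>F (n, k) in sequentially \<times>\<^sub>F sequentially. norm (of_real (\<rho> k) ^ n * ?c n) \<le> norm (?c n)"
          by (intro always_eventually) auto
        show "summable (\<lambda>n. norm (?c n))" by (rule mat_fun_summable[OF \<Psi>(3)[OF z] hol ij])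
      qed auto
      moreover have "(\<Sum>n. of_real (\<rho> k) ^ n * ?c n) = F k z" for k
        using taylor_coeff_dilate[OF hol, of "of_real (\<rho> k)"] \<rho>[of k] ij
        by (simp add: F_def mat_fun_entry mult.assoc)
      ultimately show ?thesis using ij by (simp add: mat_fun_entry)
    qed
    obtain G r where G: "G holomorphic_on \<D>" "strict_mono (r :: nat \<Rightarrow> nat)"
        "\<And>x. x \<in> \<D> \<Longrightarrow> (\<lambda>n. F (r n) x) \<longlonglongrightarrow> G x"
      by (rule Montel[of \<D> "range F" F]) (use Fh Fb in \<open>auto intro!: exI[of _ "4 ^ d * B"] simp: subset_iff\<close>)
    have "G z = mat_fun d (\<lambda>w. f (z, w)) (\<Psi> z) $$ (i, j)" if "z \<in> \<D>" for z
      using LIMSEQ_unique[OF G(3)[OF that] LIMSEQ_subseq_LIMSEQ[OF Fl[OF that] G(2), unfolded o_def]] .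
    thus "(\<lambda>z. mat_fun d (\<lambda>w. f (z, w)) (\<Psi> z) $$ (i, j)) holomorphic_on \<D>"
      using G(1) by (subst holomorphic_cong[OF refl, symmetric]) auto
  qed
  thus ?thesis by (auto simp: Hinf_mat_def)
qed

section \<open>Parseval's identity and multipliers of the Hardy space\<close>

lemma has_integral_cis_int:
  fixes k :: int
  shows "((\<lambda>t. cis (of_int k * t)) has_integral (if k = 0 then of_real (2 * pi) else 0)) {0..2 * pi}"
proof (cases "k = 0")
  case True
  have "((\<lambda>t::real. 1 :: complex) has_integral of_real (2 * pi)) {0..2 * pi}"
    using has_integral_const_real[of "1::complex" 0 "2 * pi"] by (simp add: scaleR_conv_of_real)
  thus ?thesis using True by simp
next
  case False
  define F where "F = (\<lambda>t::real. cis (of_int k * t) / (\<i> * of_int k))"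
  have "((\<lambda>t. cis (of_int k * t)) has_integral (F (2 * pi) - F 0)) {0..2 * pi}"
  proof (rule fundamental_theorem_of_calculus)
    fix t :: real
    have "((\<lambda>z. exp (\<i> * (of_int k * z))) has_field_derivative
        of_int k * (\<i> * exp (\<i> * (of_int k * of_real t)))) (at (of_real t))"
      by (auto intro!: derivative_eq_intros)
    from has_vector_derivative_real_field[OF this]
    have "((\<lambda>t. cis (of_int k * t)) has_vector_derivative (of_int k * (\<i> * cis (of_int k * t)))) (at t)"
      unfolding cis_conv_exp by simp
    hence "(F has_vector_derivative (of_int k * (\<i> * cis (of_int k * t)) / (\<i> * of_int k))) (at t)"
      unfolding F_def by (rule has_vector_derivative_divide)
    thus "(F has_vector_derivative cis (of_int k * t)) (at t within {0..2 * pi})"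
      using False by (auto intro: has_vector_derivative_at_within)
  qed auto
  moreover have "F (2 * pi) = F 0"
    using cis_multiple_2pi[of "of_int k"] by (simp add: F_def mult.commute mult.left_commute)
  ultimately show ?thesis using False by simp
qed

text \<open>
  Orthogonality of the exponentials gives the identity for partial sums; the partial sums converge
  uniformly, so one may pass to the limit under the integral.
\<close>

lemma Parseval_circle:
  fixes c :: "nat \<Rightarrow> complex"
  assumes c: "summable (\<lambda>n. norm (c n))"
  shows "((\<lambda>t. (cmod (\<Sum>n. c n * cis (of_nat n * t)))\<^sup>2) has_integral 2 * pi * (\<Sum>n. (cmod (c n))\<^sup>2)) {0..2 * pi}"
    and "summable (\<lambda>n. (cmod (c n))\<^sup>2)"
proof -
  define P where "P = (\<lambda>N t. \<Sum>n<N. c n * cis (of_nat n * t))"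
  define F where "F = (\<lambda>t. \<Sum>n. c n * cis (of_nat n * t))"
  let ?X = "{0..2 * pi}"
  have ul: "uniform_limit ?X P F sequentially"
    unfolding P_def F_def by (rule Weierstrass_m_test[OF _ c]) (simp add: norm_mult)
  have contP: "continuous_on ?X (P N)" for N
    unfolding P_def by (intro continuous_intros)
  have contF: "continuous_on ?X F"
    by (rule uniform_limit_theorem[OF _ ul]) (use contP in auto)
  have bF: "bounded (F ` ?X)"
    by (intro compact_imp_bounded compact_continuous_image contF) auto
  have ulc: "uniform_limit ?X (\<lambda>N t. cnj (P N t)) (\<lambda>t. cnj (F t)) sequentially"
    by (rule bounded_linear.uniform_limit[OF bounded_linear_cnj ul])
  have bFc: "bounded ((\<lambda>t. cnj (F t)) ` ?X)"
    using bF by (auto simp: bounded_iff)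
  have "uniform_limit ?X (\<lambda>N t. P N t * cnj (P N t)) (\<lambda>t. F t * cnj (F t)) sequentially"
    by (rule uniform_lim_mult[OF ul ulc bF bFc])
  then obtain I J where IJ: "\<And>N. ((\<lambda>t. P N t * cnj (P N t)) has_integral I N) ?X"
      "((\<lambda>t. F t * cnj (F t)) has_integral J) ?X" "I \<longlonglongrightarrow> J"
    by (rule uniform_limit_integral[where F = sequentially]) (use contP in \<open>auto intro!: continuous_intros\<close>)
  have IN: "I N = of_real (2 * pi * (\<Sum>n<N. (cmod (c n))\<^sup>2))" for N
  proof -
    have "((\<lambda>t. \<Sum>n<N. \<Sum>m<N. c n * cnj (c m) * cis (of_int (int n - int m) * t)) has_integral
        (\<Sum>n<N. \<Sum>m<N. c n * cnj (c m) * (if int n - int m = 0 then of_real (2 * pi) else 0))) ?X"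
      by (intro has_integral_sum has_integral_mult_right has_integral_cis_int) auto
    also have "(\<lambda>t. \<Sum>n<N. \<Sum>m<N. c n * cnj (c m) * cis (of_int (int n - int m) * t)) = (\<lambda>t. P N t * cnj (P N t))"
    proof
      fix t
      have "cis (of_int (int n - int m) * t) = cis (of_nat n * t) * cnj (cis (of_nat m * t))" for n m
        by (simp add: cis_cnj cis_mult left_diff_distrib)
      thus "(\<Sum>n<N. \<Sum>m<N. c n * cnj (c m) * cis (of_int (int n - int m) * t)) = P N t * cnj (P N t)"
        unfolding P_def cnj_sum sum_product by (simp add: mult_ac)
    qed
    also have "(\<Sum>n<N. \<Sum>m<N. c n * cnj (c m) * (if int n - int m = 0 then of_real (2 * pi) else 0)) =
        (\<Sum>n<N. of_real (2 * pi) * of_real ((cmod (c n))\<^sup>2))"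
    proof (rule sum.cong[OF refl])
      fix n assume n: "n \<in> {..<N}"
      have "(\<Sum>m<N. c n * cnj (c m) * (if int n - int m = 0 then of_real (2 * pi) else 0)) =
          (\<Sum>m<N. if n = m then c n * cnj (c n) * of_real (2 * pi) else 0)"
        by (intro sum.cong) auto
      also have "\<dots> = of_real (2 * pi) * of_real ((cmod (c n))\<^sup>2)"
        using n by (simp add: sum.delta' complex_norm_square[symmetric] mult.commute)
      finally show "(\<Sum>m<N. c n * cnj (c m) * (if int n - int m = 0 then of_real (2 * pi) else 0)) = \<dots>" .
    qed
    also have "\<dots> = of_real (2 * pi * (\<Sum>n<N. (cmod (c n))\<^sup>2))"
      by (simp add: sum_distrib_left)
    finally show ?thesis using IJ(1)[of N] by (rule has_integral_unique[rotated])
  qed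
  show sm: "summable (\<lambda>n. (cmod (c n))\<^sup>2)"
  proof -
    have "(\<lambda>n. norm (c n)) \<longlonglongrightarrow> 0" using c by (rule summable_LIMSEQ_zero)
    hence "\<forall>\<^sub>F n in sequentially. norm (c n) < 1" by (rule order_tendstoD) simp
    then obtain N where N: "\<And>n. n \<ge> N \<Longrightarrow> norm (c n) < 1" by (auto simp: eventually_sequentially)
    show ?thesis
    proof (rule summable_comparison_test'[OF c, of N])
      fix n assume "n \<ge> N"
      thus "norm ((cmod (c n))\<^sup>2) \<le> norm (c n)"
        using N[of n] mult_left_le[of "norm (c n)" "norm (c n)"] by (simp add: power2_eq_square)
    qed
  qed
  have "(\<lambda>N. 2 * pi * (\<Sum>n<N. (cmod (c n))\<^sup>2)) \<longlonglongrightarrow> 2 * pi * (\<Sum>n. (cmod (c n))\<^sup>2)"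
    by (intro tendsto_intros summable_LIMSEQ sm)
  hence "I \<longlonglongrightarrow> of_real (2 * pi * (\<Sum>n. (cmod (c n))\<^sup>2))"
    unfolding IN[abs_def] by (rule tendsto_of_real)
  hence J: "J = of_real (2 * pi * (\<Sum>n. (cmod (c n))\<^sup>2))" using IJ(3) LIMSEQ_unique by blast
  have "((\<lambda>t. Re (F t * cnj (F t))) has_integral Re J) ?X"
    using has_integral_linear[OF IJ(2) bounded_linear_Re] by (simp add: o_def)
  moreover have "Re (F t * cnj (F t)) = (cmod (F t))\<^sup>2" for t
    by (simp add: complex_norm_square[symmetric] flip: of_real_power)
  ultimately have "((\<lambda>t. (cmod (F t))\<^sup>2) has_integral Re J) ?X" by simp
  thus "((\<lambda>t. (cmod (\<Sum>n. c n * cis (of_nat n * t)))\<^sup>2) has_integral 2 * pi * (\<Sum>n. (cmod (c n))\<^sup>2)) {0..2 * pi}"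
    unfolding J F_def by simp
qed

text \<open>
  On a circle of radius \<open>r < 1\<close> the pointwise bound \<open>|h f| \<le> B |f|\<close> integrates, and Parseval's
  identity turns it into a bound for the coefficients; then \<open>r \<rightarrow> 1\<close>.
\<close>

lemma Hinf_mult_l2:
  assumes h: "h \<in> Hinf B" and f: "f holomorphic_on \<D>" and sm: "summable (\<lambda>n. (cmod (taylor_coeff f n))\<^sup>2)"
  shows "summable (\<lambda>n. (cmod (taylor_coeff (\<lambda>z. h z * f z) n))\<^sup>2)"
    and "(\<Sum>n. (cmod (taylor_coeff (\<lambda>z. h z * f z) n))\<^sup>2) \<le> B\<^sup>2 * (\<Sum>n. (cmod (taylor_coeff f n))\<^sup>2)"
proof -
  define g where "g = (\<lambda>z. h z * f z)"
  define S where "S = B\<^sup>2 * (\<Sum>n. (cmod (taylor_coeff f n))\<^sup>2)"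
  have g: "g holomorphic_on \<D>" unfolding g_def using h f by (auto simp: Hinf_def intro!: holomorphic_intros)
  have circle: "((\<lambda>t. (cmod (u (of_real r * cis t)))\<^sup>2) has_integral
        2 * pi * (\<Sum>n. (cmod (taylor_coeff u n * of_real r ^ n))\<^sup>2)) {0..2 * pi}"
       "summable (\<lambda>n. (cmod (taylor_coeff u n * of_real r ^ n))\<^sup>2)"
    if u: "u holomorphic_on \<D>" and r: "0 < r" "r < 1" for u r
  proof -
    have s: "summable (\<lambda>n. norm (taylor_coeff u n * of_real r ^ n))"
      using taylor_coeff_summable[OF u, of r] r by (simp add: norm_mult norm_power)
    have "(\<Sum>n. taylor_coeff u n * of_real r ^ n * cis (of_nat n * t)) = u (of_real r * cis t)" for t
    proof -
      have "of_real r * cis t \<in> \<D>" using r by (simp add: norm_mult)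
      from taylor_sums[OF u this] show ?thesis
        by (simp add: sums_iff power_mult_distrib Complex.DeMoivre mult.assoc)
    qed
    with Parseval_circle[OF s] show "((\<lambda>t. (cmod (u (of_real r * cis t)))\<^sup>2) has_integral
        2 * pi * (\<Sum>n. (cmod (taylor_coeff u n * of_real r ^ n))\<^sup>2)) {0..2 * pi}"
       "summable (\<lambda>n. (cmod (taylor_coeff u n * of_real r ^ n))\<^sup>2)" by simp_all
  qed
  have part: "(\<Sum>n<N. (cmod (taylor_coeff g n * of_real r ^ n))\<^sup>2) \<le> S" if r: "0 < r" "r < 1" for r N
  proof -
    have "2 * pi * (\<Sum>n. (cmod (taylor_coeff g n * of_real r ^ n))\<^sup>2) \<le>
        B\<^sup>2 * (2 * pi * (\<Sum>n. (cmod (taylor_coeff f n * of_real r ^ n))\<^sup>2))"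
    proof (rule has_integral_le[OF circle(1)[OF g r] has_integral_mult_right[OF circle(1)[OF f r]]])
      fix t
      have "of_real r * cis t \<in> \<D>" using r by (simp add: norm_mult)
      hence "cmod (h (of_real r * cis t)) \<le> B" by (rule Hinf_bound[OF h])
      thus "(cmod (g (of_real r * cis t)))\<^sup>2 \<le> B\<^sup>2 * (cmod (f (of_real r * cis t)))\<^sup>2"
        unfolding g_def norm_mult power_mult_distrib by (intro mult_right_mono power_mono) auto
    qed
    hence "(\<Sum>n. (cmod (taylor_coeff g n * of_real r ^ n))\<^sup>2) \<le> B\<^sup>2 * (\<Sum>n. (cmod (taylor_coeff f n * of_real r ^ n))\<^sup>2)"
      by (simp add: mult.left_commute)
    also have "\<dots> \<le> S" unfolding S_def
    proof (intro mult_left_mono suminf_le circle(2)[OF f r] sm)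
      fix n
      have "cmod (taylor_coeff f n * of_real r ^ n) \<le> cmod (taylor_coeff f n)"
        using r by (simp add: norm_mult norm_power mult_left_le power_le_one)
      thus "(cmod (taylor_coeff f n * of_real r ^ n))\<^sup>2 \<le> (cmod (taylor_coeff f n))\<^sup>2"
        by (intro power_mono) auto
    qed auto
    finally show ?thesis using sum_le_suminf[OF circle(2)[OF g r], of "{..<N}"] by simp
  qed
  have bound: "(\<Sum>n<N. (cmod (taylor_coeff g n))\<^sup>2) \<le> S" for N
  proof (rule tendsto_upperbound)
    have "((\<lambda>r. \<Sum>n<N. (cmod (taylor_coeff g n * of_real r ^ n))\<^sup>2) \<longlongrightarrow>
        (\<Sum>n<N. (cmod (taylor_coeff g n * of_real 1 ^ n))\<^sup>2)) (at_left (1::real))"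
      by (intro tendsto_intros)
    thus "((\<lambda>r. \<Sum>n<N. (cmod (taylor_coeff g n * of_real r ^ n))\<^sup>2) \<longlongrightarrow>
        (\<Sum>n<N. (cmod (taylor_coeff g n))\<^sup>2)) (at_left (1::real))" by simp
    have "\<forall>\<^sub>F r::real in at_left 1. r \<in> {0<..<1}"
      by (rule eventually_at_leftI[of 0]) auto
    thus "\<forall>\<^sub>F r::real in at_left 1. (\<Sum>n<N. (cmod (taylor_coeff g n * of_real r ^ n))\<^sup>2) \<le> S"
      by eventually_elim (use part in auto)
  qed auto
  show s: "summable (\<lambda>n. (cmod (taylor_coeff (\<lambda>z. h z * f z) n))\<^sup>2)"
    unfolding g_def[symmetric] by (rule summableI_nonneg_bounded[OF _ bound]) auto
  show "(\<Sum>n. (cmod (taylor_coeff (\<lambda>z. h z * f z) n))\<^sup>2) \<le> B\<^sup>2 * (\<Sum>n. (cmod (taylor_coeff f n))\<^sup>2)"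
    using suminf_le_const[OF s] bound unfolding g_def S_def by blast
qed

lemma power_series_l2:
  assumes sm: "summable (\<lambda>n. (cmod (c n))\<^sup>2)"
  shows "(\<lambda>z. \<Sum>n. c n * z ^ n) holomorphic_on \<D>"
    and "taylor_coeff (\<lambda>z. \<Sum>n. c n * z ^ n) n = c n"
proof -
  obtain B where B: "\<And>n. norm ((cmod (c n))\<^sup>2) \<le> B"
    using summable_imp_bounded[OF sm] by (auto simp: bounded_iff)
  have cb: "cmod (c n) \<le> 1 + B" for n
  proof (cases "cmod (c n) \<le> 1")
    case True
    thus ?thesis using order_trans[OF norm_ge_zero B[of n]] by simp
  next
    case False
    hence "cmod (c n) * 1 \<le> cmod (c n) * cmod (c n)" by (intro mult_left_mono) auto
    thus ?thesis using B[of n] by (simp add: power2_eq_square)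
  qed
  have summ: "summable (\<lambda>n. c n * z ^ n)" if "z \<in> \<D>" for z
  proof (rule summable_comparison_test'[of "\<lambda>n. (1 + B) * norm z ^ n" 0])
    show "summable (\<lambda>n. (1 + B) * norm z ^ n)" using that by (intro summable_mult summable_geometric) simp
    show "norm (c n * z ^ n) \<le> (1 + B) * norm z ^ n" for n
      unfolding norm_mult norm_power by (intro mult_right_mono cb) auto
  qed
  show hol: "(\<lambda>z. \<Sum>n. c n * z ^ n) holomorphic_on \<D>"
    by (rule power_series_holomorphic[of _ _ c]) (use summ in auto)
  define F where "F = Abs_fps c"
  have "fps_conv_radius F \<ge> 1"
    unfolding fps_conv_radius_def F_def
  proof (rule conv_radius_geI_ex')
    fix r :: real assume "0 < r" "ereal r < 1"
    thus "summable (\<lambda>n. fps_nth (Abs_fps c) n * of_real r ^ n)"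
      using summ[of "of_real r"] by simp
  qed
  note rad = this
  have "(\<lambda>z. \<Sum>n. c n * z ^ n) has_fps_expansion F"
    unfolding has_fps_expansion_def
  proof (intro conjI)
    show "0 < fps_conv_radius F" by (rule less_le_trans[OF _ rad]) simp
    show "\<forall>\<^sub>F z in nhds 0. eval_fps F z = (\<Sum>n. c n * z ^ n)"
      by (auto simp: eval_fps_def F_def)
  qed
  from fps_nth_fps_expansion[OF this, of n]
  show "taylor_coeff (\<lambda>z. \<Sum>n. c n * z ^ n) n = c n" by (simp add: taylor_coeff_def F_def)
qed

section \<open>The Hardy space as an inner product space\<close>

definition hcoeff :: "(complex \<Rightarrow> complex vec) \<Rightarrow> nat \<Rightarrow> nat \<Rightarrow> complex" where
  "hcoeff f i n = taylor_coeff (\<lambda>z. f z $ i) n"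

lemma hardy_carrier: "f \<in> hardy d \<Longrightarrow> f z \<in> carrier_vec d"
  and hardy_dim: "f \<in> hardy d \<Longrightarrow> dim_vec (f z) = d"
  and hardy_outside: "f \<in> hardy d \<Longrightarrow> z \<notin> \<D> \<Longrightarrow> f z = 0\<^sub>v d"
  and hardy_holo: "f \<in> hardy d \<Longrightarrow> i < d \<Longrightarrow> (\<lambda>z. f z $ i) holomorphic_on \<D>"
  and hardy_summable: "f \<in> hardy d \<Longrightarrow> i < d \<Longrightarrow> summable (\<lambda>n. (cmod (hcoeff f i n))\<^sup>2)"
  by (auto simp: hardy_def hcoeff_def intro: carrier_vecD)

lemma hardyI:
  assumes "\<And>z. f z \<in> carrier_vec d" "\<And>z. z \<notin> \<D> \<Longrightarrow> f z = 0\<^sub>v d"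
    "\<And>i. i < d \<Longrightarrow> (\<lambda>z. f z $ i) holomorphic_on \<D>"
    "\<And>i. i < d \<Longrightarrow> summable (\<lambda>n. (cmod (hcoeff f i n))\<^sup>2)"
  shows "f \<in> hardy d"
  using assms by (auto simp: hardy_def hcoeff_def)

lemma hardy_eqI:
  assumes f: "f \<in> hardy d" and g: "g \<in> hardy d"
    and eq: "\<And>z i. z \<in> \<D> \<Longrightarrow> i < d \<Longrightarrow> f z $ i = g z $ i"
  shows "f = g"
proof
  fix z
  show "f z = g z"
  proof (cases "z \<in> \<D>")
    case True
    thus ?thesis using hardy_dim[OF f] hardy_dim[OF g] eq by (intro eq_vecI) auto
  next
    case False
    thus ?thesis using hardy_outside[OF f] hardy_outside[OF g] by simp
  qed
qed

lemma hcoeff_sums: "f \<in> hardy d \<Longrightarrow> i < d \<Longrightarrow> z \<in> \<D> \<Longrightarrow> (\<lambda>n. hcoeff f i n * z ^ n) sums (f z $ i)"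
  unfolding hcoeff_def by (intro taylor_sums hardy_holo)

lemma hardy_eq_hcoeffI:
  assumes f: "f \<in> hardy d" and g: "g \<in> hardy d"
    and eq: "\<And>i n. i < d \<Longrightarrow> hcoeff f i n = hcoeff g i n"
  shows "f = g"
proof (rule hardy_eqI[OF f g])
  fix z i assume z: "z \<in> \<D>" and i: "i < d"
  show "f z $ i = g z $ i"
    using hcoeff_sums[OF f i z] hcoeff_sums[OF g i z] eq[OF i] by (simp add: sums_unique2)
qed

definition of_hcoeff :: "nat \<Rightarrow> (nat \<Rightarrow> nat \<Rightarrow> complex) \<Rightarrow> complex \<Rightarrow> complex vec" where
  "of_hcoeff d c z = (if z \<in> \<D> then Matrix.vec d (\<lambda>i. \<Sum>n. c i n * z ^ n) else 0\<^sub>v d)"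

lemma of_hcoeff:
  assumes c: "\<And>i. i < d \<Longrightarrow> summable (\<lambda>n. (cmod (c i n))\<^sup>2)"
  shows "of_hcoeff d c \<in> hardy d" and "\<And>i n. i < d \<Longrightarrow> hcoeff (of_hcoeff d c) i n = c i n"
proof -
  have hol: "(\<lambda>z. of_hcoeff d c z $ i) holomorphic_on \<D>" if "i < d" for i
    using power_series_l2(1)[OF c[OF that]] that
    by (subst holomorphic_cong[OF refl]) (auto simp: of_hcoeff_def)
  show co: "hcoeff (of_hcoeff d c) i n = c i n" if i: "i < d" for i n
  proof -
    have "hcoeff (of_hcoeff d c) i n = taylor_coeff (\<lambda>z. \<Sum>n. c i n * z ^ n) n"
      unfolding hcoeff_def using i by (intro taylor_coeff_cong hol) (auto simp: of_hcoeff_def)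
    thus ?thesis using power_series_l2(2)[OF c[OF i]] by simp
  qed
  show "of_hcoeff d c \<in> hardy d"
    by (rule hardyI) (use hol co c in \<open>auto simp: of_hcoeff_def\<close>)
qed

lemma summable_sq_add:
  assumes "summable (\<lambda>n. (cmod (a n))\<^sup>2)" "summable (\<lambda>n. (cmod (b n))\<^sup>2)"
  shows "summable (\<lambda>n. (cmod (a n + b n))\<^sup>2)"
proof (rule summable_comparison_test')
  show "summable (\<lambda>n. 2 * (cmod (a n))\<^sup>2 + 2 * (cmod (b n))\<^sup>2)"
    by (intro summable_add summable_mult assms)
  fix n
  have "(cmod (a n + b n))\<^sup>2 \<le> (cmod (a n) + cmod (b n))\<^sup>2"
    by (intro power_mono norm_triangle_ineq) auto
  also have "\<dots> \<le> 2 * (cmod (a n))\<^sup>2 + 2 * (cmod (b n))\<^sup>2"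
    using zero_le_power2[of "cmod (a n) - cmod (b n)"] by (simp add: power2_eq_square algebra_simps)
  finally show "norm ((cmod (a n + b n))\<^sup>2) \<le> 2 * (cmod (a n))\<^sup>2 + 2 * (cmod (b n))\<^sup>2" by simp
qed

lemma hcoeff_hadd:
  assumes "f \<in> hardy d" "g \<in> hardy d" "i < d"
  shows "hcoeff (hadd f g) i n = hcoeff f i n + hcoeff g i n"
proof -
  have "hcoeff (hadd f g) i n = taylor_coeff (\<lambda>z. f z $ i + g z $ i) n"
    using assms hardy_dim[OF assms(1)] hardy_dim[OF assms(2)] by (simp add: hcoeff_def hadd_def)
  thus ?thesis using taylor_coeff_add[OF hardy_holo[OF assms(1,3)] hardy_holo[OF assms(2,3)]]
    by (simp add: hcoeff_def)
qed

lemma hcoeff_hscale: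
  assumes "f \<in> hardy d" "i < d"
  shows "hcoeff (hscale c f) i n = c * hcoeff f i n"
proof -
  have "hcoeff (hscale c f) i n = taylor_coeff (\<lambda>z. c * f z $ i) n"
    using assms hardy_dim[OF assms(1)] by (simp add: hcoeff_def hscale_def)
  thus ?thesis using taylor_coeff_cmult[OF hardy_holo[OF assms]] by (simp add: hcoeff_def)
qed

lemma hadd_hardy [simp]:
  assumes f: "f \<in> hardy d" and g: "g \<in> hardy d"
  shows "hadd f g \<in> hardy d"
proof (rule hardyI)
  show "hadd f g z \<in> carrier_vec d" for z using hardy_carrier[OF f] hardy_carrier[OF g] by (simp add: hadd_def)
  show "hadd f g z = 0\<^sub>v d" if "z \<notin> \<D>" for z
    using hardy_outside[OF f that] hardy_outside[OF g that] by (simp add: hadd_def)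
  fix i assume i: "i < d"
  show "(\<lambda>z. hadd f g z $ i) holomorphic_on \<D>"
    using hardy_holo[OF f i] hardy_holo[OF g i] i hardy_dim[OF f] hardy_dim[OF g]
    by (auto simp: hadd_def intro!: holomorphic_intros)
  show "summable (\<lambda>n. (cmod (hcoeff (hadd f g) i n))\<^sup>2)"
    unfolding hcoeff_hadd[OF f g i] by (intro summable_sq_add hardy_summable[OF f i] hardy_summable[OF g i])
qed

lemma hscale_hardy [simp]:
  assumes f: "f \<in> hardy d"
  shows "hscale c f \<in> hardy d"
proof (rule hardyI)
  show "hscale c f z \<in> carrier_vec d" for z using hardy_carrier[OF f] by (simp add: hscale_def)
  show "hscale c f z = 0\<^sub>v d" if "z \<notin> \<D>" for z
    using hardy_outside[OF f that] by (auto simp: hscale_def intro!: eq_vecI)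
  fix i assume i: "i < d"
  show "(\<lambda>z. hscale c f z $ i) holomorphic_on \<D>"
    using hardy_holo[OF f i] i hardy_dim[OF f] by (auto simp: hscale_def intro!: holomorphic_intros)
  show "summable (\<lambda>n. (cmod (hcoeff (hscale c f) i n))\<^sup>2)"
    unfolding hcoeff_hscale[OF f i] norm_mult power_mult_distrib
    by (intro summable_mult hardy_summable[OF f i])
qed

lemma hzero_hardy [simp]: "hzero d \<in> hardy d"
proof (rule hardyI)
  show "(\<lambda>z. hzero d z $ i) holomorphic_on \<D>" if "i < d" for i using that by (simp add: hzero_def)
  show "summable (\<lambda>n. (cmod (hcoeff (hzero d) i n))\<^sup>2)" if "i < d" for i
    using that by (simp add: hzero_def hcoeff_def taylor_coeff_const)
qed (auto simp: hzero_def)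

lemma hcoeff_hzero: "i < d \<Longrightarrow> hcoeff (hzero d) i n = 0"
  by (simp add: hzero_def hcoeff_def taylor_coeff_const)

lemma hminus_eq:
  assumes "f \<in> hardy d" "g \<in> hardy d"
  shows "hminus f g = hadd f (hscale (-1) g)"
  using hardy_dim[OF assms(1)] hardy_dim[OF assms(2)]
  by (auto simp: hminus_def hadd_def hscale_def fun_eq_iff intro!: eq_vecI)

lemma hminus_hardy [simp]: "f \<in> hardy d \<Longrightarrow> g \<in> hardy d \<Longrightarrow> hminus f g \<in> hardy d"
  by (subst hminus_eq) auto

lemma hadd_index: "i < dim_vec (g z) \<Longrightarrow> hadd f g z $ i = f z $ i + g z $ i"
  and hminus_index: "i < dim_vec (g z) \<Longrightarrow> hminus f g z $ i = f z $ i - g z $ i"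
  and hscale_index: "i < dim_vec (f z) \<Longrightarrow> hscale c f z $ i = c * f z $ i"
  and hzero_index: "i < d \<Longrightarrow> hzero d z $ i = 0"
  and hadd_dim: "dim_vec (hadd f g z) = dim_vec (g z)"
  and hminus_dim: "dim_vec (hminus f g z) = dim_vec (g z)"
  and hscale_dim: "dim_vec (hscale c f z) = dim_vec (f z)"
  and hzero_dim: "dim_vec (hzero d z) = d"
  by (simp_all add: hadd_def hminus_def hscale_def hzero_def)

text \<open>
  Identities between combinations of elements are proved pointwise: \<open>hardy_eqI\<close> reduces them to
  coordinates and these rules evaluate the coordinates.
\<close>

lemmas hardy_index = hadd_index hminus_index hscale_index hzero_index hadd_dim hminus_dim hscale_dim hzero_dim hardy_dim

lemma hminus_eq_hzeroD:
  assumes f: "f \<in> hardy d" and g: "g \<in> hardy d" and z: "hminus f g = hzero d"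
  shows "f = g"
proof (rule hardy_eqI[OF f g])
  fix w i assume i: "i < d"
  have "hminus f g w $ i = 0" using z i by (simp add: hzero_index)
  thus "f w $ i = g w $ i" using f g i by (simp add: hardy_index)
qed

lemma summable_inner:
  assumes "summable (\<lambda>n. (cmod (a n))\<^sup>2)" "summable (\<lambda>n. (cmod (b n))\<^sup>2)"
  shows "summable (\<lambda>n. a n * cnj (b n))"
proof (rule summable_comparison_test')
  show "summable (\<lambda>n. (cmod (a n))\<^sup>2 + (cmod (b n))\<^sup>2)" by (intro summable_add assms)
  fix n
  have "2 * (cmod (a n) * cmod (b n)) \<le> (cmod (a n))\<^sup>2 + (cmod (b n))\<^sup>2"
    using zero_le_power2[of "cmod (a n) - cmod (b n)"] by (simp add: power2_eq_square algebra_simps)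
  moreover have "0 \<le> cmod (a n) * cmod (b n)" by simp
  moreover have "norm (a n * cnj (b n)) = cmod (a n) * cmod (b n)" by (simp add: norm_mult)
  ultimately show "norm (a n * cnj (b n)) \<le> (cmod (a n))\<^sup>2 + (cmod (b n))\<^sup>2" by linarith
qed

lemma hinner_hcoeff: "hinner d f g = (\<Sum>i<d. \<Sum>n. hcoeff f i n * cnj (hcoeff g i n))"
  by (simp add: hinner_def hcoeff_def)

lemma hinner_summable:
  "f \<in> hardy d \<Longrightarrow> g \<in> hardy d \<Longrightarrow> i < d \<Longrightarrow> summable (\<lambda>n. hcoeff f i n * cnj (hcoeff g i n))"
  by (intro summable_inner hardy_summable)

lemma hinner_hadd_left:
  assumes "f \<in> hardy d" "g \<in> hardy d" "k \<in> hardy d"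
  shows "hinner d (hadd f g) k = hinner d f k + hinner d g k"
  unfolding hinner_hcoeff sum.distrib[symmetric] using assms
  by (intro sum.cong refl)
     (simp add: hcoeff_hadd hinner_summable suminf_add distrib_right)

lemma hinner_hscale_left:
  assumes "f \<in> hardy d" "k \<in> hardy d"
  shows "hinner d (hscale c f) k = c * hinner d f k"
  unfolding hinner_hcoeff sum_distrib_left using assms
  by (intro sum.cong refl)
     (simp add: hcoeff_hscale hinner_summable suminf_mult[symmetric] mult.assoc)

lemma hinner_commute:
  assumes "f \<in> hardy d" "g \<in> hardy d"
  shows "hinner d f g = cnj (hinner d g f)"
  unfolding hinner_hcoeff cnj_sum
proof (rule sum.cong[OF refl])
  fix i assume "i \<in> {..<d}"
  hence "(\<lambda>n. cnj (hcoeff g i n * cnj (hcoeff f i n))) sums cnj (\<Sum>n. hcoeff g i n * cnj (hcoeff f i n))"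
    using assms by (intro sums_cnj[THEN iffD2] summable_sums hinner_summable) auto
  thus "(\<Sum>n. hcoeff f i n * cnj (hcoeff g i n)) = cnj (\<Sum>n. hcoeff g i n * cnj (hcoeff f i n))"
    by (simp add: sums_iff mult.commute)
qed

lemma hinner_hadd_right:
  assumes "f \<in> hardy d" "g \<in> hardy d" "k \<in> hardy d"
  shows "hinner d k (hadd f g) = hinner d k f + hinner d k g"
  using assms hinner_commute[of k d "hadd f g"] hinner_commute[of k d f] hinner_commute[of k d g]
  by (simp add: hinner_hadd_left)

lemma hinner_hscale_right:
  assumes "f \<in> hardy d" "k \<in> hardy d"
  shows "hinner d k (hscale c f) = cnj c * hinner d k f"
  using assms hinner_commute[of k d "hscale c f"] hinner_commute[of k d f]
  by (simp add: hinner_hscale_left)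

lemma hinner_hminus_left:
  assumes "f \<in> hardy d" "g \<in> hardy d" "k \<in> hardy d"
  shows "hinner d (hminus f g) k = hinner d f k - hinner d g k"
  using assms by (simp add: hminus_eq hinner_hadd_left hinner_hscale_left)

lemma hinner_hminus_right:
  assumes "f \<in> hardy d" "g \<in> hardy d" "k \<in> hardy d"
  shows "hinner d k (hminus f g) = hinner d k f - hinner d k g"
  using assms by (simp add: hminus_eq hinner_hadd_right hinner_hscale_right)

lemma hinner_hzero_left: "hinner d (hzero d) k = 0"
  and hinner_hzero_right: "hinner d k (hzero d) = 0"
  by (simp_all add: hinner_hcoeff hcoeff_hzero)

lemmas hinner_simps = hinner_hadd_left hinner_hadd_right hinner_hminus_left hinner_hminus_right
  hinner_hscale_left hinner_hscale_right hinner_hzero_left hinner_hzero_right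

text \<open>
  The squared norm, in terms of which the Hilbert space identities are free of square roots.
\<close>

definition hsq :: "nat \<Rightarrow> (complex \<Rightarrow> complex vec) \<Rightarrow> real" where
  "hsq d f = (\<Sum>i<d. \<Sum>n. (cmod (hcoeff f i n))\<^sup>2)"

lemma hinner_self:
  assumes "f \<in> hardy d" shows "hinner d f f = of_real (hsq d f)"
  unfolding hinner_hcoeff hsq_def of_real_sum
  by (intro sum.cong refl) (simp add: suminf_of_real[OF hardy_summable[OF assms]] complex_norm_square
      flip: of_real_power)

lemma hsq_nonneg: "f \<in> hardy d \<Longrightarrow> 0 \<le> hsq d f"
  unfolding hsq_def by (intro sum_nonneg suminf_nonneg hardy_summable[of f d]) auto

lemma hnorm_hsq: "f \<in> hardy d \<Longrightarrow> hnorm d f = sqrt (hsq d f)"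
  by (simp add: hnorm_def hinner_self)

lemma hnorm_sq: "f \<in> hardy d \<Longrightarrow> (hnorm d f)\<^sup>2 = hsq d f"
  by (simp add: hnorm_hsq hsq_nonneg)

lemma hnorm_nonneg: "f \<in> hardy d \<Longrightarrow> 0 \<le> hnorm d f"
  by (simp add: hnorm_hsq hsq_nonneg)

lemma hcoeff_sq_le_hsq:
  assumes f: "f \<in> hardy d" and i: "i < d"
  shows "(\<Sum>n<N. (cmod (hcoeff f i n))\<^sup>2) \<le> hsq d f"
proof -
  have "(\<Sum>n<N. (cmod (hcoeff f i n))\<^sup>2) \<le> (\<Sum>n. (cmod (hcoeff f i n))\<^sup>2)"
    by (intro sum_le_suminf hardy_summable[OF f i]) auto
  also have "\<dots> \<le> hsq d f" unfolding hsq_def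
    using i by (intro member_le_sum suminf_nonneg hardy_summable[OF f]) auto
  finally show ?thesis .
qed

lemma norm_hcoeff_le:
  assumes f: "f \<in> hardy d" and i: "i < d"
  shows "cmod (hcoeff f i n) \<le> hnorm d f"
proof -
  have "(cmod (hcoeff f i n))\<^sup>2 \<le> (\<Sum>m<Suc n. (cmod (hcoeff f i m))\<^sup>2)"
    by (rule member_le_sum) auto
  also have "\<dots> \<le> (hnorm d f)\<^sup>2" unfolding hnorm_sq[OF f] by (rule hcoeff_sq_le_hsq[OF f i])
  finally show ?thesis by (rule power2_le_imp_le) (rule hnorm_nonneg[OF f])
qed

lemma hsq_eq_0:
  assumes f: "f \<in> hardy d" and z: "hsq d f = 0"
  shows "f = hzero d"
proof (rule hardy_eq_hcoeffI[OF f hzero_hardy])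
  fix i n assume i: "i < d"
  show "hcoeff f i n = hcoeff (hzero d) i n"
    using norm_hcoeff_le[OF f i, of n] z by (simp add: hnorm_hsq[OF f] hcoeff_hzero i)
qed

lemma hardy_eq_hinnerI:
  assumes f: "f \<in> hardy d" and g: "g \<in> hardy d"
    and eq: "\<And>u. u \<in> hardy d \<Longrightarrow> hinner d u f = hinner d u g"
  shows "f = g"
proof -
  have h: "hminus f g \<in> hardy d" using f g by simp
  have "hinner d (hminus f g) (hminus f g) = 0"
    using eq[OF h] f g h by (simp add: hinner_hminus_right)
  hence "hsq d (hminus f g) = 0" using hinner_self[OF h] by simp
  hence "hminus f g = hzero d" by (rule hsq_eq_0[OF h])
  thus ?thesis by (rule hminus_eq_hzeroD[OF f g])
qed

lemma hsq_hminus_hscale: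
  assumes "f \<in> hardy d" "g \<in> hardy d"
  shows "hsq d (hminus f (hscale t g)) = hsq d f - 2 * Re (cnj t * hinner d f g) + (cmod t)\<^sup>2 * hsq d g"
proof -
  have "complex_of_real (hsq d (hminus f (hscale t g))) = hinner d (hminus f (hscale t g)) (hminus f (hscale t g))"
    using assms by (simp add: hinner_self)
  also have "\<dots> = of_real (hsq d f) - (cnj t * hinner d f g + cnj (cnj t * hinner d f g)) + of_real ((cmod t)\<^sup>2) * of_real (hsq d g)"
    using assms hinner_commute[OF assms(2,1)]
    by (simp add: hinner_simps hinner_self[symmetric] complex_norm_square algebra_simps del: of_real_power)
  also have "cnj t * hinner d f g + cnj (cnj t * hinner d f g) = of_real (2 * Re (cnj t * hinner d f g))"
    by (rule complex_add_cnj)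
  finally have "complex_of_real (hsq d (hminus f (hscale t g))) =
     of_real (hsq d f - 2 * Re (cnj t * hinner d f g) + (cmod t)\<^sup>2 * hsq d g)"
    by simp
  thus ?thesis by (simp only: of_real_eq_iff)
qed

text \<open>
  The distance from \<open>f\<close> to its projection onto the line through \<open>g\<close>. Both the Cauchy-Schwarz
  inequality and the orthogonality of a closest point come out of this formula.
\<close>

lemma hsq_best_hscale:
  assumes f: "f \<in> hardy d" and g: "g \<in> hardy d" and s: "hsq d g \<noteq> 0"
  shows "hsq d (hminus f (hscale (hinner d f g / of_real (hsq d g)) g)) = hsq d f - (cmod (hinner d f g))\<^sup>2 / hsq d g"
proof -
  define c where "c = hinner d f g"
  have "cnj (c / of_real (hsq d g)) * c = of_real ((cmod c)\<^sup>2 / hsq d g)"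
    by (simp add: complex_norm_square[symmetric] mult.commute flip: of_real_power)
  moreover have "(cmod (c / of_real (hsq d g)))\<^sup>2 * hsq d g = (cmod c)\<^sup>2 / hsq d g"
    using s by (simp add: norm_divide power_divide power2_eq_square)
  ultimately show ?thesis
    unfolding hsq_hminus_hscale[OF f g] c_def[symmetric] by (simp del: complex_cnj_divide)
qed

lemma hCauchy_Schwarz:
  assumes f: "f \<in> hardy d" and g: "g \<in> hardy d"
  shows "cmod (hinner d f g) \<le> hnorm d f * hnorm d g"
proof (cases "hsq d g = 0")
  case True
  hence "g = hzero d" by (rule hsq_eq_0[OF g])
  thus ?thesis using hnorm_nonneg[OF f] hnorm_nonneg[OF g] by (simp add: hinner_hzero_right)
next
  case False
  hence pos: "hsq d g > 0" using hsq_nonneg[OF g] by simp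
  have "0 \<le> hsq d f - (cmod (hinner d f g))\<^sup>2 / hsq d g"
    unfolding hsq_best_hscale[OF f g False, symmetric] using f g by (intro hsq_nonneg) simp
  hence "(cmod (hinner d f g))\<^sup>2 \<le> hsq d f * hsq d g" using pos by (simp add: pos_divide_le_eq)
  hence "(cmod (hinner d f g))\<^sup>2 \<le> (hnorm d f * hnorm d g)\<^sup>2"
    using f g by (simp add: power_mult_distrib hnorm_sq)
  thus ?thesis by (rule power2_le_imp_le) (simp add: f g hnorm_nonneg)
qed

lemma hnorm_triangle:
  assumes f: "f \<in> hardy d" and g: "g \<in> hardy d"
  shows "hnorm d (hadd f g) \<le> hnorm d f + hnorm d g"
proof -
  have e: "hadd f g = hminus f (hscale (-1) g)"
    using f g by (intro hardy_eqI[of _ d]) (auto simp: hardy_index)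
  have "(hnorm d (hadd f g))\<^sup>2 = hsq d f + 2 * Re (hinner d f g) + hsq d g"
    using hsq_hminus_hscale[OF f g, of "-1"] f g by (simp add: hnorm_sq e[symmetric])
  also have "\<dots> \<le> (hnorm d f)\<^sup>2 + 2 * (hnorm d f * hnorm d g) + (hnorm d g)\<^sup>2"
    using hCauchy_Schwarz[OF f g] complex_Re_le_cmod[of "hinner d f g"] by (simp add: hnorm_sq f g)
  also have "\<dots> = (hnorm d f + hnorm d g)\<^sup>2" by (simp add: power2_sum)
  finally show ?thesis by (rule power2_le_imp_le) (simp add: hnorm_nonneg f g)
qed

lemma hsq_parallelogram:
  assumes f: "f \<in> hardy d" and g: "g \<in> hardy d"
  shows "hsq d (hadd f g) + hsq d (hminus f g) = 2 * hsq d f + 2 * hsq d g"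
proof -
  have e: "hadd f g = hminus f (hscale (-1) g)" "hminus f g = hminus f (hscale 1 g)"
    using f g by (auto intro!: hardy_eqI[of _ d] simp: hardy_index)
  show ?thesis unfolding e by (simp add: hsq_hminus_hscale f g)
qed

lemma hsq_hscale: "f \<in> hardy d \<Longrightarrow> hsq d (hscale c f) = (cmod c)\<^sup>2 * hsq d f"
  by (simp add: hsq_def hcoeff_hscale norm_mult power_mult_distrib suminf_mult hardy_summable sum_distrib_left)

lemma hnorm_hscale: "f \<in> hardy d \<Longrightarrow> hnorm d (hscale c f) = cmod c * hnorm d f"
  by (simp add: hnorm_hsq hsq_hscale real_sqrt_mult)

lemma hnorm_hminus_commute:
  assumes "f \<in> hardy d" "g \<in> hardy d"
  shows "hnorm d (hminus f g) = hnorm d (hminus g f)"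
proof -
  have "hminus f g = hscale (-1) (hminus g f)"
    using assms by (intro hardy_eqI[of _ d]) (auto simp: hardy_index)
  thus ?thesis using assms by (simp add: hnorm_hscale)
qed

lemma hnorm_hminus_triangle:
  assumes "f \<in> hardy d" "g \<in> hardy d" "k \<in> hardy d"
  shows "hnorm d (hminus f k) \<le> hnorm d (hminus f g) + hnorm d (hminus g k)"
proof -
  have "hminus f k = hadd (hminus f g) (hminus g k)"
    using assms by (intro hardy_eqI[of _ d]) (auto simp: hardy_index)
  thus ?thesis using hnorm_triangle[of "hminus f g" d "hminus g k"] assms by simp
qed

section \<open>Completeness of the Hardy space\<close>

definition hCauchy :: "nat \<Rightarrow> (nat \<Rightarrow> complex \<Rightarrow> complex vec) \<Rightarrow> bool" where
  "hCauchy d X \<longleftrightarrow> (\<forall>e>0. \<exists>N. \<forall>m\<ge>N. \<forall>n\<ge>N. hnorm d (hminus (X m) (X n)) < e)"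

text \<open>
  Convergence is written through the norm because the ambient function type carries no topology
  related to the Hardy space.
\<close>

definition hlim :: "nat \<Rightarrow> (nat \<Rightarrow> complex \<Rightarrow> complex vec) \<Rightarrow> (complex \<Rightarrow> complex vec) \<Rightarrow> bool" where
  "hlim d X x \<longleftrightarrow> (\<lambda>n. hnorm d (hminus (X n) x)) \<longlonglongrightarrow> 0"

lemma hcoeff_hminus:
  "f \<in> hardy d \<Longrightarrow> g \<in> hardy d \<Longrightarrow> i < d \<Longrightarrow> hcoeff (hminus f g) i n = hcoeff f i n - hcoeff g i n"
  by (simp add: hminus_eq hcoeff_hadd hcoeff_hscale)

text \<open>
  The coefficients of a Cauchy sequence converge, and the bounds for the finite partial sums of
  \<open>\<parallel>X m - X k\<parallel>\<^sup>2\<close> survive the limit \<open>k \<rightarrow> \<infinity>\<close>; they show both that the limit coefficients are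
  square summable and that the convergence is in norm.
\<close>

lemma hardy_complete:
  assumes X: "\<And>n. X n \<in> hardy d" and C: "hCauchy d X"
  obtains x where "x \<in> hardy d" "hlim d X x"
proof -
  define c where "c = (\<lambda>i n. lim (\<lambda>k. hcoeff (X k) i n))"
  have lim: "(\<lambda>k. hcoeff (X k) i n) \<longlonglongrightarrow> c i n" if i: "i < d" for i n
  proof -
    have "Cauchy (\<lambda>k. hcoeff (X k) i n)"
    proof (rule metric_CauchyI)
      fix e :: real assume "e > 0"
      then obtain N where N: "\<And>m k. m \<ge> N \<Longrightarrow> k \<ge> N \<Longrightarrow> hnorm d (hminus (X m) (X k)) < e"
        using C unfolding hCauchy_def by blast
      have "dist (hcoeff (X m) i n) (hcoeff (X k) i n) < e" if "m \<ge> N" "k \<ge> N" for m k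
        using le_less_trans[OF norm_hcoeff_le[OF hminus_hardy[OF X X] i] N[OF that], of n]
        by (simp add: dist_norm hcoeff_hminus[OF X X i])
      thus "\<exists>N. \<forall>m\<ge>N. \<forall>k\<ge>N. dist (hcoeff (X m) i n) (hcoeff (X k) i n) < e" by blast
    qed
    thus ?thesis unfolding c_def by (intro convergent_LIMSEQ_iff[THEN iffD1] Cauchy_convergent)
  qed
  have est: "(\<Sum>i<d. \<Sum>n<M. (cmod (hcoeff (X m) i n - c i n))\<^sup>2) \<le> e\<^sup>2"
    if e: "e > 0" and N: "\<forall>m\<ge>N. \<forall>k\<ge>N. hnorm d (hminus (X m) (X k)) < e" and m: "m \<ge> N" for e N m M
  proof (rule tendsto_upperbound)
    show "(\<lambda>k. \<Sum>i<d. \<Sum>n<M. (cmod (hcoeff (X m) i n - hcoeff (X k) i n))\<^sup>2)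
        \<longlonglongrightarrow> (\<Sum>i<d. \<Sum>n<M. (cmod (hcoeff (X m) i n - c i n))\<^sup>2)"
      by (intro tendsto_intros lim) auto
    have "(\<Sum>i<d. \<Sum>n<M. (cmod (hcoeff (X m) i n - hcoeff (X k) i n))\<^sup>2) \<le> e\<^sup>2" if "k \<ge> N" for k
    proof -
      have h: "hminus (X m) (X k) \<in> hardy d" using X by simp
      have "(\<Sum>i<d. \<Sum>n<M. (cmod (hcoeff (X m) i n - hcoeff (X k) i n))\<^sup>2) \<le> hsq d (hminus (X m) (X k))"
        unfolding hsq_def
        by (intro sum_mono)
           (use h in \<open>auto simp: hcoeff_hminus[OF X X, symmetric] intro!: sum_le_suminf hardy_summable\<close>)
      also have "\<dots> \<le> e\<^sup>2"
        unfolding hnorm_sq[OF h, symmetric] using N m that hnorm_nonneg[OF h] by (intro power_mono) (auto intro: less_imp_le)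
      finally show ?thesis .
    qed
    thus "\<forall>\<^sub>F k in sequentially. (\<Sum>i<d. \<Sum>n<M. (cmod (hcoeff (X m) i n - hcoeff (X k) i n))\<^sup>2) \<le> e\<^sup>2"
      unfolding eventually_sequentially by blast
  qed simp
  have smd: "summable (\<lambda>n. (cmod (hcoeff (X m) i n - c i n))\<^sup>2)"
    if "\<forall>m\<ge>N. \<forall>k\<ge>N. hnorm d (hminus (X m) (X k)) < e" "e > 0" "m \<ge> N" "i < d" for e N m i
  proof (rule summableI_nonneg_bounded[where x = "e\<^sup>2"])
    fix M
    have "(\<Sum>n<M. (cmod (hcoeff (X m) i n - c i n))\<^sup>2) \<le> (\<Sum>i<d. \<Sum>n<M. (cmod (hcoeff (X m) i n - c i n))\<^sup>2)"
      using \<open>i < d\<close> by (intro member_le_sum sum_nonneg) auto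
    also have "\<dots> \<le> e\<^sup>2" using that by (intro est) auto
    finally show "(\<Sum>n<M. (cmod (hcoeff (X m) i n - c i n))\<^sup>2) \<le> e\<^sup>2" .
  qed simp
  have cs: "summable (\<lambda>n. (cmod (c i n))\<^sup>2)" if i: "i < d" for i
  proof -
    obtain N where N: "\<forall>m\<ge>N. \<forall>k\<ge>N. hnorm d (hminus (X m) (X k)) < 1"
      using C[unfolded hCauchy_def, rule_format, of 1] by auto
    have "summable (\<lambda>n. (cmod (hcoeff (X N) i n - c i n))\<^sup>2)"
      by (rule smd[of N 1]) (use N i in auto)
    hence "summable (\<lambda>n. (cmod (c i n - hcoeff (X N) i n + hcoeff (X N) i n))\<^sup>2)"
      using hardy_summable[OF X i]
      by (intro summable_sq_add) (simp_all add: norm_minus_commute)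
    thus ?thesis by simp
  qed
  define x where "x = of_hcoeff d c"
  have x: "x \<in> hardy d" and xc: "\<And>i n. i < d \<Longrightarrow> hcoeff x i n = c i n"
    unfolding x_def using of_hcoeff[of d c] cs by auto
  have "hlim d X x" unfolding hlim_def
  proof (rule LIMSEQ_I)
    fix e :: real assume "e > 0"
    hence e2: "e / 2 > 0" by simp
    then obtain N where N: "\<forall>m\<ge>N. \<forall>k\<ge>N. hnorm d (hminus (X m) (X k)) < e / 2"
      using C unfolding hCauchy_def by blast
    have "hnorm d (hminus (X m) x) \<le> e / 2" if m: "m \<ge> N" for m
    proof -
      have h: "hminus (X m) x \<in> hardy d" using X x by simp
      have eqs: "(\<Sum>n. (cmod (hcoeff (hminus (X m) x) i n))\<^sup>2) = (\<Sum>n. (cmod (hcoeff (X m) i n - c i n))\<^sup>2)" if "i < d" for i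
        using that by (simp add: hcoeff_hminus[OF X x] xc)
      have "(\<lambda>M. \<Sum>i<d. \<Sum>n<M. (cmod (hcoeff (X m) i n - c i n))\<^sup>2) \<longlonglongrightarrow>
          (\<Sum>i<d. \<Sum>n. (cmod (hcoeff (X m) i n - c i n))\<^sup>2)"
        by (intro tendsto_sum summable_LIMSEQ smd[OF N e2 m]) auto
      hence "(\<Sum>i<d. \<Sum>n. (cmod (hcoeff (X m) i n - c i n))\<^sup>2) \<le> (e / 2)\<^sup>2"
        by (rule tendsto_upperbound) (use est[OF e2 N m] in auto)
      hence "(hnorm d (hminus (X m) x))\<^sup>2 \<le> (e / 2)\<^sup>2"
        by (simp add: hnorm_sq[OF h] hsq_def eqs)
      thus ?thesis by (rule power2_le_imp_le) (use e2 in simp)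
    qed
    moreover have "0 \<le> hnorm d (hminus (X m) x)" for m using X x by (intro hnorm_nonneg) simp
    ultimately show "\<exists>N. \<forall>m\<ge>N. norm (hnorm d (hminus (X m) x) - 0) < e"
      using \<open>e > 0\<close> by (intro exI[of _ N]) (auto intro: le_less_trans[of _ "e / 2"])
  qed
  thus ?thesis using that x by blast
qed

section \<open>Orthogonal projections\<close>

text \<open>
  Closedness is expressed as completeness, so that the same notion serves for the range of an
  isometry defined on a complete space.
\<close>

definition closed_subspace :: "nat \<Rightarrow> (complex \<Rightarrow> complex vec) set \<Rightarrow> bool" where
  "closed_subspace d K \<longleftrightarrow> K \<subseteq> hardy d \<and> hzero d \<in> K \<and>
     (\<forall>f\<in>K. \<forall>g\<in>K. hadd f g \<in> K) \<and> (\<forall>c. \<forall>f\<in>K. hscale c f \<in> K) \<and>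
     (\<forall>X. (\<forall>n. X n \<in> K) \<and> hCauchy d X \<longrightarrow> (\<exists>x\<in>K. hlim d X x))"

lemma closed_subspace_hminus:
  "closed_subspace d K \<Longrightarrow> f \<in> K \<Longrightarrow> g \<in> K \<Longrightarrow> hminus f g \<in> K"
  unfolding closed_subspace_def by (metis hminus_eq subsetD)

lemma closed_subspaceD:
  assumes "closed_subspace d K"
  shows "f \<in> K \<Longrightarrow> f \<in> hardy d" "hzero d \<in> K" "f \<in> K \<Longrightarrow> g \<in> K \<Longrightarrow> hadd f g \<in> K"
    "f \<in> K \<Longrightarrow> hscale c f \<in> K" "f \<in> K \<Longrightarrow> g \<in> K \<Longrightarrow> hminus f g \<in> K"
  using assms closed_subspace_hminus[OF assms] unfolding closed_subspace_def by auto

text \<open>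
  A minimizing sequence is Cauchy by the parallelogram identity, since midpoints of its members lie
  in \<open>K\<close> as well.
\<close>

lemma hardy_closest_point_exists:
  assumes K: "closed_subspace d K" and f: "f \<in> hardy d"
  obtains g where "g \<in> K" "\<And>k. k \<in> K \<Longrightarrow> hsq d (hminus f g) \<le> hsq d (hminus f k)"
proof -
  note Kh = closed_subspaceD(1)[OF K]
  define D where "D = (\<lambda>k. hsq d (hminus f k))"
  have D0: "D k \<ge> 0" if "k \<in> K" for k unfolding D_def using f Kh[OF that] by (intro hsq_nonneg) simp
  define \<delta> where "\<delta> = Inf (D ` K)"
  have bdd: "bdd_below (D ` K)" using D0 by (intro bdd_belowI[of _ 0]) auto
  have \<delta>: "\<delta> \<le> D k" if "k \<in> K" for k unfolding \<delta>_def using bdd that by (intro cInf_lower) auto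
  have "\<exists>k\<in>K. D k < \<delta> + 1 / real (Suc n)" for n
    using cInf_lessD[of "D ` K" "\<delta> + 1 / real (Suc n)"] closed_subspaceD(2)[OF K] by (auto simp: \<delta>_def)
  then obtain X where X: "\<And>n. X n \<in> K" "\<And>n. D (X n) < \<delta> + 1 / real (Suc n)" by metis
  have Xh: "X n \<in> hardy d" for n using Kh X by blast
  have par: "hsq d (hminus (X m) (X n)) \<le> 2 / real (Suc m) + 2 / real (Suc n)" for m n
  proof -
    define a where "a = hminus f (X m)"
    define b where "b = hminus f (X n)"
    have ab: "a \<in> hardy d" "b \<in> hardy d" using f Xh by (auto simp: a_def b_def)
    \<comment> \<open>the midpoint, whose distance from \<open>f\<close> is at least the infimum\<close>
    define k where "k = hscale (1/2) (hadd (X m) (X n))"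
    have k: "k \<in> K" unfolding k_def by (intro closed_subspaceD[OF K] X)
    have "hadd a b = hscale 2 (hminus f k)"
      using f Xh[of m] Xh[of n] ab Kh[OF k] unfolding a_def b_def k_def
      by (intro hardy_eqI[of _ d]) (auto simp: hardy_index algebra_simps)
    hence "hsq d (hadd a b) = 4 * D k" using f Kh[OF k] by (simp add: hsq_hscale D_def)
    hence "hsq d (hadd a b) \<ge> 4 * \<delta>" using \<delta>[OF k] by simp
    moreover have hm: "hminus a b = hminus (X n) (X m)"
      using f Xh[of m] Xh[of n] ab unfolding a_def b_def by (intro hardy_eqI[of _ d]) (auto simp: hardy_index)
    moreover have "hsq d (hminus a b) = hsq d (hminus (X m) (X n))"
      unfolding hm using hnorm_hminus_commute[OF Xh Xh, of n m] Xh by (simp add: hnorm_hsq)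
    moreover have "hsq d a < \<delta> + 1 / real (Suc m)" "hsq d b < \<delta> + 1 / real (Suc n)"
      using X(2) by (simp_all only: a_def b_def D_def)
    moreover have "2 / real (Suc m) = 2 * (1 / real (Suc m))" "2 / real (Suc n) = 2 * (1 / real (Suc n))"
      by simp_all
    ultimately show ?thesis using hsq_parallelogram[OF ab] by linarith
  qed
  have "hCauchy d X" unfolding hCauchy_def
  proof (intro allI impI)
    fix e :: real assume e: "e > 0"
    obtain N where N: "4 / e\<^sup>2 < real N" using reals_Archimedean2 by blast
    have "hnorm d (hminus (X m) (X n)) < e" if "m \<ge> N" "n \<ge> N" for m n
    proof -
      have pos: "0 < 4 / e\<^sup>2" using e by simp
      have b: "2 / real (Suc k) < e\<^sup>2 / 2" if "k \<ge> N" for k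
      proof -
        have "4 / e\<^sup>2 < real (Suc k)" using N that by simp
        hence "4 < real (Suc k) * e\<^sup>2" using e by (simp add: pos_divide_less_eq)
        thus ?thesis by (simp add: field_simps)
      qed
      have h: "hminus (X m) (X n) \<in> hardy d" using Xh by simp
      have "(hnorm d (hminus (X m) (X n)))\<^sup>2 < e\<^sup>2"
        using par[of m n] b[OF that(1)] b[OF that(2)] by (simp add: hnorm_sq[OF h])
      thus ?thesis using e by (simp add: power_less_imp_less_base)
    qed
    thus "\<exists>N. \<forall>m\<ge>N. \<forall>n\<ge>N. hnorm d (hminus (X m) (X n)) < e" by blast
  qed
  then obtain g where g: "g \<in> K" "hlim d X g" using K X(1) unfolding closed_subspace_def by blast
  have gh: "g \<in> hardy d" using Kh g by blast
  have "hnorm d (hminus f g) \<le> sqrt \<delta>"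
  proof (rule LIMSEQ_le_const[where X = "\<lambda>n. sqrt (\<delta> + 1 / real (Suc n)) + hnorm d (hminus (X n) g)"])
    have "(\<lambda>n. sqrt (\<delta> + 1 / real (Suc n)) + hnorm d (hminus (X n) g)) \<longlonglongrightarrow> sqrt (\<delta> + 0) + 0"
      using g(2) unfolding hlim_def
      by (intro tendsto_add tendsto_real_sqrt tendsto_const LIMSEQ_inverse_real_of_nat[unfolded inverse_eq_divide])
    thus "(\<lambda>n. sqrt (\<delta> + 1 / real (Suc n)) + hnorm d (hminus (X n) g)) \<longlonglongrightarrow> sqrt \<delta>" by simp
    have "hnorm d (hminus f g) \<le> sqrt (\<delta> + 1 / real (Suc n)) + hnorm d (hminus (X n) g)" for n
    proof -
      have "hnorm d (hminus f (X n)) \<le> sqrt (\<delta> + 1 / real (Suc n))"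
        using X(2)[of n] f Xh[of n] by (simp add: hnorm_hsq D_def)
      thus ?thesis using hnorm_hminus_triangle[OF f Xh gh, of n] by simp
    qed
    thus "\<exists>N. \<forall>n\<ge>N. hnorm d (hminus f g) \<le> sqrt (\<delta> + 1 / real (Suc n)) + hnorm d (hminus (X n) g)" by blast
  qed
  hence "hsq d (hminus f g) \<le> \<delta>" using f gh by (simp add: hnorm_hsq)
  hence "hsq d (hminus f g) \<le> hsq d (hminus f k)" if "k \<in> K" for k using \<delta>[OF that] by (simp add: D_def)
  thus ?thesis using that g(1) by blast
qed

text \<open>
  If the difference \<open>r\<close> of \<open>f\<close> and its closest point were not orthogonal to \<open>k\<close>, moving the
  closest point along \<open>k\<close> would decrease the distance.
\<close>

lemma hardy_projection_exists:
  assumes K: "closed_subspace d K" and f: "f \<in> hardy d"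
  obtains g where "g \<in> K" "\<And>k. k \<in> K \<Longrightarrow> hinner d (hminus f g) k = 0"
proof -
  note Kh = closed_subspaceD(1)[OF K]
  obtain g where g: "g \<in> K" and min: "\<And>k. k \<in> K \<Longrightarrow> hsq d (hminus f g) \<le> hsq d (hminus f k)"
    by (rule hardy_closest_point_exists[OF K f]) blast
  define r where "r = hminus f g"
  have r: "r \<in> hardy d" using f Kh[OF g] by (simp add: r_def)
  have "hinner d r k = 0" if k: "k \<in> K" for k
  proof (cases "hsq d k = 0")
    case True
    hence "k = hzero d" by (rule hsq_eq_0[OF Kh[OF k]])
    thus ?thesis by (simp add: hinner_hzero_right)
  next
    case False
    hence pos: "hsq d k > 0" using hsq_nonneg[OF Kh[OF k]] by simp
    define t where "t = hinner d r k / of_real (hsq d k)"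
    have "hminus r (hscale t k) = hminus f (hadd g (hscale t k))"
      unfolding r_def using f Kh[OF g] Kh[OF k] by (intro hardy_eqI[of _ d]) (auto simp: hardy_index)
    moreover have "hadd g (hscale t k) \<in> K" by (intro closed_subspaceD[OF K] g k)
    ultimately have "hsq d r \<le> hsq d (hminus r (hscale t k))" using min by (simp add: r_def)
    hence "(cmod (hinner d r k))\<^sup>2 / hsq d k \<le> 0"
      using hsq_best_hscale[OF r Kh[OF k] False] by (simp add: t_def)
    hence "(cmod (hinner d r k))\<^sup>2 \<le> 0" using pos by (simp add: divide_le_0_iff)
    thus ?thesis by simp
  qed
  thus ?thesis using that g by (simp add: r_def)
qed

lemma hproj_unique:
  assumes K: "closed_subspace d K" and f: "f \<in> hardy d"
    and g: "g \<in> K" "\<And>k. k \<in> K \<Longrightarrow> hinner d (hminus f g) k = 0"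
  shows "hproj d K f = g"
  unfolding hproj_def
proof (rule the_equality)
  show "g \<in> K \<and> (\<forall>k\<in>K. hinner d (hminus f g) k = 0)" using g by blast
  fix g' assume g': "g' \<in> K \<and> (\<forall>k\<in>K. hinner d (hminus f g') k = 0)"
  note Kh = closed_subspaceD(1)[OF K]
  have h: "hminus g g' \<in> K" using closed_subspaceD(5)[OF K] g g' by blast
  have "hinner d (hminus f g') (hminus g g') - hinner d (hminus f g) (hminus g g') = 0" using h g g' by simp
  hence "hinner d (hminus g g') (hminus g g') = 0"
    using f g g' Kh by (simp add: hinner_hminus_left)
  hence "hsq d (hminus g g') = 0" using hinner_self[OF Kh[OF h]] by simp
  hence "hminus g g' = hzero d" by (rule hsq_eq_0[OF Kh[OF h]])
  hence "g = g'" using Kh g g' by (intro hminus_eq_hzeroD[of g d g']) auto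
  thus "g' = g" ..
qed

text \<open>
  The description operator in \<open>hproj\<close> denotes a vector by existence and uniqueness; from here on
  only these two properties are used.
\<close>

lemma hproj:
  assumes K: "closed_subspace d K" and f: "f \<in> hardy d"
  shows "hproj d K f \<in> K" "\<And>k. k \<in> K \<Longrightarrow> hinner d (hproj d K f) k = hinner d f k"
proof -
  obtain g where g: "g \<in> K" "\<And>k. k \<in> K \<Longrightarrow> hinner d (hminus f g) k = 0"
    by (rule hardy_projection_exists[OF K f]) blast
  have e: "hproj d K f = g" by (rule hproj_unique[OF K f g])
  show "hproj d K f \<in> K" using e g by simp
  show "hinner d (hproj d K f) k = hinner d f k" if "k \<in> K" for k
    using g(2)[OF that] f closed_subspaceD(1)[OF K] g(1) that by (simp add: e hinner_hminus_left)
qed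

section \<open>The Riesz representation theorem\<close>

lemma hlim_functional:
  assumes \<phi>: "\<And>u v. u \<in> hardy d \<Longrightarrow> v \<in> hardy d \<Longrightarrow> \<phi> (hminus u v) = \<phi> u - \<phi> v"
    and b: "\<And>u. u \<in> hardy d \<Longrightarrow> cmod (\<phi> u) \<le> C * hnorm d u"
    and X: "\<And>n. X n \<in> hardy d" and x: "x \<in> hardy d" and l: "hlim d X x"
  shows "(\<lambda>n. \<phi> (X n)) \<longlonglongrightarrow> \<phi> x"
proof (rule LIM_zero_cancel, rule Lim_null_comparison)
  show "\<forall>\<^sub>F n in sequentially. norm (\<phi> (X n) - \<phi> x) \<le> C * hnorm d (hminus (X n) x)"
    using b[OF hminus_hardy[OF X x]] by (intro always_eventually) (simp add: \<phi>[OF X x])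
  show "(\<lambda>n. C * hnorm d (hminus (X n) x)) \<longlonglongrightarrow> 0"
    using l unfolding hlim_def by (rule tendsto_mult_right_zero)
qed

text \<open>
  The representing vector is a multiple of a vector \<open>e\<close> orthogonal to the kernel of \<open>\<phi>\<close>.
\<close>

lemma hardy_Riesz:
  assumes add: "\<And>u v. u \<in> hardy d \<Longrightarrow> v \<in> hardy d \<Longrightarrow> \<phi> (hadd u v) = \<phi> u + \<phi> v"
    and scale: "\<And>c u. u \<in> hardy d \<Longrightarrow> \<phi> (hscale c u) = c * \<phi> u"
    and b: "\<And>u. u \<in> hardy d \<Longrightarrow> cmod (\<phi> u) \<le> C * hnorm d u"
  obtains x where "x \<in> hardy d" "\<And>u. u \<in> hardy d \<Longrightarrow> \<phi> u = hinner d u x"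
proof (cases "\<forall>u\<in>hardy d. \<phi> u = 0")
  case True
  thus ?thesis using that[of "hzero d"] by (simp add: hinner_hzero_right)
next
  case False
  then obtain f where f: "f \<in> hardy d" "\<phi> f \<noteq> 0" by blast
  define K where "K = {u \<in> hardy d. \<phi> u = 0}"
  have minus: "\<phi> (hminus u v) = \<phi> u - \<phi> v" if "u \<in> hardy d" "v \<in> hardy d" for u v
    using that by (simp add: hminus_eq add scale)
  have K: "closed_subspace d K" unfolding closed_subspace_def
  proof (intro conjI allI ballI impI)
    have "\<phi> (hscale 0 (hzero d)) = 0" by (simp add: scale)
    moreover have "hscale 0 (hzero d) = hzero d" by (intro hardy_eqI[of _ d]) (auto simp: hardy_index)
    ultimately show "hzero d \<in> K" by (simp add: K_def)
    fix X assume X: "(\<forall>n. X n \<in> K) \<and> hCauchy d X"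
    hence Xh: "X n \<in> hardy d" "\<phi> (X n) = 0" for n by (auto simp: K_def)
    obtain x where x: "x \<in> hardy d" "hlim d X x" by (rule hardy_complete[of X]) (use Xh X in auto)
    have "(\<lambda>n. \<phi> (X n)) \<longlonglongrightarrow> \<phi> x" by (rule hlim_functional[OF minus b Xh(1) x])
    hence "0 = \<phi> x" by (simp only: Xh(2) LIMSEQ_const_iff)
    hence "\<phi> x = 0" ..
    thus "\<exists>x\<in>K. hlim d X x" using x by (auto simp: K_def)
  qed (auto simp: K_def add scale)
  obtain g where g: "g \<in> K" "\<And>k. k \<in> K \<Longrightarrow> hinner d (hminus f g) k = 0"
    by (rule hardy_projection_exists[OF K f(1)]) blast
  define e where "e = hminus f g"
  have gh: "g \<in> hardy d" "\<phi> g = 0" using g(1) by (auto simp: K_def)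
  have e: "e \<in> hardy d" using f gh by (simp add: e_def)
  have \<phi>e: "\<phi> e \<noteq> 0" using f gh by (simp add: e_def minus)
  have "hsq d e \<noteq> 0"
  proof
    assume "hsq d e = 0"
    hence "hnorm d e = 0" by (simp add: hnorm_hsq e)
    thus False using b[OF e] \<phi>e by simp
  qed
  define x where "x = hscale (cnj (\<phi> e) / of_real (hsq d e)) e"
  have "\<phi> u = hinner d u x" if u: "u \<in> hardy d" for u
  proof -
    define k where "k = hminus u (hscale (\<phi> u / \<phi> e) e)"
    have "k \<in> K" using u e \<phi>e by (simp add: k_def K_def minus scale)
    hence "hinner d e k = 0" using g(2) by (simp add: e_def)
    hence "hinner d k e = 0" using hinner_commute[of k d e] \<open>k \<in> K\<close> e by (simp add: K_def)
    moreover have "hinner d k e = hinner d u e - \<phi> u / \<phi> e * of_real (hsq d e)"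
      unfolding k_def hinner_hminus_left[OF u hscale_hardy[OF e] e] hinner_hscale_left[OF e e] hinner_self[OF e] ..
    ultimately have ue: "hinner d u e = \<phi> u / \<phi> e * of_real (hsq d e)" by simp
    have "hinner d u x = \<phi> e / of_real (hsq d e) * hinner d u e"
      unfolding x_def hinner_hscale_right[OF e u] by simp
    also have "\<dots> = \<phi> u" unfolding ue using \<phi>e \<open>hsq d e \<noteq> 0\<close> by simp
    finally show ?thesis ..
  qed
  moreover have "x \<in> hardy d" using e by (simp add: x_def)
  ultimately show ?thesis using that by blast
qed

section \<open>Multiplication operators and their adjoints\<close>

lemma taylor_coeff_sum:
  assumes "\<And>j. j \<in> S \<Longrightarrow> f j holomorphic_on \<D>"
  shows "taylor_coeff (\<lambda>z. \<Sum>j\<in>S. f j z) n = (\<Sum>j\<in>S. taylor_coeff (f j) n)"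
  using assms
proof (induction S rule: infinite_finite_induct)
  case (insert x F)
  have "taylor_coeff (\<lambda>z. f x z + (\<Sum>j\<in>F. f j z)) n = taylor_coeff (f x) n + taylor_coeff (\<lambda>z. \<Sum>j\<in>F. f j z) n"
    using insert.prems by (intro taylor_coeff_add holomorphic_on_sum) auto
  thus ?case using insert by simp
qed (simp_all add: taylor_coeff_const)

lemma Hinf_mat_carrier: "\<Phi> \<in> Hinf_mat d \<Longrightarrow> z \<in> \<D> \<Longrightarrow> \<Phi> z \<in> carrier_mat d d"
  by (simp add: Hinf_mat_def)

lemma Hinf_mat_bound:
  assumes "\<Phi> \<in> Hinf_mat d"
  obtains B where "0 < B" "\<And>i j. i < d \<Longrightarrow> j < d \<Longrightarrow> (\<lambda>z. \<Phi> z $$ (i, j)) \<in> Hinf B"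
proof -
  define U where "U = (\<Union>i<d. \<Union>j<d. (\<lambda>z. \<Phi> z $$ (i, j)) ` \<D>)"
  have "bounded U"
    unfolding U_def using assms by (intro bounded_UN ballI finite_lessThan) (auto simp: Hinf_mat_def)
  then obtain B where B: "0 < B" "\<forall>x\<in>U. norm x \<le> B"
    using bounded_pos by blast
  have "(\<lambda>z. \<Phi> z $$ (i, j)) \<in> Hinf B" if "i < d" "j < d" for i j
  proof (rule HinfI)
    show "norm (\<Phi> z $$ (i, j)) \<le> B" if "z \<in> \<D>" for z
      using B(2) \<open>i < d\<close> \<open>j < d\<close> that unfolding U_def by blast
  qed (use assms that in \<open>auto simp: Hinf_mat_def\<close>)
  thus ?thesis using that B(1) by blast
qed

lemma mult_op_entry:
  assumes "\<Phi> \<in> Hinf_mat d" "f \<in> hardy d" "z \<in> \<D>" "i < d"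
  shows "mult_op d \<Phi> f z $ i = (\<Sum>j<d. \<Phi> z $$ (i, j) * f z $ j)"
  using mat_vec_entry[OF Hinf_mat_carrier[OF assms(1,3)] hardy_carrier[OF assms(2)] assms(4)] assms(3)
  by (simp add: mult_op_def)

lemma norm_sum_sq_le:
  fixes t :: "nat \<Rightarrow> complex"
  shows "(cmod (\<Sum>j<d. t j))\<^sup>2 \<le> real d * (\<Sum>j<d. (cmod (t j))\<^sup>2)"
proof -
  have "(cmod (\<Sum>j<d. t j))\<^sup>2 \<le> (\<Sum>j<d. 1 * cmod (t j))\<^sup>2"
    using norm_sum[of t "{..<d}"] by (intro power_mono) simp_all
  also have "\<dots> \<le> (\<Sum>j<d. 1\<^sup>2) * (\<Sum>j<d. (cmod (t j))\<^sup>2)" by (rule Cauchy_Schwarz_ineq_sum)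
  finally show ?thesis by simp
qed

text \<open>
  Entrywise, by the multiplier estimate for scalar functions. The crude constant \<open>d B\<close> suffices:
  boundedness is only needed for adjoints to exist.
\<close>

lemma mult_op_bounded:
  assumes \<Phi>: "\<Phi> \<in> Hinf_mat d"
  shows mult_op_hardy: "f \<in> hardy d \<Longrightarrow> mult_op d \<Phi> f \<in> hardy d"
    and mult_op_norm: "\<exists>C\<ge>0. \<forall>f\<in>hardy d. hnorm d (mult_op d \<Phi> f) \<le> C * hnorm d f"
proof -
  obtain B where B: "0 < B" "\<And>i j. i < d \<Longrightarrow> j < d \<Longrightarrow> (\<lambda>z. \<Phi> z $$ (i, j)) \<in> Hinf B"
    by (rule Hinf_mat_bound[OF \<Phi>]) blast
  have main: "mult_op d \<Phi> f \<in> hardy d \<and> hsq d (mult_op d \<Phi> f) \<le> (real d * B)\<^sup>2 * hsq d f"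
    if f: "f \<in> hardy d" for f
  proof -
    define t where "t = (\<lambda>i j n. taylor_coeff (\<lambda>z. \<Phi> z $$ (i, j) * f z $ j) n)"
    define s where "s = (\<lambda>j. \<Sum>n. (cmod (hcoeff f j n))\<^sup>2)"
    have hol: "(\<lambda>z. \<Phi> z $$ (i, j) * f z $ j) holomorphic_on \<D>" if "i < d" "j < d" for i j
      using Hinf_holo[OF B(2)[OF that]] hardy_holo[OF f that(2)] by (intro holomorphic_intros)
    have ts: "summable (\<lambda>n. (cmod (t i j n))\<^sup>2)" "(\<Sum>n. (cmod (t i j n))\<^sup>2) \<le> B\<^sup>2 * s j"
      if "i < d" "j < d" for i j
      using Hinf_mult_l2[OF B(2)[OF that] hardy_holo[OF f that(2)]] hardy_summable[OF f that(2)]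
      by (simp_all add: t_def s_def hcoeff_def)
    have holM: "(\<lambda>z. mult_op d \<Phi> f z $ i) holomorphic_on \<D>" if i: "i < d" for i
    proof -
      have "(\<lambda>z. \<Sum>j<d. \<Phi> z $$ (i, j) * f z $ j) holomorphic_on \<D>"
        using hol[OF i] by (intro holomorphic_on_sum) auto
      thus ?thesis by (subst holomorphic_cong[OF refl]) (auto simp: mult_op_entry[OF \<Phi> f _ i])
    qed
    have co: "hcoeff (mult_op d \<Phi> f) i n = (\<Sum>j<d. t i j n)" if i: "i < d" for i n
    proof -
      have "hcoeff (mult_op d \<Phi> f) i n = taylor_coeff (\<lambda>z. \<Sum>j<d. \<Phi> z $$ (i, j) * f z $ j) n"
        unfolding hcoeff_def by (rule taylor_coeff_cong[OF holM[OF i]]) (rule mult_op_entry[OF \<Phi> f _ i])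
      also have "\<dots> = (\<Sum>j<d. t i j n)"
        unfolding t_def using hol[OF i] by (intro taylor_coeff_sum) auto
      finally show ?thesis .
    qed
    have le: "(cmod (hcoeff (mult_op d \<Phi> f) i n))\<^sup>2 \<le> real d * (\<Sum>j<d. (cmod (t i j n))\<^sup>2)" if "i < d" for i n
      unfolding co[OF that] by (rule norm_sum_sq_le)
    have sm: "summable (\<lambda>n. real d * (\<Sum>j<d. (cmod (t i j n))\<^sup>2))" if "i < d" for i
      using ts(1)[OF that] by (intro summable_mult summable_sum) auto
    have sm': "summable (\<lambda>n. (cmod (hcoeff (mult_op d \<Phi> f) i n))\<^sup>2)" if "i < d" for i
      by (rule summable_comparison_test'[OF sm[OF that], of 0]) (use le[OF that] in simp)
    have mem: "mult_op d \<Phi> f \<in> hardy d"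
    proof (rule hardyI)
      show "mult_op d \<Phi> f z \<in> carrier_vec d" for z
        using Hinf_mat_carrier[OF \<Phi>, of z] hardy_carrier[OF f, of z]
        by (auto simp: mult_op_def intro: mult_mat_vec_carrier)
    qed (use holM sm' in \<open>auto simp: mult_op_def\<close>)
    have "(\<Sum>n. (cmod (hcoeff (mult_op d \<Phi> f) i n))\<^sup>2) \<le> real d * (B\<^sup>2 * hsq d f)" if i: "i < d" for i
    proof -
      have "(\<Sum>n. (cmod (hcoeff (mult_op d \<Phi> f) i n))\<^sup>2) \<le> (\<Sum>n. real d * (\<Sum>j<d. (cmod (t i j n))\<^sup>2))"
        by (intro suminf_le le sm sm' i)
      also have "\<dots> = real d * (\<Sum>j<d. \<Sum>n. (cmod (t i j n))\<^sup>2)"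
      proof -
        have "(\<Sum>n. \<Sum>j<d. (cmod (t i j n))\<^sup>2) = (\<Sum>j<d. \<Sum>n. (cmod (t i j n))\<^sup>2)"
          using ts(1)[OF i] by (intro suminf_sum) auto
        thus ?thesis using ts(1)[OF i] by (subst suminf_mult) (auto intro!: summable_sum)
      qed
      also have "\<dots> \<le> real d * (\<Sum>j<d. B\<^sup>2 * s j)"
        using ts(2)[OF i] by (intro mult_left_mono sum_mono) auto
      also have "\<dots> = real d * (B\<^sup>2 * hsq d f)" by (simp add: hsq_def s_def sum_distrib_left)
      finally show ?thesis .
    qed
    hence "hsq d (mult_op d \<Phi> f) \<le> (\<Sum>i<d. real d * (B\<^sup>2 * hsq d f))"
      unfolding hsq_def[of d "mult_op d \<Phi> f"] by (intro sum_mono) auto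
    also have "\<dots> = (real d * B)\<^sup>2 * hsq d f" by (simp add: power2_eq_square)
    finally show ?thesis using mem by simp
  qed
  show "f \<in> hardy d \<Longrightarrow> mult_op d \<Phi> f \<in> hardy d" using main by blast
  show "\<exists>C\<ge>0. \<forall>f\<in>hardy d. hnorm d (mult_op d \<Phi> f) \<le> C * hnorm d f"
  proof (intro exI[of _ "real d * B"] conjI ballI)
    fix f assume f: "f \<in> hardy d"
    have m: "mult_op d \<Phi> f \<in> hardy d" using main[OF f] by blast
    have "(hnorm d (mult_op d \<Phi> f))\<^sup>2 \<le> (real d * B * hnorm d f)\<^sup>2"
      using main[OF f] by (simp add: hnorm_sq f m power_mult_distrib)
    thus "hnorm d (mult_op d \<Phi> f) \<le> real d * B * hnorm d f"
      by (rule power2_le_imp_le) (use B hnorm_nonneg[OF f] in simp)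
  qed (use B in simp)
qed

lemma mult_op_hadd:
  assumes \<Phi>: "\<Phi> \<in> Hinf_mat d" and f: "f \<in> hardy d" and g: "g \<in> hardy d"
  shows "mult_op d \<Phi> (hadd f g) = hadd (mult_op d \<Phi> f) (mult_op d \<Phi> g)"
proof (rule hardy_eqI)
  fix z i assume z: "z \<in> \<D>" and i: "i < d"
  have "dim_vec (mult_op d \<Phi> g z) = d" by (rule hardy_dim[OF mult_op_hardy[OF \<Phi> g]])
  thus "mult_op d \<Phi> (hadd f g) z $ i = hadd (mult_op d \<Phi> f) (mult_op d \<Phi> g) z $ i"
    using f g i by (simp add: hadd_index mult_op_entry[OF \<Phi> _ z i] hardy_dim distrib_left sum.distrib)
qed (simp_all add: mult_op_hardy[OF \<Phi>] f g)

lemma mult_op_hscale: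
  assumes \<Phi>: "\<Phi> \<in> Hinf_mat d" and f: "f \<in> hardy d"
  shows "mult_op d \<Phi> (hscale c f) = hscale c (mult_op d \<Phi> f)"
proof (rule hardy_eqI)
  fix z i assume z: "z \<in> \<D>" and i: "i < d"
  have "dim_vec (mult_op d \<Phi> f z) = d" by (rule hardy_dim[OF mult_op_hardy[OF \<Phi> f]])
  thus "mult_op d \<Phi> (hscale c f) z $ i = hscale c (mult_op d \<Phi> f) z $ i"
    using f i by (simp add: hscale_index mult_op_entry[OF \<Phi> _ z i] hardy_dim sum_distrib_left mult_ac)
qed (simp_all add: mult_op_hardy[OF \<Phi>] f)

text \<open>
  Riesz representation of \<open>u \<mapsto> \<langle>\<Phi> u, g\<rangle>\<close> shows that the description in the adjoint denotes.
\<close>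

lemma hadjoint_mult_op:
  assumes \<Phi>: "\<Phi> \<in> Hinf_mat d" and g: "g \<in> hardy d"
  shows "hadjoint d (mult_op d \<Phi>) g \<in> hardy d"
    and "u \<in> hardy d \<Longrightarrow> hinner d (mult_op d \<Phi> u) g = hinner d u (hadjoint d (mult_op d \<Phi>) g)"
proof -
  obtain C where C: "C \<ge> 0" "\<And>f. f \<in> hardy d \<Longrightarrow> hnorm d (mult_op d \<Phi> f) \<le> C * hnorm d f"
    using mult_op_norm[OF \<Phi>] by blast
  obtain x where x: "x \<in> hardy d" "\<And>u. u \<in> hardy d \<Longrightarrow> hinner d (mult_op d \<Phi> u) g = hinner d u x"
  proof (rule hardy_Riesz[of d "\<lambda>u. hinner d (mult_op d \<Phi> u) g" "C * hnorm d g"])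
    fix u v c assume u: "u \<in> hardy d" and v: "v \<in> hardy d"
    show "hinner d (mult_op d \<Phi> (hadd u v)) g = hinner d (mult_op d \<Phi> u) g + hinner d (mult_op d \<Phi> v) g"
      by (simp add: mult_op_hadd \<Phi> u v hinner_hadd_left mult_op_hardy g)
  next
    fix u c assume u: "u \<in> hardy d"
    show "hinner d (mult_op d \<Phi> (hscale c u)) g = c * hinner d (mult_op d \<Phi> u) g"
      by (simp add: mult_op_hscale \<Phi> u hinner_hscale_left mult_op_hardy g)
    have "cmod (hinner d (mult_op d \<Phi> u) g) \<le> hnorm d (mult_op d \<Phi> u) * hnorm d g"
      by (intro hCauchy_Schwarz mult_op_hardy \<Phi> u g)
    also have "\<dots> \<le> C * hnorm d u * hnorm d g"
      by (intro mult_right_mono C(2) u hnorm_nonneg g)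
    finally show "cmod (hinner d (mult_op d \<Phi> u) g) \<le> C * hnorm d g * hnorm d u" by (simp add: mult_ac)
  qed blast
  have "hadjoint d (mult_op d \<Phi>) g = x"
    unfolding adjoint_on_def
  proof (rule the_equality)
    fix x' assume x': "x' \<in> hardy d \<and> (\<forall>u\<in>hardy d. hinner d (mult_op d \<Phi> u) g = hinner d u x')"
    show "x' = x" by (rule hardy_eq_hinnerI) (use x x' in auto)
  qed (use x in auto)
  with x show "hadjoint d (mult_op d \<Phi>) g \<in> hardy d"
    and "u \<in> hardy d \<Longrightarrow> hinner d (mult_op d \<Phi> u) g = hinner d u (hadjoint d (mult_op d \<Phi>) g)" by auto
qed

lemma hadjoint_mult_op_zero_iff:
  assumes \<Phi>: "\<Phi> \<in> Hinf_mat d" and g: "g \<in> hardy d"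
  shows "hadjoint d (mult_op d \<Phi>) g = hzero d \<longleftrightarrow> (\<forall>u\<in>hardy d. hinner d (mult_op d \<Phi> u) g = 0)"
proof
  assume "\<forall>u\<in>hardy d. hinner d (mult_op d \<Phi> u) g = 0"
  thus "hadjoint d (mult_op d \<Phi>) g = hzero d"
    using hadjoint_mult_op[OF \<Phi> g] by (intro hardy_eq_hinnerI) (auto simp: hinner_hzero_right)
qed (use hadjoint_mult_op(2)[OF \<Phi> g] in \<open>auto simp: hinner_hzero_right\<close>)

section \<open>Szego kernels\<close>

text \<open>
  The kernel at \<open>l\<close> in direction \<open>v\<close>, that is \<open>z \<mapsto> v / (1 - cnj l z)\<close>; pairing with it evaluates
  at \<open>l\<close>.
\<close>

definition szego :: "nat \<Rightarrow> complex \<Rightarrow> complex vec \<Rightarrow> complex \<Rightarrow> complex vec" where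
  "szego d l v = of_hcoeff d (\<lambda>i n. v $ i * cnj l ^ n)"

lemma szego:
  assumes l: "l \<in> \<D>"
  shows szego_hardy: "szego d l v \<in> hardy d"
    and szego_reproducing: "f \<in> hardy d \<Longrightarrow> hinner d f (szego d l v) = (\<Sum>i<d. f l $ i * cnj (v $ i))"
    and szego_at: "i < d \<Longrightarrow> szego d l v l $ i = v $ i / of_real (1 - (cmod l)\<^sup>2)"
proof -
  have l2: "(cmod l)\<^sup>2 < 1" using l by (simp add: abs_square_less_1)
  have sm: "summable (\<lambda>n. (cmod (v $ i * cnj l ^ n))\<^sup>2)" for i
    unfolding norm_mult power_mult_distrib norm_power complex_mod_cnj power_mult[symmetric]
    by (subst (2) mult.commute, subst power_mult, intro summable_mult summable_geometric) (use l2 in simp)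
  note oh = of_hcoeff[of d "\<lambda>i n. v $ i * cnj l ^ n", OF sm, folded szego_def]
  show h: "szego d l v \<in> hardy d" by (rule oh(1))
  show "hinner d f (szego d l v) = (\<Sum>i<d. f l $ i * cnj (v $ i))" if f: "f \<in> hardy d"
    unfolding hinner_hcoeff
  proof (rule sum.cong[OF refl])
    fix i assume "i \<in> {..<d}"
    hence i: "i < d" by simp
    have "(\<lambda>n. hcoeff f i n * l ^ n * cnj (v $ i)) sums (f l $ i * cnj (v $ i))"
      by (intro sums_mult2 hcoeff_sums[OF f i l])
    thus "(\<Sum>n. hcoeff f i n * cnj (hcoeff (szego d l v) i n)) = f l $ i * cnj (v $ i)"
      by (simp add: oh(2)[OF i] sums_iff mult_ac)
  qed
  show "szego d l v l $ i = v $ i / of_real (1 - (cmod l)\<^sup>2)" if i: "i < d"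
  proof -
    have n1: "norm (cnj l * l) < 1" using l2 by (simp add: norm_mult power2_eq_square)
    have "(\<lambda>n. v $ i * (cnj l * l) ^ n) sums (v $ i * (1 / (1 - cnj l * l)))"
      by (intro sums_mult geometric_sums n1)
    moreover have "(\<lambda>n. v $ i * (cnj l * l) ^ n) sums (szego d l v l $ i)"
      using hcoeff_sums[OF h i l] by (simp add: oh(2)[OF i] power_mult_distrib mult.assoc)
    ultimately have "szego d l v l $ i = v $ i * (1 / (1 - cnj l * l))" by (rule sums_unique2[rotated])
    moreover have "1 - cnj l * l = of_real (1 - (cmod l)\<^sup>2)"
      by (simp add: complex_norm_square mult.commute del: of_real_power)
    ultimately show ?thesis by simp
  qed
qed

lemma vnorm_sq: "v \<in> carrier_vec d \<Longrightarrow> complex_of_real ((vnorm v)\<^sup>2) = (\<Sum>i<d. v $ i * cnj (v $ i))"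
  by (simp add: vnorm_def L2_set_def sum_nonneg complex_norm_square[symmetric])

lemma hsq_szego:
  assumes l: "l \<in> \<D>" and v: "v \<in> carrier_vec d"
  shows "hsq d (szego d l v) = (vnorm v)\<^sup>2 / (1 - (cmod l)\<^sup>2)"
proof -
  have "complex_of_real (hsq d (szego d l v)) = (\<Sum>i<d. szego d l v l $ i * cnj (v $ i))"
    using szego_hardy[OF l] szego_reproducing[OF l] by (simp add: hinner_self[symmetric])
  also have "\<dots> = (\<Sum>i<d. v $ i * cnj (v $ i)) / of_real (1 - (cmod l)\<^sup>2)"
    unfolding sum_divide_distrib by (intro sum.cong refl) (simp add: szego_at[OF l] del: of_real_diff)
  also have "\<dots> = of_real ((vnorm v)\<^sup>2 / (1 - (cmod l)\<^sup>2))"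
    unfolding vnorm_sq[OF v, symmetric] by (simp only: of_real_divide)
  finally show ?thesis by (simp only: of_real_eq_iff)
qed

text \<open>
  Pair \<open>\<Psi> k\<^sub>u\<close> with \<open>k\<^sub>w\<close>, where \<open>w = \<Psi>(l) u\<close> and \<open>k\<close> denotes Szego kernels at \<open>l\<close>. The pairing
  equals \<open>\<parallel>w\<parallel>\<^sup>2 / (1 - |l|\<^sup>2)\<close>, while the isometry property and the Cauchy-Schwarz inequality bound it by
  \<open>\<parallel>u\<parallel> \<parallel>w\<parallel> / (1 - |l|\<^sup>2)\<close>.
\<close>

lemma inner_function_contractive:
  assumes I: "inner_function d \<Psi>" and l: "l \<in> \<D>"
  shows "contractive d (\<Psi> l)"
proof -
  have \<Psi>: "\<Psi> \<in> Hinf_mat d" and iso: "\<And>f. f \<in> hardy d \<Longrightarrow> hnorm d (mult_op d \<Psi> f) = hnorm d f"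
    using I by (auto simp: inner_function_def)
  have P: "\<Psi> l \<in> carrier_mat d d" by (rule Hinf_mat_carrier[OF \<Psi> l])
  have pos: "1 - (cmod l)\<^sup>2 > 0" using l by (simp add: abs_square_less_1)
  have "vnorm (\<Psi> l *\<^sub>v u) \<le> vnorm u" if u: "u \<in> carrier_vec d" for u
  proof (cases "vnorm (\<Psi> l *\<^sub>v u) = 0")
    case False
    define c where "c = 1 - (cmod l)\<^sup>2"
    have c: "c > 0" using pos by (simp add: c_def)
    define w where "w = \<Psi> l *\<^sub>v u"
    have w: "w \<in> carrier_vec d" using P u by (simp add: w_def)
    note h = szego_hardy[OF l, of d]
    have "hinner d (mult_op d \<Psi> (szego d l u)) (szego d l w) = (\<Sum>i<d. mult_op d \<Psi> (szego d l u) l $ i * cnj (w $ i))"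
      by (intro szego_reproducing l mult_op_hardy \<Psi> h)
    also have "\<dots> = (\<Sum>i<d. w $ i * cnj (w $ i) / of_real c)"
    proof (rule sum.cong[OF refl])
      fix i assume "i \<in> {..<d}"
      hence i: "i < d" by simp
      have "mult_op d \<Psi> (szego d l u) l $ i = (\<Sum>j<d. \<Psi> l $$ (i, j) * (u $ j / of_real c))"
        unfolding mult_op_entry[OF \<Psi> h l i] by (intro sum.cong refl) (simp add: szego_at[OF l] c_def del: of_real_diff)
      also have "\<dots> = w $ i / of_real c"
        unfolding w_def mat_vec_entry[OF P u i] by (simp add: sum_divide_distrib)
      finally show "mult_op d \<Psi> (szego d l u) l $ i * cnj (w $ i) = w $ i * cnj (w $ i) / of_real c" by simp
    qed
    also have "\<dots> = of_real ((vnorm w)\<^sup>2 / c)"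
      unfolding of_real_divide vnorm_sq[OF w] by (simp add: sum_divide_distrib)
    finally have eq: "hinner d (mult_op d \<Psi> (szego d l u)) (szego d l w) = of_real ((vnorm w)\<^sup>2 / c)" .
    have "(vnorm w)\<^sup>2 / c = cmod (hinner d (mult_op d \<Psi> (szego d l u)) (szego d l w))"
      unfolding eq norm_of_real using c by simp
    also have "\<dots> \<le> hnorm d (mult_op d \<Psi> (szego d l u)) * hnorm d (szego d l w)"
      by (intro hCauchy_Schwarz mult_op_hardy \<Psi> h)
    also have "\<dots> = (vnorm u / sqrt c) * (vnorm w / sqrt c)"
      by (simp add: iso[OF h] hnorm_hsq[OF h] hsq_szego[OF l] u w c_def real_sqrt_divide)
    also have "\<dots> = vnorm u * vnorm w / c" using c by simp
    finally have "vnorm w * vnorm w \<le> vnorm u * vnorm w"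
      using c by (simp add: power2_eq_square divide_right_mono field_simps)
    moreover have "vnorm w > 0" using False vnorm_nonneg[of w] unfolding w_def by linarith
    ultimately show ?thesis unfolding w_def by simp
  qed simp
  thus ?thesis using P by (simp add: contractive_def)
qed

text \<open>
  What the calculus needs from the symbol: values that are contractions with spectrum in the disc.
\<close>

definition admissible :: "nat \<Rightarrow> (complex \<Rightarrow> complex mat) \<Rightarrow> bool" where
  "admissible d \<Psi> \<longleftrightarrow> \<Psi> \<in> Hinf_mat d \<and> (\<forall>z\<in>\<D>. Schur_stable d (\<Psi> z) \<and> contractive d (\<Psi> z))"

lemma rational_pure_inner_admissible: "rational_pure_inner d \<Psi> \<Longrightarrow> admissible d \<Psi>"
  using inner_function_contractive[of d \<Psi>] Hinf_mat_carrier[of \<Psi> d]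
  by (auto simp: rational_pure_inner_def admissible_def inner_function_def Schur_stable_def)

lemma admissibleD:
  assumes "admissible d \<Psi>"
  shows "\<Psi> \<in> Hinf_mat d" "z \<in> \<D> \<Longrightarrow> Schur_stable d (\<Psi> z)" "z \<in> \<D> \<Longrightarrow> contractive d (\<Psi> z)"
  using assms by (auto simp: admissible_def)

section \<open>The calculus of the isometric pair\<close>

lemma calculus_symbol:
  "admissible d \<Psi> \<Longrightarrow> f \<in> Hinf2 \<Longrightarrow> (\<lambda>z. mat_fun d (\<lambda>w. f (z, w)) (\<Psi> z)) \<in> Hinf_mat d"
  by (rule calculus_Hinf_mat) (auto simp: admissible_def)

lemma Hinf2_slice: "f \<in> Hinf2 \<Longrightarrow> z \<in> \<D> \<Longrightarrow> (\<lambda>w. f (z, w)) holomorphic_on \<D>"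
  by (auto simp: Hinf2_iff_sep sep_Hinf_def Hinf_def)

lemma calc_M_hardy: "admissible d \<Psi> \<Longrightarrow> f \<in> Hinf2 \<Longrightarrow> u \<in> hardy d \<Longrightarrow> calc_M d \<Psi> f u \<in> hardy d"
  unfolding calc_M_def by (intro mult_op_hardy calculus_symbol)

lemma calc_M_at: "z \<in> \<D> \<Longrightarrow> calc_M d \<Psi> f u z = mat_act d (\<Psi> z) (\<lambda>w. f (z, w)) (u z)"
  by (simp add: calc_M_def mult_op_def mat_act_def)

lemma calc_M_hadd:
  "admissible d \<Psi> \<Longrightarrow> f \<in> Hinf2 \<Longrightarrow> u \<in> hardy d \<Longrightarrow> v \<in> hardy d \<Longrightarrow>
   calc_M d \<Psi> f (hadd u v) = hadd (calc_M d \<Psi> f u) (calc_M d \<Psi> f v)"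
  unfolding calc_M_def by (intro mult_op_hadd calculus_symbol)

lemma calc_M_cong:
  assumes "f \<in> Hinf2" "\<And>z w. z \<in> \<D> \<Longrightarrow> w \<in> \<D> \<Longrightarrow> f (z, w) = g (z, w)"
  shows "calc_M d \<Psi> f = calc_M d \<Psi> g"
proof -
  have "mat_fun d (\<lambda>w. f (z, w)) (\<Psi> z) = mat_fun d (\<lambda>w. g (z, w)) (\<Psi> z)" if "z \<in> \<D>" for z
    using that assms(2) by (intro mat_fun_cong Hinf2_slice[OF assms(1)]) auto
  thus ?thesis by (auto simp: calc_M_def mult_op_def fun_eq_iff)
qed

lemma hardy_ext:
  assumes "f \<in> hardy d" "g \<in> hardy d" "\<And>z. z \<in> \<D> \<Longrightarrow> f z = g z"
  shows "f = g"
  by (rule hardy_eqI[OF assms(1,2)]) (simp add: assms(3))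

lemma calc_M_mult:
  assumes a: "admissible d \<Psi>" and f: "f \<in> Hinf2" and g: "g \<in> Hinf2" and u: "u \<in> hardy d"
  shows "calc_M d \<Psi> (\<lambda>p. f p * g p) u = calc_M d \<Psi> f (calc_M d \<Psi> g u)"
  using admissibleD[OF a] hardy_carrier[OF u]
  by (intro hardy_ext[of _ d] calc_M_hardy a f g u Hinf2_mult)
     (simp add: calc_M_at mat_act_mult Hinf2_slice f g)

lemma calc_M_add:
  assumes a: "admissible d \<Psi>" and f: "f \<in> Hinf2" and g: "g \<in> Hinf2" and u: "u \<in> hardy d"
  shows "calc_M d \<Psi> (\<lambda>p. f p + g p) u = hadd (calc_M d \<Psi> f u) (calc_M d \<Psi> g u)"
  using admissibleD[OF a] hardy_carrier[OF u]
  by (intro hardy_ext[of _ d] calc_M_hardy hadd_hardy a f g u Hinf2_add)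
     (simp add: hadd_def calc_M_at mat_act_add Hinf2_slice f g)

lemma calc_M_const:
  assumes a: "admissible d \<Psi>" and u: "u \<in> hardy d"
  shows "calc_M d \<Psi> (\<lambda>p. c) u = hscale c u"
  using admissibleD[OF a] hardy_carrier[OF u]
  by (intro hardy_ext[of _ d] calc_M_hardy hscale_hardy a u Hinf2_const)
     (simp add: hscale_def calc_M_at mat_act_const)

text \<open>
  The two coordinate functions give back the two operators of the pair, here and in the next lemma.
\<close>

lemma calc_M_fst:
  assumes a: "admissible d \<Psi>" and u: "u \<in> hardy d"
  shows "calc_M d \<Psi> fst u = shift u"
proof
  fix z
  show "calc_M d \<Psi> fst u z = shift u z"
  proof (cases "z \<in> \<D>")
    case True
    thus ?thesis using admissibleD[OF a] hardy_carrier[OF u] by (simp add: calc_M_at mat_act_const shift_def)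
  next
    case False
    thus ?thesis using hardy_outside[OF u] by (auto simp: calc_M_def mult_op_def shift_def intro!: eq_vecI)
  qed
qed

lemma calc_M_snd:
  assumes a: "admissible d \<Psi>"
  shows "calc_M d \<Psi> snd u = mult_op d \<Psi> u"
  using Hinf_mat_carrier[OF admissibleD(1)[OF a]]
  by (auto simp: calc_M_def mult_op_def mat_fun_ident fun_eq_iff)

section \<open>Isometries into the Hardy space and the annihilator of the pair\<close>

lemma cinner_self_norm: "cinner x x = complex_of_real ((norm (x :: 'h :: chilbert_space))\<^sup>2)"
proof -
  have "Im (cinner x x) = - Im (cinner x x)" using arg_cong[OF cinner_commute[of x x], of Im] by simp
  moreover have "0 \<le> Re (cinner x x)" using norm_ge_zero[of x] by (simp add: norm_eq_sqrt_cinner)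
  hence "(norm x)\<^sup>2 = Re (cinner x x)" by (simp add: norm_eq_sqrt_cinner)
  ultimately show ?thesis by (simp add: complex_eq_iff)
qed

lemma Re_cinner: "2 * Re (cinner x y) = (norm (x + y))\<^sup>2 - (norm x)\<^sup>2 - (norm (y :: 'h :: chilbert_space))\<^sup>2"
proof -
  have r: "cinner a (x + y) = cinner a x + cinner a y" for a
    using cinner_commute[of a "x + y"] cinner_commute[of a x] cinner_commute[of a y]
    by (simp add: cinner_add_left)
  have "complex_of_real ((norm (x + y))\<^sup>2) = cinner x x + cinner x y + cnj (cinner x y) + cinner y y"
    unfolding cinner_self_norm[symmetric] cinner_add_left r cinner_commute[of y x] by simp
  also have "\<dots> = of_real ((norm x)\<^sup>2 + 2 * Re (cinner x y) + (norm y)\<^sup>2)"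
    unfolding cinner_self_norm using complex_add_cnj[of "cinner x y"] by simp
  finally show ?thesis by (simp only: of_real_eq_iff)
qed

lemma cinner_eqI:
  assumes "\<And>u. cinner u x = cinner u (y :: 'h :: chilbert_space)"
  shows "x = y"
proof -
  have m: "(-1) *\<^sub>C y = - y" using scaleC_of_real[of "-1" y] by simp
  have "cinner (x - y) x = cinner (x - y) y" by (rule assms)
  hence "cinner x (x - y) = cinner y (x - y)"
    using cinner_commute[of x "x - y"] cinner_commute[of y "x - y"] by simp
  moreover have "cinner (x + (-1) *\<^sub>C y) (x - y) = cinner x (x - y) - cinner y (x - y)"
    by (simp only: cinner_add_left cinner_scaleC_left) simp
  ultimately have "cinner (x - y) (x - y) = 0" by (simp add: m)
  thus ?thesis by (simp add: cinner_self_norm)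
qed

text \<open>
  Polarization; the imaginary part is obtained by applying the real one to \<open>- \<i> u\<close>.
\<close>

lemma isometry_hinner:
  assumes J: "isometry_into_hardy d (J :: 'h :: chilbert_space \<Rightarrow> _)"
  shows "hinner d (J u) (J v) = cinner u v"
proof -
  have Jh: "J x \<in> hardy d" and Ja: "J (x + y) = hadd (J x) (J y)" and Js: "J (c *\<^sub>C x) = hscale c (J x)"
    and Jn: "hnorm d (J x) = norm x" for x y c
    using J by (auto simp: isometry_into_hardy_def)
  have sq: "hsq d (J x) = (norm x)\<^sup>2" for x using hnorm_sq[OF Jh, of x] by (simp add: Jn)
  have re: "Re (hinner d (J x) (J y)) = Re (cinner x y)" for x y
  proof -
    have e: "hadd (J x) (J y) = hminus (J x) (hscale (-1) (J y))"
      using Jh[of x] Jh[of y] by (intro hardy_eqI[of _ d]) (auto simp: hardy_index)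
    have "hsq d (J (x + y)) = hsq d (J x) + 2 * Re (hinner d (J x) (J y)) + hsq d (J y)"
      unfolding Ja e hsq_hminus_hscale[OF Jh Jh] by simp
    thus ?thesis using Re_cinner[of x y] by (simp add: sq)
  qed
  have "Im (hinner d (J u) (J v)) = Re (hinner d (J ((-\<i>) *\<^sub>C u)) (J v))"
    unfolding Js hinner_hscale_left[OF Jh Jh] by simp
  also have "\<dots> = Im (cinner u v)" unfolding re cinner_scaleC_left by simp
  finally show ?thesis using re by (simp add: complex_eq_iff)
qed

lemma isometry_range_closed:
  assumes J: "isometry_into_hardy d (J :: 'h :: chilbert_space \<Rightarrow> _)"
  shows "closed_subspace d (range J)"
proof -
  have Jh: "J x \<in> hardy d" and Ja: "J (x + y) = hadd (J x) (J y)" and Js: "J (c *\<^sub>C x) = hscale c (J x)"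
    and Jn: "hnorm d (J x) = norm x" for x y c
    using J by (auto simp: isometry_into_hardy_def)
  have Jm: "J (x - y) = hminus (J x) (J y)" for x y
  proof -
    have "(-1) *\<^sub>C y = - y" using scaleC_of_real[of "-1" y] by simp
    hence "J (x - y) = hadd (J x) (hscale (-1) (J y))" using Ja[of x "(-1) *\<^sub>C y"] Js[of "-1" y] by simp
    thus ?thesis by (simp add: hminus_eq[OF Jh Jh])
  qed
  show ?thesis unfolding closed_subspace_def
  proof (intro conjI allI ballI impI)
    have "J (0 - 0) = hminus (J 0) (J 0)" by (rule Jm)
    also have "\<dots> = hzero d" using Jh[of 0] by (intro hardy_eqI[of _ d]) (auto simp: hardy_index)
    finally show "hzero d \<in> range J" by (metis rangeI)
    fix X assume X: "(\<forall>n. X n \<in> range J) \<and> hCauchy d X"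
    hence "\<forall>n. \<exists>x. X n = J x" by blast
    then obtain x where x: "\<And>n. X n = J (x n)" by metis
    have "Cauchy x"
    proof (rule CauchyI)
      fix e :: real assume "e > 0"
      then obtain N where "\<forall>m\<ge>N. \<forall>n\<ge>N. hnorm d (hminus (X m) (X n)) < e"
        using X unfolding hCauchy_def by blast
      thus "\<exists>N. \<forall>m\<ge>N. \<forall>n\<ge>N. norm (x m - x n) < e"
        by (intro exI[of _ N]) (simp add: x Jm[symmetric] Jn)
    qed
    then obtain y where "x \<longlonglongrightarrow> y" using Cauchy_convergent convergent_def by blast
    hence "(\<lambda>n. norm (x n - y)) \<longlonglongrightarrow> 0" by (simp add: tendsto_norm_zero LIM_zero)
    hence "hlim d X (J y)" by (simp add: hlim_def x Jm[symmetric] Jn)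
    thus "\<exists>x\<in>range J. hlim d X x" by blast
  qed (use Jh in \<open>auto simp: Ja[symmetric] Js[symmetric]\<close>)
qed

text \<open>
  The adjoint of \<open>J\<close> exists because the range of \<open>J\<close> is complete: project \<open>y\<close> to the range and
  pull back. So the description in the adjoint denotes, and it denotes \<open>0\<close> exactly when \<open>y\<close> is
  orthogonal to the range.
\<close>

lemma isometry_adjoint_zero_iff:
  assumes J: "isometry_into_hardy d (J :: 'h :: chilbert_space \<Rightarrow> _)" and y: "y \<in> hardy d"
  shows "adjoint_on UNIV cinner (hinner d) J y = 0 \<longleftrightarrow> (\<forall>u. hinner d (J u) y = 0)"
proof -
  have Jh: "J x \<in> hardy d" for x using J by (auto simp: isometry_into_hardy_def)
  obtain g where g: "g \<in> range J" "\<And>k. k \<in> range J \<Longrightarrow> hinner d (hminus y g) k = 0"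
    by (rule hardy_projection_exists[OF isometry_range_closed[OF J] y]) blast
  obtain x where x: "g = J x" using g(1) by blast
  have adj: "hinner d (J u) y = cinner u x" for u
  proof -
    have "hinner d (hminus y (J x)) (J u) = 0" using g(2) x by blast
    hence "hinner d y (J u) = hinner d (J x) (J u)" by (simp add: hinner_hminus_left y Jh)
    hence "hinner d (J u) y = hinner d (J u) (J x)"
      using hinner_commute[OF Jh y, of u] hinner_commute[OF Jh Jh, of u x] by simp
    thus ?thesis by (simp add: isometry_hinner[OF J])
  qed
  have ax: "adjoint_on UNIV cinner (hinner d) J y = x"
    unfolding adjoint_on_def
  proof (rule the_equality)
    fix x' assume "x' \<in> UNIV \<and> (\<forall>u\<in>UNIV. hinner d (J u) y = cinner u x')"
    thus "x' = x" by (intro cinner_eqI) (simp add: adj)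
  qed (simp add: adj)
  have c0: "cinner u (0 :: 'h) = 0" for u
  proof -
    have "cinner (0 *\<^sub>C (0 :: 'h)) u = 0" by (simp only: cinner_scaleC_left) simp
    moreover have "(0::complex) *\<^sub>C (0 :: 'h) = 0" using scaleC_of_real[of 0 "0 :: 'h"] by simp
    ultimately show ?thesis using cinner_commute[of u "0 :: 'h"] by simp
  qed
  have "x = 0 \<longleftrightarrow> (\<forall>u. cinner u x = 0)"
  proof
    assume "\<forall>u. cinner u x = 0"
    thus "x = 0" by (intro cinner_eqI) (simp add: c0)
  qed (simp add: c0)
  thus ?thesis by (simp add: ax adj)
qed

text \<open>
  In this weak form the annihilator is visibly closed under scalar multiplication and contains
  \<open>Ann(M)\<close>.
\<close>

lemma Ann_T_iff:
  assumes a: "admissible d \<Psi>" and J: "isometry_into_hardy d (J :: 'h :: chilbert_space \<Rightarrow> _)"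
  shows "f \<in> Ann_T d \<Psi> J \<longleftrightarrow> f \<in> Hinf2 \<and> (\<forall>x u. hinner d (J u) (calc_M d \<Psi> f (J x)) = 0)"
proof (cases "f \<in> Hinf2")
  case True
  have "J x \<in> hardy d" for x using J by (auto simp: isometry_into_hardy_def)
  thus ?thesis using True
    by (simp add: Ann_T_def calc_T_def isometry_adjoint_zero_iff[OF J calc_M_hardy[OF a True]])
qed (simp add: Ann_T_def)

lemma Ann_M_subset_Ann_T:
  assumes a: "admissible d \<Psi>" and J: "isometry_into_hardy d (J :: 'h :: chilbert_space \<Rightarrow> _)"
  shows "Ann_M d \<Psi> \<subseteq> Ann_T d \<Psi> J"
proof
  fix f assume f: "f \<in> Ann_M d \<Psi>"
  have "J x \<in> hardy d" for x using J by (auto simp: isometry_into_hardy_def)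
  thus "f \<in> Ann_T d \<Psi> J" using f unfolding Ann_T_iff[OF a J] by (auto simp: Ann_M_def hinner_hzero_right)
qed

lemma calc_M_cmult:
  assumes "admissible d \<Psi>" "f \<in> Hinf2" "u \<in> hardy d"
  shows "calc_M d \<Psi> (\<lambda>p. c * f p) u = hscale c (calc_M d \<Psi> f u)"
  using assms by (simp add: calc_M_mult Hinf2_const calc_M_const calc_M_hardy)

lemma Ann_T_cmult:
  assumes a: "admissible d \<Psi>" and J: "isometry_into_hardy d (J :: 'h :: chilbert_space \<Rightarrow> _)"
    and f: "f \<in> Ann_T d \<Psi> J"
  shows "(\<lambda>p. c * f p) \<in> Ann_T d \<Psi> J"
proof -
  have "J x \<in> hardy d" for x using J by (auto simp: isometry_into_hardy_def)
  thus ?thesis using f unfolding Ann_T_iff[OF a J]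
    by (auto simp: calc_M_cmult[OF a] hinner_hscale_right calc_M_hardy[OF a] intro!: Hinf2_mult Hinf2_const)
qed

section \<open>Joint eigenvectors of the adjoints\<close>

lemma hscale_one: "f \<in> hardy d \<Longrightarrow> hscale 1 f = f"
  and hscale_zero: "f \<in> hardy d \<Longrightarrow> hscale 0 f = hzero d"
  by (auto intro!: hardy_eqI[of _ d] simp: hardy_index)

text \<open>
  If \<open>v\<close> is a left eigenvector of \<open>\<Psi>(l)\<close> for \<open>m\<close>, the Szego kernel at \<open>l\<close> in direction of the
  conjugate of \<open>v\<close> is an eigenvector of every \<open>f(M)\<^sup>*\<close>, with eigenvalue the conjugate of \<open>f(l, m)\<close>.
\<close>

lemma joint_eigenvector:
  assumes a: "admissible d \<Psi>" and lm: "l \<in> \<D>" "m \<in> \<D>"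
    and v: "v \<in> carrier_vec d" "v \<noteq> 0\<^sub>v d"
    and ev: "\<And>j. j < d \<Longrightarrow> (\<Sum>i<d. v $ i * \<Psi> l $$ (i, j)) = m * v $ j"
  obtains k where "k \<in> hardy d" "hinner d k k \<noteq> 0"
    "\<And>f u. f \<in> Hinf2 \<Longrightarrow> u \<in> hardy d \<Longrightarrow> hinner d (calc_M d \<Psi> f u) k = f (l, m) * hinner d u k"
proof -
  define k where "k = szego d l (map_vec cnj v)"
  have kh: "k \<in> hardy d" unfolding k_def by (rule szego_hardy[OF lm(1)])
  have rep: "hinner d u k = (\<Sum>i<d. u l $ i * v $ i)" if "u \<in> hardy d" for u
    unfolding k_def szego_reproducing[OF lm(1) that] using v(1) by (intro sum.cong) auto
  have eig: "hinner d (calc_M d \<Psi> f u) k = f (l, m) * hinner d u k" if f: "f \<in> Hinf2" and u: "u \<in> hardy d" for f u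
  proof -
    let ?F = "mat_fun d (\<lambda>w. f (l, w)) (\<Psi> l)"
    have "hinner d (calc_M d \<Psi> f u) k = (\<Sum>i<d. (\<Sum>j<d. ?F $$ (i, j) * u l $ j) * v $ i)"
      unfolding rep[OF calc_M_hardy[OF a f u]]
      using mult_op_entry[OF calculus_symbol[OF a f] u lm(1)] by (simp add: calc_M_def)
    also have "\<dots> = (\<Sum>j<d. (\<Sum>i<d. v $ i * ?F $$ (i, j)) * u l $ j)"
      unfolding sum_distrib_right by (subst sum.swap) (simp add: mult_ac)
    also have "\<dots> = (\<Sum>j<d. f (l, m) * v $ j * u l $ j)"
      using mat_fun_left_eigenvector[OF admissibleD(2)[OF a lm(1)] v(1) lm(2) Hinf2_slice[OF f lm(1)] ev]
      by (intro sum.cong refl) simp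
    also have "\<dots> = f (l, m) * hinner d u k"
      unfolding rep[OF u] sum_distrib_left by (simp add: mult_ac)
    finally show ?thesis .
  qed
  have pos: "hinner d k k \<noteq> 0"
  proof
    assume "hinner d k k = 0"
    hence "hsq d k = 0" using hinner_self[OF kh] by simp
    hence "hinner d u k = 0" for u using hsq_eq_0[OF kh] by (simp add: hinner_hzero_right)
    hence z: "(\<Sum>i<d. szego d l (map_vec cnj v) l $ i * v $ i) = 0" using rep[OF kh] by (simp add: k_def)
    have pos: "1 - (cmod l)\<^sup>2 > 0" using lm(1) by (simp add: abs_square_less_1)
    have "(\<Sum>i<d. szego d l (map_vec cnj v) l $ i * v $ i) = of_real ((vnorm v)\<^sup>2) / of_real (1 - (cmod l)\<^sup>2)"
      unfolding vnorm_sq[OF v(1)] sum_divide_distrib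
      using v(1) by (intro sum.cong refl) (simp add: szego_at[OF lm(1)] mult.commute del: of_real_diff)
    hence "vnorm v = 0" using z pos by (simp del: of_real_diff)
    hence "v = 0\<^sub>v d" using v(1) norm_entry_le_vnorm[of _ v] by (intro eq_vecI) auto
    thus False using v(2) by simp
  qed
  show ?thesis using that[OF kh pos eig] by blast
qed

section \<open>The calculus of the compressed pair\<close>

text \<open>
  The kernel of \<open>f(M)\<^sup>*\<close> is the orthogonal complement of the range of \<open>f(M)\<close>.
\<close>

lemma K_space_iff:
  assumes a: "admissible d \<Psi>"
  shows "k \<in> K_space d \<Psi> J \<longleftrightarrow> k \<in> hardy d \<and>
     (\<forall>f\<in>Ann_T d \<Psi> J. \<forall>u\<in>hardy d. hinner d (calc_M d \<Psi> f u) k = 0)"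
proof -
  have "hadjoint d (calc_M d \<Psi> f) k = hzero d \<longleftrightarrow> (\<forall>u\<in>hardy d. hinner d (calc_M d \<Psi> f u) k = 0)"
    if "f \<in> Ann_T d \<Psi> J" "k \<in> hardy d" for f
    using hadjoint_mult_op_zero_iff[OF calculus_symbol[OF a] that(2), of f] that(1)
    by (simp add: calc_M_def Ann_T_def)
  thus ?thesis by (auto simp: K_space_def)
qed

lemma closed_subspace_K:
  assumes a: "admissible d \<Psi>"
  shows "closed_subspace d (K_space d \<Psi> J)"
  unfolding closed_subspace_def
proof (intro conjI allI ballI impI)
  show sub: "K_space d \<Psi> J \<subseteq> hardy d" by (auto simp: K_space_def)
  show "hzero d \<in> K_space d \<Psi> J" by (simp add: K_space_iff[OF a] hinner_hzero_right)
  have H: "calc_M d \<Psi> f u \<in> hardy d" if "f \<in> Ann_T d \<Psi> J" "u \<in> hardy d" for f u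
    using calc_M_hardy[OF a _ that(2)] that(1) by (simp add: Ann_T_def)
  show "hadd f g \<in> K_space d \<Psi> J" if "f \<in> K_space d \<Psi> J" "g \<in> K_space d \<Psi> J" for f g
    using that by (simp add: K_space_iff[OF a] hinner_hadd_right H)
  show "hscale c f \<in> K_space d \<Psi> J" if "f \<in> K_space d \<Psi> J" for c f
    using that by (simp add: K_space_iff[OF a] hinner_hscale_right H)
  fix X assume X: "(\<forall>n. X n \<in> K_space d \<Psi> J) \<and> hCauchy d X"
  hence Xh: "X n \<in> hardy d" for n using sub by blast
  obtain x where x: "x \<in> hardy d" "hlim d X x" by (rule hardy_complete[OF Xh]) (use X in auto)
  have "hinner d (calc_M d \<Psi> f u) x = 0" if f: "f \<in> Ann_T d \<Psi> J" and u: "u \<in> hardy d" for f u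
  proof -
    define v where "v = calc_M d \<Psi> f u"
    have v: "v \<in> hardy d" unfolding v_def by (rule H[OF f u])
    have "(\<lambda>n. hinner d v (X n)) \<longlonglongrightarrow> hinner d v x"
      by (rule hlim_functional[where C = "hnorm d v"])
         (use v Xh x in \<open>auto simp: hinner_hminus_right intro: hCauchy_Schwarz\<close>)
    moreover have "hinner d v (X n) = 0" for n
      using X f u by (auto simp: K_space_iff[OF a] v_def)
    ultimately have "(\<lambda>n. 0) \<longlonglongrightarrow> hinner d v x" by simp
    hence "0 = hinner d v x" by (simp only: LIMSEQ_const_iff)
    thus ?thesis by (simp add: v_def)
  qed
  hence "x \<in> K_space d \<Psi> J" using x by (simp add: K_space_iff[OF a])
  thus "\<exists>x\<in>K_space d \<Psi> J. hlim d X x" using x by blast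
qed

text \<open>
  The operator \<open>f(S)\<close>, where \<open>S\<close> is the compressed pair.
\<close>

definition calc_S :: "nat \<Rightarrow> (complex \<Rightarrow> complex mat) \<Rightarrow> ('h::chilbert_space \<Rightarrow> complex \<Rightarrow> complex vec) \<Rightarrow>
    (complex \<times> complex \<Rightarrow> complex) \<Rightarrow> (complex \<Rightarrow> complex vec) \<Rightarrow> complex \<Rightarrow> complex vec" where
  "calc_S d \<Psi> J f k = hproj d (K_space d \<Psi> J) (calc_M d \<Psi> f k)"

context
  fixes d :: nat and \<Psi> :: "complex \<Rightarrow> complex mat" and J :: "'h::chilbert_space \<Rightarrow> complex \<Rightarrow> complex vec"
  assumes a: "admissible d \<Psi>"
begin

private abbreviation (input) "K \<equiv> K_space d \<Psi> J"
private abbreviation (input) "C \<equiv> calc_S d \<Psi> J"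

lemma K_space_hardy: "k \<in> K \<Longrightarrow> k \<in> hardy d"
  by (simp add: K_space_iff[OF a])

lemmas K_space_subspace = closed_subspaceD[OF closed_subspace_K[OF a, of J]]

lemma K_space_eqI:
  assumes "x \<in> K" "y \<in> K" "\<And>k. k \<in> K \<Longrightarrow> hinner d x k = hinner d y k"
  shows "x = y"
proof (rule hminus_eq_hzeroD[of _ d])
  show xy: "x \<in> hardy d" "y \<in> hardy d" using assms K_space_hardy by auto
  have m: "hminus x y \<in> K" using K_space_subspace(5) assms by blast
  have "hinner d (hminus x y) (hminus x y) = 0"
    using assms(3)[OF m] xy by (simp add: hinner_hminus_left)
  hence "hsq d (hminus x y) = 0" using hinner_self[of "hminus x y" d] xy by simp
  thus "hminus x y = hzero d" using xy by (intro hsq_eq_0) auto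
qed

lemma calc_S_K: "f \<in> Hinf2 \<Longrightarrow> k \<in> hardy d \<Longrightarrow> C f k \<in> K"
  unfolding calc_S_def by (intro hproj closed_subspace_K a calc_M_hardy)

lemma calc_S_inner:
  "f \<in> Hinf2 \<Longrightarrow> x \<in> hardy d \<Longrightarrow> k \<in> K \<Longrightarrow> hinner d (C f x) k = hinner d (calc_M d \<Psi> f x) k"
  unfolding calc_S_def by (intro hproj closed_subspace_K a calc_M_hardy)

text \<open>
  Since \<open>f(M)\<close> and \<open>g(M)\<close> commute, \<open>g(M)\<^sup>*\<close> maps the common kernel of the \<open>f(M)\<^sup>*\<close> into itself.
\<close>

lemma K_space_coinvariant:
  assumes g: "g \<in> Hinf2" and k: "k \<in> K"
  obtains k' where "k' \<in> K" "\<And>u. u \<in> hardy d \<Longrightarrow> hinner d (calc_M d \<Psi> g u) k = hinner d u k'"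
proof -
  define k' where "k' = hadjoint d (calc_M d \<Psi> g) k"
  have k': "k' \<in> hardy d" "\<And>u. u \<in> hardy d \<Longrightarrow> hinner d (calc_M d \<Psi> g u) k = hinner d u k'"
    unfolding k'_def calc_M_def using hadjoint_mult_op[OF calculus_symbol[OF a g] K_space_hardy[OF k]] by auto
  have "hinner d (calc_M d \<Psi> f u) k' = 0" if f: "f \<in> Ann_T d \<Psi> J" and u: "u \<in> hardy d" for f u
  proof -
    have f2: "f \<in> Hinf2" using f by (simp add: Ann_T_def)
    have "hinner d (calc_M d \<Psi> f u) k' = hinner d (calc_M d \<Psi> g (calc_M d \<Psi> f u)) k"
      using k'(2) calc_M_hardy[OF a f2 u] by simp
    also have "calc_M d \<Psi> g (calc_M d \<Psi> f u) = calc_M d \<Psi> f (calc_M d \<Psi> g u)"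
      unfolding calc_M_mult[OF a g f2 u, symmetric] calc_M_mult[OF a f2 g u, symmetric]
      by (simp add: mult.commute)
    also have "hinner d (calc_M d \<Psi> f (calc_M d \<Psi> g u)) k = 0"
      using k f calc_M_hardy[OF a g u] by (simp add: K_space_iff[OF a])
    finally show ?thesis .
  qed
  hence "k' \<in> K" using k'(1) by (simp add: K_space_iff[OF a])
  thus ?thesis using that k'(2) by blast
qed

text \<open>
  Compression is multiplicative on a co-invariant subspace: pairing with \<open>k \<in> K\<close> moves \<open>f(M)\<close> to the
  other side, where it stays in \<open>K\<close> and no longer sees the projection.
\<close>

lemma calc_S_mult:
  assumes f: "f \<in> Hinf2" and g: "g \<in> Hinf2" and x: "x \<in> K"
  shows "C f (C g x) = C (\<lambda>p. f p * g p) x"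
proof (rule K_space_eqI)
  note xh = K_space_hardy[OF x]
  have gx: "C g x \<in> K" by (rule calc_S_K[OF g xh])
  show "C f (C g x) \<in> K" by (rule calc_S_K[OF f K_space_hardy[OF gx]])
  show "C (\<lambda>p. f p * g p) x \<in> K" by (intro calc_S_K Hinf2_mult f g xh)
  fix k assume k: "k \<in> K"
  obtain k' where k': "k' \<in> K" "\<And>u. u \<in> hardy d \<Longrightarrow> hinner d (calc_M d \<Psi> f u) k = hinner d u k'"
    by (rule K_space_coinvariant[OF f k]) blast
  have "hinner d (C f (C g x)) k = hinner d (C g x) k'"
    using calc_S_inner[OF f K_space_hardy[OF gx] k] k'(2)[OF K_space_hardy[OF gx]] by simp
  also have "\<dots> = hinner d (calc_M d \<Psi> g x) k'" by (rule calc_S_inner[OF g xh k'(1)])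
  also have "\<dots> = hinner d (calc_M d \<Psi> f (calc_M d \<Psi> g x)) k"
    using k'(2)[OF calc_M_hardy[OF a g xh]] by simp
  also have "\<dots> = hinner d (C (\<lambda>p. f p * g p) x) k"
    using calc_S_inner[OF Hinf2_mult[OF f g] xh k] calc_M_mult[OF a f g xh] by simp
  finally show "hinner d (C f (C g x)) k = hinner d (C (\<lambda>p. f p * g p) x) k" .
qed

lemma calc_S_add:
  assumes f: "f \<in> Hinf2" and g: "g \<in> Hinf2" and x: "x \<in> K"
  shows "C (\<lambda>p. f p + g p) x = hadd (C f x) (C g x)"
proof (rule K_space_eqI)
  note xh = K_space_hardy[OF x]
  have m: "C f x \<in> K" "C g x \<in> K" using calc_S_K f g xh by auto
  show "C (\<lambda>p. f p + g p) x \<in> K" by (intro calc_S_K Hinf2_add f g xh)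
  show "hadd (C f x) (C g x) \<in> K" using K_space_subspace(3) m by blast
  fix k assume k: "k \<in> K"
  show "hinner d (C (\<lambda>p. f p + g p) x) k = hinner d (hadd (C f x) (C g x)) k"
    using calc_S_inner[OF Hinf2_add[OF f g] xh k] calc_S_inner[OF f xh k] calc_S_inner[OF g xh k]
      K_space_hardy[OF m(1)] K_space_hardy[OF m(2)] K_space_hardy[OF k] calc_M_hardy[OF a f xh] calc_M_hardy[OF a g xh]
    by (simp add: calc_M_add[OF a f g xh] hinner_hadd_left)
qed

lemma calc_S_hadd:
  assumes f: "f \<in> Hinf2" and x: "x \<in> K" and y: "y \<in> K"
  shows "C f (hadd x y) = hadd (C f x) (C f y)"
proof (rule K_space_eqI)
  note xh = K_space_hardy[OF x] and yh = K_space_hardy[OF y]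
  have m: "C f x \<in> K" "C f y \<in> K" using calc_S_K f xh yh by auto
  show "C f (hadd x y) \<in> K" by (intro calc_S_K hadd_hardy f xh yh)
  show "hadd (C f x) (C f y) \<in> K" using K_space_subspace(3) m by blast
  fix k assume k: "k \<in> K"
  show "hinner d (C f (hadd x y)) k = hinner d (hadd (C f x) (C f y)) k"
    using calc_S_inner[OF f hadd_hardy[OF xh yh] k] calc_S_inner[OF f xh k] calc_S_inner[OF f yh k]
      K_space_hardy[OF m(1)] K_space_hardy[OF m(2)] K_space_hardy[OF k] calc_M_hardy[OF a f xh] calc_M_hardy[OF a f yh]
    by (simp add: calc_M_hadd[OF a f xh yh] hinner_hadd_left)
qed

lemma calc_S_const:
  assumes x: "x \<in> K"
  shows "C (\<lambda>p. c) x = hscale c x"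
proof (rule K_space_eqI)
  note xh = K_space_hardy[OF x]
  show "C (\<lambda>p. c) x \<in> K" by (intro calc_S_K Hinf2_const xh)
  show "hscale c x \<in> K" using K_space_subspace(4) x by blast
  fix k assume k: "k \<in> K"
  show "hinner d (C (\<lambda>p. c) x) k = hinner d (hscale c x) k"
    using calc_S_inner[OF Hinf2_const xh k, of c] calc_M_const[OF a xh, of c] by simp
qed

lemma calc_S_one: "x \<in> K \<Longrightarrow> C (\<lambda>p. 1) x = x"
  using calc_S_const[of x 1] hscale_one[OF K_space_hardy[of x]] by simp

lemma calc_S_Ann:
  assumes f: "f \<in> Ann_T d \<Psi> J" and x: "x \<in> K"
  shows "C f x = hzero d"
proof (rule K_space_eqI)
  have f2: "f \<in> Hinf2" using f by (simp add: Ann_T_def)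
  show "C f x \<in> K" by (rule calc_S_K[OF f2 K_space_hardy[OF x]])
  show "hzero d \<in> K" by (rule K_space_subspace(2))
  fix k assume k: "k \<in> K"
  show "hinner d (C f x) k = hinner d (hzero d) k"
    using calc_S_inner[OF f2 K_space_hardy[OF x] k] k f K_space_hardy[OF x]
    by (simp add: K_space_iff[OF a] hinner_hzero_left)
qed

text \<open>
  The zero vector is the zero function of \<open>S\<close> applied to a vector, and this operator commutes with
  \<open>f(S)\<close>.
\<close>

lemma calc_S_hzero: "f \<in> Hinf2 \<Longrightarrow> C f (hzero d) = hzero d"
proof -
  assume f: "f \<in> Hinf2"
  have "C f (C (\<lambda>p. 0) (hzero d)) = C (\<lambda>p. 0) (C f (hzero d))"
    using calc_S_mult[OF f Hinf2_const K_space_subspace(2)] calc_S_mult[OF Hinf2_const f K_space_subspace(2)] by simp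
  moreover have z0: "C (\<lambda>p. 0) x = hzero d" if "x \<in> K" for x
    using calc_S_const[OF that, of 0] hscale_zero[OF K_space_hardy[OF that]] by simp
  ultimately show ?thesis
    using z0[OF K_space_subspace(2)] z0[OF calc_S_K[OF f hzero_hardy]] by simp
qed

lemma calc_S_cong:
  assumes "f \<in> Hinf2" "\<And>z w. z \<in> \<D> \<Longrightarrow> w \<in> \<D> \<Longrightarrow> f (z, w) = g (z, w)"
  shows "C f x = C g x"
  using calc_M_cong[OF assms] by (simp add: calc_S_def)

lemma compression_shift:
  assumes f: "f \<in> Hinf2" and x: "x \<in> K"
  shows "hminus (C f x) (hscale c x) = C (\<lambda>p. f p - c) x"
proof -
  note xh = K_space_hardy[OF x]
  have "C (\<lambda>p. f p + (- c)) x = hadd (C f x) (hscale (- c) x)"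
    using calc_S_add[OF f Hinf2_const x, of "- c"] calc_S_const[OF x, of "- c"] by simp
  also have "\<dots> = hminus (C f x) (hscale c x)"
    using K_space_hardy[OF calc_S_K[OF f xh]] xh by (intro hardy_eqI[of _ d]) (auto simp: hardy_index)
  finally show ?thesis by simp
qed

lemma S1_calc: "x \<in> K \<Longrightarrow> S1 d \<Psi> J x = C fst x"
  using calc_M_fst[OF a K_space_hardy] by (simp add: S1_def calc_S_def)

lemma S2_calc: "S2 d \<Psi> J x = C snd x"
  using calc_M_snd[OF a] by (simp add: S2_def calc_S_def)

section \<open>The Taylor spectrum of the compressed pair\<close>

lemma koszul_exact_cong:
  assumes "\<And>x. x \<in> X \<Longrightarrow> A x = A' x" "\<And>x. x \<in> X \<Longrightarrow> B x = B' x"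
  shows "koszul_exact n X A B = koszul_exact n X A' B'"
  unfolding koszul_exact_def using assms by (simp cong: ball_cong bex_cong conj_cong)

lemma taylor_spectrum_iff:
  "(l, m) \<in> taylor_spectrum d K (S1 d \<Psi> J) (S2 d \<Psi> J) \<longleftrightarrow>
   \<not> koszul_exact d K (C (\<lambda>p. fst p - l)) (C (\<lambda>p. snd p - m))"
proof -
  have "koszul_exact d K (\<lambda>k. hminus (S1 d \<Psi> J k) (hscale l k)) (\<lambda>k. hminus (S2 d \<Psi> J k) (hscale m k)) =
        koszul_exact d K (C (\<lambda>p. fst p - l)) (C (\<lambda>p. snd p - m))"
    by (rule koszul_exact_cong)
       (simp_all add: S1_calc S2_calc compression_shift[OF Hinf2_fst] compression_shift[OF Hinf2_snd])
  thus ?thesis by (simp add: taylor_spectrum_def)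
qed

text \<open>
  With \<open>A = \<alpha>(S)\<close>, \<open>B = \<beta>(S)\<close>, \<open>G = g(S)\<close>, \<open>H = h(S)\<close> all operators commute and \<open>A G + B H = 1\<close>.
  This gives injectivity at once; a cycle \<open>A y = B x\<close> is the boundary of \<open>u = G x + H y\<close>; and \<open>v\<close> is
  the image of the pair \<open>(- H v, G v)\<close>.
\<close>

lemma koszul_exact_of_Bezout:
  assumes f: "f \<in> Ann_T d \<Psi> J" and g: "g \<in> Hinf2" and h: "h \<in> Hinf2"
    and \<alpha>: "\<alpha> \<in> Hinf2" and \<beta>: "\<beta> \<in> Hinf2"
    and one: "\<And>z w. z \<in> \<D> \<Longrightarrow> w \<in> \<D> \<Longrightarrow> 1 = f (z, w) + \<alpha> (z, w) * g (z, w) + \<beta> (z, w) * h (z, w)"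
  shows "koszul_exact d K (C \<alpha>) (C \<beta>)"
proof -
  have f2: "f \<in> Hinf2" using f by (simp add: Ann_T_def)
  note CK = calc_S_K[OF _ K_space_hardy]
  have id: "x = hadd (C \<alpha> (C g x)) (C \<beta> (C h x))" if x: "x \<in> K" for x
  proof -
    have "x = C (\<lambda>p. 1) x" using calc_S_one[OF x] by simp
    also have "\<dots> = C (\<lambda>p. f p + (\<alpha> p * g p + \<beta> p * h p)) x"
      using one by (intro calc_S_cong Hinf2_const) (simp add: add.assoc)
    also have "\<dots> = hadd (C f x) (hadd (C (\<lambda>p. \<alpha> p * g p) x) (C (\<lambda>p. \<beta> p * h p) x))"
      by (simp add: calc_S_add f2 g h \<alpha> \<beta> Hinf2_mult Hinf2_add x)
    also have "\<dots> = hadd (hzero d) (hadd (C \<alpha> (C g x)) (C \<beta> (C h x)))"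
      by (simp add: calc_S_Ann[OF f x] calc_S_mult g h \<alpha> \<beta> x)
    also have "\<dots> = hadd (C \<alpha> (C g x)) (C \<beta> (C h x))"
      using K_space_hardy[OF CK[OF \<alpha> CK[OF g x]]] K_space_hardy[OF CK[OF \<beta> CK[OF h x]]]
      by (intro hardy_eqI[of _ d]) (auto simp: hardy_index)
    finally show ?thesis .
  qed
  have comm: "C p (C q x) = C q (C p x)" if "p \<in> Hinf2" "q \<in> Hinf2" "x \<in> K" for p q x
    using that by (simp add: calc_S_mult mult.commute)
  have zz: "hadd (hzero d) (hzero d) = hzero d"
    by (intro hardy_eqI[of _ d]) (auto simp: hardy_index)
  show ?thesis unfolding koszul_exact_def
  proof (intro conjI ballI impI)
    fix u assume u: "u \<in> K" and z: "C \<alpha> u = hzero d \<and> C \<beta> u = hzero d"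
    have "C \<alpha> (C g u) = hzero d" "C \<beta> (C h u) = hzero d"
      using comm[OF \<alpha> g u] comm[OF \<beta> h u] z calc_S_hzero[OF g] calc_S_hzero[OF h] by auto
    thus "u = hzero d" using id[OF u] zz by simp
  next
    fix x y assume x: "x \<in> K" and y: "y \<in> K" and z: "hminus (C \<alpha> y) (C \<beta> x) = hzero d"
    have e: "C \<alpha> y = C \<beta> x"
      by (rule hminus_eq_hzeroD[OF K_space_hardy[OF CK[OF \<alpha> y]] K_space_hardy[OF CK[OF \<beta> x]] z])
    define u where "u = hadd (C g x) (C h y)"
    have u: "u \<in> K" unfolding u_def using K_space_subspace(3) CK[OF g x] CK[OF h y] by blast
    have "C \<alpha> u = hadd (C \<alpha> (C g x)) (C \<alpha> (C h y))"
      unfolding u_def by (rule calc_S_hadd[OF \<alpha> CK[OF g x] CK[OF h y]])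
    also have "C \<alpha> (C h y) = C \<beta> (C h x)"
      using comm[OF \<alpha> h y] comm[OF \<beta> h x] e by simp
    finally have 1: "C \<alpha> u = x" using id[OF x] by simp
    have "C \<beta> u = hadd (C \<beta> (C g x)) (C \<beta> (C h y))"
      unfolding u_def by (rule calc_S_hadd[OF \<beta> CK[OF g x] CK[OF h y]])
    also have "C \<beta> (C g x) = C \<alpha> (C g y)"
      using comm[OF \<beta> g x] comm[OF \<alpha> g y] e by simp
    finally have 2: "C \<beta> u = y" using id[OF y] by simp
    show "\<exists>u\<in>K. C \<alpha> u = x \<and> C \<beta> u = y" using u 1 2 by blast
  next
    fix v assume v: "v \<in> K"
    define x where "x = hscale (-1) (C h v)"
    have x: "x \<in> K" unfolding x_def using K_space_subspace(4) CK[OF h v] by blast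
    have "C \<beta> x = C \<beta> (C (\<lambda>p. -1) (C h v))"
      unfolding x_def by (simp add: calc_S_const[OF CK[OF h v]])
    also have "\<dots> = C (\<lambda>p. -1) (C \<beta> (C h v))"
      by (rule comm[OF \<beta> Hinf2_const CK[OF h v]])
    also have "\<dots> = hscale (-1) (C \<beta> (C h v))"
      by (rule calc_S_const[OF CK[OF \<beta> CK[OF h v]]])
    finally have \<beta>x: "C \<beta> x = hscale (-1) (C \<beta> (C h v))" .
    have "hminus (C \<alpha> (C g v)) (C \<beta> x) = hadd (C \<alpha> (C g v)) (C \<beta> (C h v))"
      unfolding \<beta>x using K_space_hardy[OF CK[OF \<alpha> CK[OF g v]]] K_space_hardy[OF CK[OF \<beta> CK[OF h v]]]
      by (intro hardy_eqI[of _ d]) (auto simp: hardy_index)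
    also have "\<dots> = v" using id[OF v] by simp
    finally show "\<exists>x\<in>K. \<exists>y\<in>K. hminus (C \<alpha> y) (C \<beta> x) = v"
      using x CK[OF g v] by blast
  qed
qed

lemma taylor_spectrum_subset_supp:
  "taylor_spectrum d K (S1 d \<Psi> J) (S2 d \<Psi> J) \<subseteq> supp (Ann_T d \<Psi> J)"
proof clarify
  fix l m assume lm: "(l, m) \<in> taylor_spectrum d K (S1 d \<Psi> J) (S2 d \<Psi> J)"
  show "(l, m) \<in> supp (Ann_T d \<Psi> J)"
  proof (rule ccontr)
    assume "(l, m) \<notin> supp (Ann_T d \<Psi> J)"
    then obtain f g h where fgh: "f \<in> Ann_T d \<Psi> J" "g \<in> Hinf2" "h \<in> Hinf2"
      "\<forall>z\<in>\<D>. \<forall>w\<in>\<D>. 1 = f (z, w) + (z - l) * g (z, w) + (w - m) * h (z, w)"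
      unfolding supp_def by blast
    have "koszul_exact d K (C (\<lambda>p. fst p - l)) (C (\<lambda>p. snd p - m))"
      by (rule koszul_exact_of_Bezout[OF fgh(1-3)]) (use fgh(4) in auto)
    thus False using lm taylor_spectrum_iff by blast
  qed
qed

text \<open>
  The joint eigenvector \<open>k\<close> lies in \<open>K\<close> because every \<open>f \<in> Ann(T)\<close> vanishes at \<open>(l, m)\<close>. It is
  orthogonal to the ranges of \<open>S\<^sub>1 - l\<close> and \<open>S\<^sub>2 - m\<close>, so the last Koszul map does not reach it.
\<close>

lemma eigenvector_in_taylor_spectrum:
  assumes lm: "l \<in> \<D>" "m \<in> \<D>" and Z: "\<And>f. f \<in> Ann_T d \<Psi> J \<Longrightarrow> f (l, m) = 0"
    and v: "v \<in> carrier_vec d" "v \<noteq> 0\<^sub>v d"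
    and ev: "\<And>j. j < d \<Longrightarrow> (\<Sum>i<d. v $ i * \<Psi> l $$ (i, j)) = m * v $ j"
  shows "(l, m) \<in> taylor_spectrum d K (S1 d \<Psi> J) (S2 d \<Psi> J)"
proof -
  obtain k where kh: "k \<in> hardy d" and pos: "hinner d k k \<noteq> 0"
    and eig: "\<And>f u. f \<in> Hinf2 \<Longrightarrow> u \<in> hardy d \<Longrightarrow> hinner d (calc_M d \<Psi> f u) k = f (l, m) * hinner d u k"
    by (rule joint_eigenvector[OF a lm v ev]) blast+
  have kK: "k \<in> K" unfolding K_space_iff[OF a]
    using kh eig Z by (auto simp: Ann_T_def)
  have "\<not> koszul_exact d K (C (\<lambda>p. fst p - l)) (C (\<lambda>p. snd p - m))"
  proof
    let ?\<alpha> = "\<lambda>p::complex \<times> complex. fst p - l" and ?\<beta> = "\<lambda>p::complex \<times> complex. snd p - m"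
    have ab: "?\<alpha> \<in> Hinf2" "?\<beta> \<in> Hinf2" by auto
    assume "koszul_exact d K (C ?\<alpha>) (C ?\<beta>)"
    then obtain x y where xy: "x \<in> K" "y \<in> K" "hminus (C ?\<alpha> y) (C ?\<beta> x) = k"
      unfolding koszul_exact_def using kK by blast
    note xh = K_space_hardy[OF xy(1)] and yh = K_space_hardy[OF xy(2)]
    have "hinner d k k = hinner d (hminus (C ?\<alpha> y) (C ?\<beta> x)) k" by (simp only: xy(3))
    also have "\<dots> = hinner d (C ?\<alpha> y) k - hinner d (C ?\<beta> x) k"
      by (rule hinner_hminus_left[OF K_space_hardy[OF calc_S_K[OF ab(1) yh]] K_space_hardy[OF calc_S_K[OF ab(2) xh]] kh])
    also have "hinner d (C ?\<alpha> y) k = 0"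
      unfolding calc_S_inner[OF ab(1) yh kK] eig[OF ab(1) yh] by simp
    also have "hinner d (C ?\<beta> x) k = 0"
      unfolding calc_S_inner[OF ab(2) xh kK] eig[OF ab(2) xh] by simp
    finally show False using pos by simp
  qed
  thus ?thesis by (simp add: taylor_spectrum_iff)
qed

end

section \<open>Values at points of the closed bidisc\<close>

text \<open>
  The relation \<open>f \<in> c + (z - l) H\<^sup>\<infinity> + (w - m) H\<^sup>\<infinity>\<close>, which gives \<open>f\<close> the value \<open>c\<close> at \<open>(l, m)\<close>
  also when this point lies on the boundary of the bidisc. The functions that have a value form an
  algebra.
\<close>

definition Bezout_value :: "complex \<Rightarrow> complex \<Rightarrow> (complex \<times> complex \<Rightarrow> complex) \<Rightarrow> complex \<Rightarrow> bool" where
  "Bezout_value l m f c \<longleftrightarrow> (\<exists>g\<in>Hinf2. \<exists>h\<in>Hinf2. \<forall>z\<in>\<D>. \<forall>w\<in>\<D>.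
     f (z, w) = c + (z - l) * g (z, w) + (w - m) * h (z, w))"

lemma Bezout_valueI:
  assumes "g \<in> Hinf2" "h \<in> Hinf2"
    "\<And>z w. z \<in> \<D> \<Longrightarrow> w \<in> \<D> \<Longrightarrow> f (z, w) = c + (z - l) * g (z, w) + (w - m) * h (z, w)"
  shows "Bezout_value l m f c"
  using assms unfolding Bezout_value_def by blast

lemma Bezout_valueE:
  assumes "Bezout_value l m f c"
  obtains g h where "g \<in> Hinf2" "h \<in> Hinf2"
    "\<And>z w. z \<in> \<D> \<Longrightarrow> w \<in> \<D> \<Longrightarrow> f (z, w) = c + (z - l) * g (z, w) + (w - m) * h (z, w)"
  using assms unfolding Bezout_value_def by blast

lemma Bezout_value_cong:
  assumes "Bezout_value l m f c" "\<And>z w. z \<in> \<D> \<Longrightarrow> w \<in> \<D> \<Longrightarrow> f' (z, w) = f (z, w)"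
  shows "Bezout_value l m f' c"
  using assms unfolding Bezout_value_def by simp

lemma Bezout_value_const: "Bezout_value l m (\<lambda>p. c) c"
  by (rule Bezout_valueI[OF Hinf2_const[of 0] Hinf2_const[of 0]]) simp

lemma Bezout_value_snd: "Bezout_value l m snd m"
  by (rule Bezout_valueI[OF Hinf2_const[of 0] Hinf2_const[of 1]]) simp

lemma Bezout_value_add:
  assumes "Bezout_value l m f c" "Bezout_value l m f' c'"
  shows "Bezout_value l m (\<lambda>p. f p + f' p) (c + c')"
proof -
  obtain g h where g: "g \<in> Hinf2" "h \<in> Hinf2"
    "\<And>z w. z \<in> \<D> \<Longrightarrow> w \<in> \<D> \<Longrightarrow> f (z, w) = c + (z - l) * g (z, w) + (w - m) * h (z, w)"
    by (rule Bezout_valueE[OF assms(1)]) blast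
  obtain g' h' where g': "g' \<in> Hinf2" "h' \<in> Hinf2"
    "\<And>z w. z \<in> \<D> \<Longrightarrow> w \<in> \<D> \<Longrightarrow> f' (z, w) = c' + (z - l) * g' (z, w) + (w - m) * h' (z, w)"
    by (rule Bezout_valueE[OF assms(2)]) blast
  show ?thesis
    by (rule Bezout_valueI[OF Hinf2_add[OF g(1) g'(1)] Hinf2_add[OF g(2) g'(2)]])
       (simp add: g(3) g'(3) algebra_simps)
qed

lemma Bezout_value_mult:
  assumes "Bezout_value l m f c" "Bezout_value l m f' c'" and f': "f' \<in> Hinf2"
  shows "Bezout_value l m (\<lambda>p. f p * f' p) (c * c')"
proof -
  obtain g h where g: "g \<in> Hinf2" "h \<in> Hinf2"
    "\<And>z w. z \<in> \<D> \<Longrightarrow> w \<in> \<D> \<Longrightarrow> f (z, w) = c + (z - l) * g (z, w) + (w - m) * h (z, w)"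
    by (rule Bezout_valueE[OF assms(1)]) blast
  obtain g' h' where g': "g' \<in> Hinf2" "h' \<in> Hinf2"
    "\<And>z w. z \<in> \<D> \<Longrightarrow> w \<in> \<D> \<Longrightarrow> f' (z, w) = c' + (z - l) * g' (z, w) + (w - m) * h' (z, w)"
    by (rule Bezout_valueE[OF assms(2)]) blast
  show ?thesis
  proof (rule Bezout_valueI)
    show "(\<lambda>p. c * g' p + g p * f' p) \<in> Hinf2" "(\<lambda>p. c * h' p + h p * f' p) \<in> Hinf2"
      using g g' f' by (auto intro!: Hinf2_add Hinf2_mult Hinf2_const)
    fix z w assume zw: "z \<in> \<D>" "w \<in> \<D>"
    have "f (z, w) * f' (z, w) = c * f' (z, w) + ((z - l) * g (z, w) + (w - m) * h (z, w)) * f' (z, w)"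
      by (simp add: g(3)[OF zw] algebra_simps)
    also have "c * f' (z, w) = c * (c' + (z - l) * g' (z, w) + (w - m) * h' (z, w))"
      by (simp only: g'(3)[OF zw])
    finally show "f (z, w) * f' (z, w) = c * c' + (z - l) * (c * g' (z, w) + g (z, w) * f' (z, w)) +
        (w - m) * (c * h' (z, w) + h (z, w) * f' (z, w))"
      by (simp add: algebra_simps)
  qed
qed

lemma Bezout_value_sum:
  assumes "\<And>i. i \<in> A \<Longrightarrow> \<exists>c. Bezout_value l m (f i) c"
  shows "\<exists>c. Bezout_value l m (\<lambda>p. \<Sum>i\<in>A. f i p) c"
  using assms
proof (induction A rule: infinite_finite_induct)
  case (insert x F)
  then obtain c c' where "Bezout_value l m (f x) c" "Bezout_value l m (\<lambda>p. \<Sum>i\<in>F. f i p) c'" by blast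
  from Bezout_value_add[OF this] show ?case using insert.hyps by auto
qed (use Bezout_value_const[of l m 0] in auto)

lemma Bezout_value_prod:
  assumes "\<And>i. i \<in> A \<Longrightarrow> f i \<in> Hinf2 \<and> (\<exists>c. Bezout_value l m (f i) c)"
  shows "\<exists>c. Bezout_value l m (\<lambda>p. \<Prod>i\<in>A. f i p) c"
  using assms
proof (induction A rule: infinite_finite_induct)
  case (insert x F)
  then obtain c c' where "Bezout_value l m (f x) c" "Bezout_value l m (\<lambda>p. \<Prod>i\<in>F. f i p) c'" by blast
  moreover have "(\<lambda>p. \<Prod>i\<in>F. f i p) \<in> Hinf2" using insert.prems by (intro Hinf2_prod) auto
  ultimately have "Bezout_value l m (\<lambda>p. f x p * (\<Prod>i\<in>F. f i p)) (c * c')" by (rule Bezout_value_mult)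
  thus ?case using insert.hyps by auto
qed (use Bezout_value_const[of l m 1] in auto)

section \<open>Bounded rational functions\<close>

text \<open>
  Take a representation with denominator of least degree. At a zero of the denominator on the unit
  circle, boundedness makes the numerator vanish as well, and a linear factor cancels.
\<close>

lemma bounded_rational_reduced:
  assumes bd: "bounded (\<phi> ` \<D>)"
    and rat: "\<exists>p q :: complex poly. \<forall>z\<in>\<D>. poly q z \<noteq> 0 \<and> \<phi> z = poly p z / poly q z"
  obtains p q where "\<And>z. z \<in> cball 0 1 \<Longrightarrow> poly q z \<noteq> 0" "\<And>z. z \<in> \<D> \<Longrightarrow> \<phi> z = poly p z / poly q z"
proof -
  define R where "R = (\<lambda>(p, q). \<forall>z\<in>\<D>. poly q z \<noteq> 0 \<and> \<phi> z = poly p z / poly q z)"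
  obtain p0 q0 where "R (p0, q0)" using rat unfolding R_def by auto
  from ex_has_least_nat[of R, OF this, of "\<lambda>pq. degree (snd pq)"]
  obtain pq where pq: "R pq" "\<And>pq'. R pq' \<Longrightarrow> degree (snd pq) \<le> degree (snd pq')" by blast
  obtain p q where e: "pq = (p, q)" by (cases pq)
  have R: "poly q z \<noteq> 0" "\<phi> z = poly p z / poly q z" if "z \<in> \<D>" for z
    using pq(1) that by (auto simp: R_def e)
  have min: "degree q \<le> degree q'" if "\<And>z. z \<in> \<D> \<Longrightarrow> poly q' z \<noteq> 0 \<and> \<phi> z = poly p' z / poly q' z" for p' q'
    using pq(2)[of "(p', q')"] that by (auto simp: R_def e)
  obtain B where B: "\<And>z. z \<in> \<D> \<Longrightarrow> cmod (\<phi> z) \<le> B" using bd unfolding bounded_iff by blast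
  have le: "cmod (poly p z) \<le> B * cmod (poly q z)" if "z \<in> \<D>" for z
    using B[OF that] R[OF that] by (simp add: norm_divide divide_le_eq)
  have "poly q \<zeta> \<noteq> 0" if \<zeta>: "\<zeta> \<in> cball 0 1" for \<zeta>
  proof
    assume q0: "poly q \<zeta> = 0"
    hence \<zeta>D: "\<zeta> \<notin> \<D>" using R(1) by blast
    have "closed {z. cmod (poly p z) \<le> B * cmod (poly q z)}"
      by (intro closed_Collect_le continuous_intros)
    moreover have "\<D> \<subseteq> {z. cmod (poly p z) \<le> B * cmod (poly q z)}" using le by blast
    ultimately have "closure \<D> \<subseteq> {z. cmod (poly p z) \<le> B * cmod (poly q z)}" by (rule closure_minimal[rotated])
    hence "cmod (poly p \<zeta>) \<le> B * cmod (poly q \<zeta>)" using \<zeta> by auto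
    hence p0: "poly p \<zeta> = 0" using q0 by simp
    obtain p' where p': "p = [:-\<zeta>, 1:] * p'" using p0 by (auto simp: poly_eq_0_iff_dvd dvd_def)
    obtain q' where q': "q = [:-\<zeta>, 1:] * q'" using q0 by (auto simp: poly_eq_0_iff_dvd dvd_def)
    have "q \<noteq> 0" using R(1)[of 0] by auto
    hence "q' \<noteq> 0" using q' by auto
    hence "degree q = Suc (degree q')" unfolding q' by (subst degree_mult_eq) auto
    moreover have "degree q \<le> degree q'"
    proof (rule min)
      fix z assume z: "z \<in> \<D>"
      hence nz: "z - \<zeta> \<noteq> 0" using \<zeta>D by auto
      have "poly q z = (z - \<zeta>) * poly q' z" "poly p z = (z - \<zeta>) * poly p' z"
        by (simp_all add: p' q' algebra_simps)
      thus "poly q' z \<noteq> 0 \<and> \<phi> z = poly p' z / poly q' z" using R[OF z] nz by simp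
    qed
    ultimately show False by simp
  qed
  thus ?thesis using that R(2) by blast
qed

text \<open>
  Without poles on the closed disc, the value at \<open>l\<close> can be subtracted and the difference divided by
  \<open>z - l\<close> among rational functions.
\<close>

lemma bounded_rational_value:
  assumes bd: "bounded (\<phi> ` \<D>)"
    and rat: "\<exists>p q :: complex poly. \<forall>z\<in>\<D>. poly q z \<noteq> 0 \<and> \<phi> z = poly p z / poly q z"
    and l: "l \<in> cball 0 1"
  shows "\<exists>c. Bezout_value l m (\<lambda>p. \<phi> (fst p)) c"
proof -
  obtain p q where q: "\<And>z. z \<in> cball 0 1 \<Longrightarrow> poly q z \<noteq> 0" and \<phi>: "\<And>z. z \<in> \<D> \<Longrightarrow> \<phi> z = poly p z / poly q z"
    by (rule bounded_rational_reduced[OF bd rat]) blast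
  have sub: "\<D> \<subseteq> cball 0 1" by auto
  \<comment> \<open>numerator of \<open>\<phi>(z) - \<phi>(l)\<close>\<close>
  define N where "N = Polynomial.smult (poly q l) p - Polynomial.smult (poly p l) q"
  have "poly N l = 0" by (simp add: N_def)
  then obtain s where s: "N = [:-l, 1:] * s" by (auto simp: poly_eq_0_iff_dvd dvd_def)
  define r where "r = (\<lambda>z. poly s z / (poly q z * poly q l))"
  have "continuous_on (cball 0 1) r" unfolding r_def using q l by (intro continuous_intros) auto
  hence "bounded (r ` cball 0 1)" by (intro compact_imp_bounded compact_continuous_image) auto
  then obtain B where B: "\<And>z. z \<in> cball 0 1 \<Longrightarrow> cmod (r z) \<le> B" unfolding bounded_iff by blast
  have "r \<in> Hinf B"
  proof (rule HinfI)
    show "r holomorphic_on \<D>" unfolding r_def using q l by (intro holomorphic_intros) auto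
  qed (use B in auto)
  hence r2: "(\<lambda>p. r (fst p)) \<in> Hinf2" by (rule Hinf2_fst_comp)
  have "\<phi> z = poly p l / poly q l + (z - l) * r z" if z: "z \<in> \<D>" for z
  proof -
    have nz: "poly q z \<noteq> 0" "poly q l \<noteq> 0" using q z l sub by blast+
    have "poly q l * poly p z - poly p l * poly q z = (z - l) * poly s z"
      using arg_cong[OF s, of "\<lambda>N. poly N z"] by (simp add: N_def algebra_simps)
    hence "poly q l * poly p z = poly p l * poly q z + (z - l) * poly s z" by (simp add: algebra_simps)
    thus ?thesis unfolding \<phi>[OF z] r_def using nz by (simp add: field_simps)
  qed
  hence "Bezout_value l m (\<lambda>p. \<phi> (fst p)) (poly p l / poly q l)"
    by (intro Bezout_valueI[OF r2 Hinf2_const[of 0]]) simp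
  thus ?thesis by blast
qed

section \<open>The characteristic function of the symbol\<close>

definition det_fun :: "nat \<Rightarrow> (complex \<Rightarrow> complex mat) \<Rightarrow> complex \<times> complex \<Rightarrow> complex" where
  "det_fun d \<Psi> = (\<lambda>(z, w). det (\<Psi> z - w \<cdot>\<^sub>m 1\<^sub>m d))"

lemma V_set_iff: "(z, w) \<in> V_set d \<Psi> \<longleftrightarrow> z \<in> \<D> \<and> w \<in> \<D> \<and> det_fun d \<Psi> (z, w) = 0"
  by (auto simp: V_set_def det_fun_def)

lemma Hinf2_cong:
  assumes "f \<in> Hinf2" "\<And>z w. z \<in> \<D> \<Longrightarrow> w \<in> \<D> \<Longrightarrow> g (z, w) = f (z, w)"
  shows "g \<in> Hinf2"
proof -
  obtain B where B: "f \<in> sep_Hinf B" using assms(1) Hinf2_iff_sep by blast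
  have "(\<lambda>z. g (z, w)) \<in> Hinf B" if "w \<in> \<D>" for w
  proof -
    have "(\<lambda>z. f (z, w)) \<in> Hinf B" using B that by (simp add: sep_Hinf_def)
    thus ?thesis using assms(2) that holomorphic_cong[of \<D> \<D> "\<lambda>z. f (z, w)" "\<lambda>z. g (z, w)"]
      by (simp add: Hinf_def)
  qed
  moreover have "(\<lambda>w. g (z, w)) \<in> Hinf B" if "z \<in> \<D>" for z
  proof -
    have "(\<lambda>w. f (z, w)) \<in> Hinf B" using B that by (simp add: sep_Hinf_def)
    thus ?thesis using assms(2) that holomorphic_cong[of \<D> \<D> "\<lambda>w. f (z, w)" "\<lambda>w. g (z, w)"]
      by (simp add: Hinf_def)
  qed
  ultimately have "g \<in> sep_Hinf B" by (simp add: sep_Hinf_def)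
  thus ?thesis by (rule Hinf2_sepI)
qed

text \<open>
  The sign of the second summand sits in a coefficient, so that the entry is visibly a sum of products
  of functions that have a value.
\<close>

definition det_entry :: "(complex \<Rightarrow> complex mat) \<Rightarrow> nat \<Rightarrow> nat \<Rightarrow> complex \<times> complex \<Rightarrow> complex" where
  "det_entry \<Psi> i j = (\<lambda>p. \<Psi> (fst p) $$ (i, j) + (if i = j then -1 else 0) * snd p)"

lemma det_fun_expand:
  assumes \<Psi>: "\<Psi> \<in> Hinf_mat d" and z: "z \<in> \<D>"
  shows "det_fun d \<Psi> (z, w) =
    (\<Sum>\<pi> | \<pi> permutes {0..<d}. signof \<pi> * (\<Prod>i=0..<d. det_entry \<Psi> i (\<pi> i) (z, w)))"
proof -
  have P: "\<Psi> z \<in> carrier_mat d d" by (rule Hinf_mat_carrier[OF \<Psi> z])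
  hence "\<Psi> z - w \<cdot>\<^sub>m 1\<^sub>m d \<in> carrier_mat d d" by (intro minus_carrier_mat) auto
  hence "det_fun d \<Psi> (z, w) =
      (\<Sum>\<pi> | \<pi> permutes {0..<d}. signof \<pi> * (\<Prod>i=0..<d. (\<Psi> z - w \<cdot>\<^sub>m 1\<^sub>m d) $$ (i, \<pi> i)))"
    by (simp add: det_fun_def det_def')
  also have "\<dots> = (\<Sum>\<pi> | \<pi> permutes {0..<d}. signof \<pi> * (\<Prod>i=0..<d. det_entry \<Psi> i (\<pi> i) (z, w)))"
  proof (intro sum.cong refl arg_cong2[where f = "(*)"] prod.cong)
    fix \<pi> i assume "\<pi> \<in> {\<pi>. \<pi> permutes {0..<d}}" and i: "i \<in> {0..<d}"
    hence "\<pi> i < d" using permutes_in_image[of \<pi> "{0..<d}" i] by auto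
    thus "(\<Psi> z - w \<cdot>\<^sub>m 1\<^sub>m d) $$ (i, \<pi> i) = det_entry \<Psi> i (\<pi> i) (z, w)"
      using P i by (auto simp: det_entry_def)
  qed
  finally show ?thesis .
qed

lemma det_entry_Hinf2:
  assumes \<Psi>: "\<Psi> \<in> Hinf_mat d" and \<pi>: "\<pi> permutes {0..<d}" and i: "i \<in> {0..<d}"
  shows "det_entry \<Psi> i (\<pi> i) \<in> Hinf2"
proof -
  have ij: "i < d" "\<pi> i < d" using i permutes_in_image[OF \<pi>, of i] by auto
  obtain B where "\<And>i j. i < d \<Longrightarrow> j < d \<Longrightarrow> (\<lambda>z. \<Psi> z $$ (i, j)) \<in> Hinf B"
    by (rule Hinf_mat_bound[OF \<Psi>]) blast
  from Hinf2_fst_comp[OF this[OF ij]] show ?thesis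
    unfolding det_entry_def by (intro Hinf2_add Hinf2_mult Hinf2_const Hinf2_snd)
qed

lemma det_fun_Hinf2:
  assumes \<Psi>: "\<Psi> \<in> Hinf_mat d"
  shows "det_fun d \<Psi> \<in> Hinf2"
proof (rule Hinf2_cong)
  show "(\<lambda>p. \<Sum>\<pi> | \<pi> permutes {0..<d}. signof \<pi> * (\<Prod>i=0..<d. det_entry \<Psi> i (\<pi> i) p)) \<in> Hinf2"
    by (intro Hinf2_sum Hinf2_mult Hinf2_const Hinf2_prod det_entry_Hinf2[OF \<Psi>]) auto
qed (simp add: det_fun_expand[OF \<Psi>])

lemma det_entry_Bezout_value:
  assumes \<Psi>: "\<Psi> \<in> Hinf_mat d" and rat: "rational_entries d \<Psi>" and l: "l \<in> cball 0 1"
    and \<pi>: "\<pi> permutes {0..<d}" and i: "i \<in> {0..<d}"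
  shows "\<exists>c. Bezout_value l m (det_entry \<Psi> i (\<pi> i)) c"
proof -
  have ij: "i < d" "\<pi> i < d" using i permutes_in_image[OF \<pi>, of i] by auto
  have "bounded ((\<lambda>z. \<Psi> z $$ (i, \<pi> i)) ` \<D>)" using \<Psi> ij by (simp add: Hinf_mat_def)
  moreover have "\<exists>p q :: complex poly. \<forall>z\<in>\<D>. poly q z \<noteq> 0 \<and> \<Psi> z $$ (i, \<pi> i) = poly p z / poly q z"
    using rat ij by (simp add: rational_entries_def)
  ultimately obtain c where "Bezout_value l m (\<lambda>p. \<Psi> (fst p) $$ (i, \<pi> i)) c"
    using bounded_rational_value[OF _ _ l] by blast
  from Bezout_value_add[OF this Bezout_value_mult[OF Bezout_value_const Bezout_value_snd Hinf2_snd]]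
  show ?thesis unfolding det_entry_def by blast
qed

lemma det_fun_Bezout_value:
  assumes \<Psi>: "\<Psi> \<in> Hinf_mat d" and rat: "rational_entries d \<Psi>" and l: "l \<in> cball 0 1"
  shows "\<exists>c. Bezout_value l m (det_fun d \<Psi>) c"
proof -
  have "\<exists>c. Bezout_value l m
      (\<lambda>p. \<Sum>\<pi> | \<pi> permutes {0..<d}. signof \<pi> * (\<Prod>i=0..<d. det_entry \<Psi> i (\<pi> i) p)) c"
  proof (rule Bezout_value_sum)
    fix \<pi> assume "\<pi> \<in> {\<pi>. \<pi> permutes {0..<d}}"
    hence \<pi>: "\<pi> permutes {0..<d}" by simp
    have "\<exists>c. Bezout_value l m (\<lambda>p. \<Prod>i=0..<d. det_entry \<Psi> i (\<pi> i) p) c"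
      by (intro Bezout_value_prod conjI det_entry_Hinf2[OF \<Psi> \<pi>] det_entry_Bezout_value[OF \<Psi> rat l \<pi>])
    then obtain c where c: "Bezout_value l m (\<lambda>p. \<Prod>i=0..<d. det_entry \<Psi> i (\<pi> i) p) c" by blast
    have "(\<lambda>p. \<Prod>i=0..<d. det_entry \<Psi> i (\<pi> i) p) \<in> Hinf2"
      by (intro Hinf2_prod det_entry_Hinf2[OF \<Psi> \<pi>])
    from Bezout_value_mult[OF Bezout_value_const c this]
    show "\<exists>c. Bezout_value l m (\<lambda>p. signof \<pi> * (\<Prod>i=0..<d. det_entry \<Psi> i (\<pi> i) p)) c" by blast
  qed
  then obtain c where c: "Bezout_value l m
      (\<lambda>p. \<Sum>\<pi> | \<pi> permutes {0..<d}. signof \<pi> * (\<Prod>i=0..<d. det_entry \<Psi> i (\<pi> i) p)) c" by blast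
  have "Bezout_value l m (det_fun d \<Psi>) c"
    by (rule Bezout_value_cong[OF c]) (simp add: det_fun_expand[OF \<Psi>])
  thus ?thesis by blast
qed

text \<open>
  At each \<open>z\<close> this is the Cayley-Hamilton theorem for \<open>\<Psi>(z)\<close>.
\<close>

lemma det_fun_Ann_M:
  assumes a: "admissible d \<Psi>"
  shows "det_fun d \<Psi> \<in> Ann_M d \<Psi>"
proof -
  note \<Psi> = admissibleD[OF a]
  have h: "det_fun d \<Psi> \<in> Hinf2" by (rule det_fun_Hinf2[OF \<Psi>(1)])
  have "calc_M d \<Psi> (det_fun d \<Psi>) g = hzero d" if g: "g \<in> hardy d" for g
  proof (rule hardy_ext[OF calc_M_hardy[OF a h g] hzero_hardy])
    fix z assume z: "z \<in> \<D>"
    note st = \<Psi>(2)[OF z]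
    have P: "\<Psi> z \<in> carrier_mat d d" using st by (simp add: Schur_stable_def)
    obtain es where es: "char_poly (\<Psi> z) = (\<Prod>e\<leftarrow>es. [:- e, 1:])"
      by (rule Schur_stable_char_poly[OF st]) blast
    have "calc_M d \<Psi> (det_fun d \<Psi>) g z = mat_act d (\<Psi> z) (\<lambda>w. (-1) ^ d * root_prod es w) (g z)"
      unfolding calc_M_at[OF z] using det_shift_root_prod[OF P es]
      by (intro mat_act_cong Hinf2_slice[OF h z]) (simp add: det_fun_def)
    also have "\<dots> = mat_act d (\<Psi> z) (\<lambda>w. (-1) ^ d) (mat_act d (\<Psi> z) (root_prod es) (g z))"
      by (intro mat_act_mult st root_prod_holo holomorphic_intros hardy_carrier[OF g])
    also have "\<dots> = 0\<^sub>v d"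
      by (simp add: Cayley_Hamilton_roots[OF st es hardy_carrier[OF g]] mat_act_zero)
    finally show "calc_M d \<Psi> (det_fun d \<Psi>) g z = hzero d z" by (simp add: hzero_def)
  qed
  thus ?thesis using h by (simp add: Ann_M_def)
qed

lemma det_fun_zero_left_eigenvector:
  assumes P: "\<Psi> z \<in> carrier_mat d d" and 0: "det_fun d \<Psi> (z, w) = 0"
  obtains v where "v \<in> carrier_vec d" "v \<noteq> 0\<^sub>v d"
    "\<And>j. j < d \<Longrightarrow> (\<Sum>i<d. v $ i * \<Psi> z $$ (i, j)) = w * v $ j"
proof -
  define M where "M = \<Psi> z - w \<cdot>\<^sub>m 1\<^sub>m d"
  have M: "M \<in> carrier_mat d d" unfolding M_def using P by (intro minus_carrier_mat) auto
  have "det (transpose_mat M) = 0" using det_transpose[OF M] 0 by (simp add: det_fun_def M_def)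
  then obtain v where v: "v \<in> carrier_vec d" "v \<noteq> 0\<^sub>v d" "transpose_mat M *\<^sub>v v = 0\<^sub>v d"
    using det_0_iff_vec_prod_zero_field[of "transpose_mat M" d] M by auto
  have "(\<Sum>i<d. v $ i * \<Psi> z $$ (i, j)) = w * v $ j" if j: "j < d" for j
  proof -
    have "0 = (\<Sum>i<d. transpose_mat M $$ (j, i) * v $ i)"
      using mat_vec_entry[of "transpose_mat M" d v j] M v j by simp
    also have "\<dots> = (\<Sum>i<d. v $ i * \<Psi> z $$ (i, j) - (if i = j then w * v $ j else 0))"
      using M P j by (intro sum.cong refl) (auto simp: M_def algebra_simps)
    also have "\<dots> = (\<Sum>i<d. v $ i * \<Psi> z $$ (i, j)) - w * v $ j"
      using j by (simp add: sum_subtractf)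
    finally show ?thesis by simp
  qed
  thus ?thesis using that v by blast
qed

text \<open>
  Pair \<open>f(M) k = 0\<close> with the joint eigenvector \<open>k\<close>.
\<close>

lemma Ann_M_zero_on_V:
  assumes a: "admissible d \<Psi>" and f: "f \<in> Ann_M d \<Psi>" and V: "(z, w) \<in> V_set d \<Psi>"
  shows "f (z, w) = 0"
proof -
  have zw: "z \<in> \<D>" "w \<in> \<D>" and 0: "det_fun d \<Psi> (z, w) = 0" using V by (auto simp: V_set_iff)
  have P: "\<Psi> z \<in> carrier_mat d d" by (rule Hinf_mat_carrier[OF admissibleD(1)[OF a] zw(1)])
  obtain v where v: "v \<in> carrier_vec d" "v \<noteq> 0\<^sub>v d"
    "\<And>j. j < d \<Longrightarrow> (\<Sum>i<d. v $ i * \<Psi> z $$ (i, j)) = w * v $ j"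
    by (rule det_fun_zero_left_eigenvector[OF P 0]) blast
  obtain k where k: "k \<in> hardy d" "hinner d k k \<noteq> 0"
    "\<And>f u. f \<in> Hinf2 \<Longrightarrow> u \<in> hardy d \<Longrightarrow> hinner d (calc_M d \<Psi> f u) k = f (z, w) * hinner d u k"
    by (rule joint_eigenvector[OF a zw v]) blast+
  have "hinner d (calc_M d \<Psi> f k) k = 0" using f k(1) by (simp add: Ann_M_def hinner_hzero_left)
  hence "f (z, w) * hinner d k k = 0" using k(3)[of f k] k(1) f by (simp add: Ann_M_def)
  thus ?thesis using k(2) by simp
qed

section \<open>Supports\<close>

lemma not_in_suppI:
  assumes "f \<in> F" "g \<in> Hinf2" "h \<in> Hinf2"
    "\<And>z w. z \<in> \<D> \<Longrightarrow> w \<in> \<D> \<Longrightarrow> 1 = f (z, w) + (z - l) * g (z, w) + (w - m) * h (z, w)"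
  shows "(l, m) \<notin> supp F"
  using assms unfolding supp_def by blast

text \<open>
  Dividing by the value \<open>c\<close> turns \<open>f = c + (z - l) g + (w - m) h\<close> into a Bezout identity.
\<close>

lemma not_in_supp_of_Bezout_value:
  assumes f: "f \<in> F" and scale: "\<And>f c. f \<in> F \<Longrightarrow> (\<lambda>p. c * f p) \<in> F"
    and v: "Bezout_value l m f c" "c \<noteq> 0"
  shows "(l, m) \<notin> supp F"
proof -
  obtain g h where g: "g \<in> Hinf2" "h \<in> Hinf2"
    "\<And>z w. z \<in> \<D> \<Longrightarrow> w \<in> \<D> \<Longrightarrow> f (z, w) = c + (z - l) * g (z, w) + (w - m) * h (z, w)"
    by (rule Bezout_valueE[OF v(1)]) blast
  show ?thesis
  proof (rule not_in_suppI[of "\<lambda>p. (1 / c) * f p" _ "\<lambda>p. (- 1 / c) * g p" "\<lambda>p. (- 1 / c) * h p"])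
    show "(\<lambda>p. (1 / c) * f p) \<in> F" by (rule scale[OF f])
    show "(\<lambda>p. (- 1 / c) * g p) \<in> Hinf2" "(\<lambda>p. (- 1 / c) * h p) \<in> Hinf2"
      by (intro Hinf2_mult Hinf2_const g)+
    fix z w assume "z \<in> \<D>" "w \<in> \<D>"
    thus "1 = (1 / c) * f (z, w) + (z - l) * ((- 1 / c) * g (z, w)) + (w - m) * ((- 1 / c) * h (z, w))"
      using v(2) by (simp add: g(3) field_simps)
  qed
qed

lemma inverse_shift_Hinf:
  assumes l: "l \<notin> cball 0 1"
  shows "(\<lambda>z. 1 / (z - l)) \<in> Hinf (1 / (cmod l - 1))"
proof (rule HinfI)
  show "(\<lambda>z. 1 / (z - l)) holomorphic_on \<D>" using l by (intro holomorphic_intros) auto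
  fix z assume z: "z \<in> \<D>"
  have "cmod l - 1 \<le> cmod (z - l)"
    using norm_triangle_ineq2[of l z] z by (simp add: norm_minus_commute)
  thus "cmod (1 / (z - l)) \<le> 1 / (cmod l - 1)" using l by (simp add: norm_divide frac_le)
qed

text \<open>
  Off the closed disc \<open>1 / (z - l)\<close> is itself bounded and holomorphic.
\<close>

lemma supp_subset_closed_bidisc:
  assumes 0: "(\<lambda>p. 0) \<in> F"
  shows "supp F \<subseteq> cball 0 1 \<times> cball 0 1"
proof clarify
  fix l m assume lm: "(l, m) \<in> supp F"
  have "l \<in> cball 0 1"
  proof (rule ccontr)
    assume l: "l \<notin> cball 0 1"
    have "(l, m) \<notin> supp F"
      by (rule not_in_suppI[OF 0 Hinf2_fst_comp[OF inverse_shift_Hinf[OF l]] Hinf2_const[of 0]])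
         (use l in auto)
    thus False using lm by blast
  qed
  moreover have "m \<in> cball 0 1"
  proof (rule ccontr)
    assume m: "m \<notin> cball 0 1"
    have "(l, m) \<notin> supp F"
      by (rule not_in_suppI[OF 0 Hinf2_const[of 0] Hinf2_snd_comp[OF inverse_shift_Hinf[OF m]]])
         (use m in auto)
    thus False using lm by blast
  qed
  ultimately show "l \<in> cball 0 1 \<and> m \<in> cball 0 1" by blast
qed

lemma root_prod_lower_bound:
  assumes "\<And>e. e \<in> set es \<Longrightarrow> \<epsilon> \<le> cmod (w - e)" "0 \<le> \<epsilon>"
  shows "\<epsilon> ^ length es \<le> cmod (root_prod es w)"
  using assms(1)
proof (induction es)
  case (Cons e es)
  thus ?case using assms(2) by (simp add: norm_mult mult_mono)
qed simp

lemma Ann_M_cmult: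
  assumes "admissible d \<Psi>" "f \<in> Ann_M d \<Psi>"
  shows "(\<lambda>p. c * f p) \<in> Ann_M d \<Psi>"
  using assms by (auto simp: Ann_M_def calc_M_cmult hscale_def hzero_def intro!: Hinf2_mult Hinf2_const eq_vecI)

text \<open>
  The characteristic function must have value \<open>0\<close> at \<open>(l, m)\<close>. Approach \<open>(l, m)\<close> radially: the
  characteristic function becomes smaller than \<open>\<epsilon>\<^sup>d\<close>, so one of its \<open>d\<close> linear factors is smaller
  than \<open>\<epsilon>\<close>, and the corresponding eigenvalue gives a nearby point of the variety.
\<close>

lemma supp_Ann_M_subset_closure:
  assumes a: "admissible d \<Psi>" and rat: "rational_entries d \<Psi>"
  shows "supp (Ann_M d \<Psi>) \<subseteq> closure (V_set d \<Psi>)"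
proof clarify
  fix l m assume lm: "(l, m) \<in> supp (Ann_M d \<Psi>)"
  note \<Psi> = admissibleD[OF a]
  have "(\<lambda>p. 0) \<in> Ann_M d \<Psi>" using Ann_M_cmult[OF a det_fun_Ann_M[OF a], of 0] by simp
  hence lm1: "l \<in> cball 0 1" "m \<in> cball 0 1" using supp_subset_closed_bidisc lm by blast+
  obtain c where c: "Bezout_value l m (det_fun d \<Psi>) c"
    using det_fun_Bezout_value[OF \<Psi>(1) rat lm1(1)] by blast
  have "c = 0"
    using not_in_supp_of_Bezout_value[OF det_fun_Ann_M[OF a] Ann_M_cmult[OF a] c] lm by blast
  then obtain g h where g: "g \<in> Hinf2" "h \<in> Hinf2"
    "\<And>z w. z \<in> \<D> \<Longrightarrow> w \<in> \<D> \<Longrightarrow> det_fun d \<Psi> (z, w) = (z - l) * g (z, w) + (w - m) * h (z, w)"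
    using Bezout_valueE[OF c] by (metis add_0)
  obtain G where G: "G > 0" "\<And>z w. z \<in> \<D> \<Longrightarrow> w \<in> \<D> \<Longrightarrow> cmod (g (z, w)) \<le> G"
    by (rule Hinf2_obtain[OF g(1)]) blast
  obtain H where H: "H > 0" "\<And>z w. z \<in> \<D> \<Longrightarrow> w \<in> \<D> \<Longrightarrow> cmod (h (z, w)) \<le> H"
    by (rule Hinf2_obtain[OF g(2)]) blast
  show "(l, m) \<in> closure (V_set d \<Psi>)"
    unfolding closure_approachable
  proof (intro allI impI)
    fix e :: real assume e: "e > 0"
    define \<epsilon> where "\<epsilon> = e / 4"
    have \<epsilon>: "\<epsilon> > 0" using e by (simp add: \<epsilon>_def)
    \<comment> \<open>a radial step so short that the characteristic function drops below \<open>\<epsilon>\<^sup>d\<close>\<close>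
    obtain t where t: "0 < t" "t < 1" "t < \<epsilon>" "t * (G + H) < \<epsilon> ^ d"
    proof -
      define t where "t = min (1 / 2) (min (\<epsilon> / 2) (\<epsilon> ^ d / (2 * (G + H))))"
      have "t * (G + H) \<le> \<epsilon> ^ d / (2 * (G + H)) * (G + H)"
        unfolding t_def using G(1) H(1) by (intro mult_right_mono) auto
      also have "\<dots> = \<epsilon> ^ d / 2"
      proof -
        have "x / (2 * S) * S = x / 2" if "S > 0" for x S :: real using that by simp
        from this[of "G + H" "\<epsilon> ^ d"] show ?thesis using G(1) H(1) by linarith
      qed
      also have "\<dots> < \<epsilon> ^ d" using \<epsilon> by simp
      finally have "t * (G + H) < \<epsilon> ^ d" .
      moreover have "0 < t" "t < 1" "t < \<epsilon>" using \<epsilon> G(1) H(1) by (auto simp: t_def min_less_iff_disj)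
      ultimately show ?thesis using that by blast
    qed
    define z where "z = complex_of_real (1 - t) * l"
    define w where "w = complex_of_real (1 - t) * m"
    have in_D: "complex_of_real (1 - t) * x \<in> \<D>" if "x \<in> cball 0 1" for x
    proof -
      have "cmod (complex_of_real (1 - t) * x) \<le> (1 - t) * 1"
        unfolding norm_mult norm_of_real using that t by (intro mult_mono) auto
      thus ?thesis using t by simp
    qed
    have near: "cmod (complex_of_real (1 - t) * x - x) \<le> t" if "x \<in> cball 0 1" for x
    proof -
      have "complex_of_real (1 - t) * x - x = of_real (- t) * x" by (simp add: algebra_simps)
      hence "cmod (complex_of_real (1 - t) * x - x) = t * cmod x" using t by (simp add: norm_mult)
      also have "\<dots> \<le> t * 1" using that t by (intro mult_left_mono) auto
      finally show ?thesis by simp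
    qed
    have zw: "z \<in> \<D>" "w \<in> \<D>" unfolding z_def w_def by (intro in_D lm1)+
    have zl: "cmod (z - l) \<le> t" and wm: "cmod (w - m) \<le> t" unfolding z_def w_def by (intro near lm1)+
    have "cmod (det_fun d \<Psi> (z, w)) \<le> cmod (z - l) * cmod (g (z, w)) + cmod (w - m) * cmod (h (z, w))"
      unfolding g(3)[OF zw] norm_mult[symmetric] by (rule norm_triangle_ineq)
    also have "\<dots> \<le> t * G + t * H"
      using zl wm G H zw t by (intro add_mono mult_mono) auto
    also have "\<dots> < \<epsilon> ^ d" using t(4) by (simp add: algebra_simps)
    finally have small: "cmod (det_fun d \<Psi> (z, w)) < \<epsilon> ^ d" .
    note st = \<Psi>(2)[OF zw(1)]
    have P: "\<Psi> z \<in> carrier_mat d d" using st by (simp add: Schur_stable_def)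
    obtain es where es: "char_poly (\<Psi> z) = (\<Prod>e\<leftarrow>es. [:- e, 1:])" "length es = d" "set es \<subseteq> \<D>"
      by (rule Schur_stable_char_poly[OF st])
    have det: "det_fun d \<Psi> (z, x) = (-1) ^ d * root_prod es x" for x
      using det_shift_root_prod[OF P es(1)] by (simp add: det_fun_def)
    have "\<not> (\<forall>x\<in>set es. \<epsilon> \<le> cmod (w - x))"
    proof
      assume "\<forall>x\<in>set es. \<epsilon> \<le> cmod (w - x)"
      hence "\<epsilon> ^ length es \<le> cmod (root_prod es w)" using \<epsilon> by (intro root_prod_lower_bound) auto
      thus False using small es(2) det[of w] by (simp add: norm_mult norm_power)
    qed
    then obtain x where x: "x \<in> set es" "cmod (w - x) < \<epsilon>" by force
    have "root_prod es x = 0" using x(1) by (induction es) auto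
    hence V: "(z, x) \<in> V_set d \<Psi>" using x(1) es(3) zw(1) by (auto simp: V_set_iff det)
    have "dist (z, x) (l, m) \<le> dist z l + dist x m"
      using norm_Pair_le[of "z - l" "x - m"] by (simp add: dist_norm)
    also have "dist x m \<le> dist x w + dist w m" by (rule dist_triangle)
    also have "dist z l + (dist x w + dist w m) < e"
      using zl wm x(2) t(3) e by (simp add: dist_norm norm_minus_commute \<epsilon>_def)
    finally show "\<exists>y\<in>V_set d \<Psi>. dist y (l, m) < e" using V by fastforce
  qed
qed

text \<open>
  On the variety a Bezout identity reads \<open>1 = (z - l) g + (w - m) h\<close>, which fails near \<open>(l, m)\<close>
  because \<open>g\<close> and \<open>h\<close> are bounded.
\<close>

lemma closure_subset_supp_Ann_M:
  assumes a: "admissible d \<Psi>"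
  shows "closure (V_set d \<Psi>) \<subseteq> supp (Ann_M d \<Psi>)"
proof clarify
  fix l m assume lm: "(l, m) \<in> closure (V_set d \<Psi>)"
  show "(l, m) \<in> supp (Ann_M d \<Psi>)"
  proof (rule ccontr)
    assume "(l, m) \<notin> supp (Ann_M d \<Psi>)"
    then obtain f g h where fgh: "f \<in> Ann_M d \<Psi>" "g \<in> Hinf2" "h \<in> Hinf2"
      "\<forall>z\<in>\<D>. \<forall>w\<in>\<D>. 1 = f (z, w) + (z - l) * g (z, w) + (w - m) * h (z, w)"
      unfolding supp_def by blast
    obtain G where G: "G > 0" "\<And>z w. z \<in> \<D> \<Longrightarrow> w \<in> \<D> \<Longrightarrow> cmod (g (z, w)) \<le> G"
      by (rule Hinf2_obtain[OF fgh(2)]) blast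
    obtain H where H: "H > 0" "\<And>z w. z \<in> \<D> \<Longrightarrow> w \<in> \<D> \<Longrightarrow> cmod (h (z, w)) \<le> H"
      by (rule Hinf2_obtain[OF fgh(3)]) blast
    have pos: "1 / (G + H) > 0" using G H by simp
    then obtain y where y: "y \<in> V_set d \<Psi>" "dist y (l, m) < 1 / (G + H)"
      using lm unfolding closure_approachable by blast
    obtain z w where zw: "y = (z, w)" by (cases y)
    have D: "z \<in> \<D>" "w \<in> \<D>" using y(1) by (auto simp: zw V_set_iff)
    have "1 = f (z, w) + (z - l) * g (z, w) + (w - m) * h (z, w)" using fgh(4) D by blast
    hence "1 = (z - l) * g (z, w) + (w - m) * h (z, w)"
      using Ann_M_zero_on_V[OF a fgh(1)] y(1) zw by simp
    hence "1 = cmod ((z - l) * g (z, w) + (w - m) * h (z, w))" by (metis norm_one)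
    also have "\<dots> \<le> cmod (z - l) * cmod (g (z, w)) + cmod (w - m) * cmod (h (z, w))"
      unfolding norm_mult[symmetric] by (rule norm_triangle_ineq)
    also have "\<dots> \<le> dist y (l, m) * G + dist y (l, m) * H"
      using G H D norm_fst_le[of "z - l" "w - m"] norm_snd_le[of "w - m" "z - l"]
      by (intro add_mono mult_mono) (auto simp: zw dist_norm)
    also have "\<dots> < 1" using y(2) G(1) H(1) by (simp add: pos_less_divide_eq distrib_left)
    finally show False by simp
  qed
qed

lemma supp_mono: "F \<subseteq> F' \<Longrightarrow> supp F' \<subseteq> supp F"
  unfolding supp_def by blast

lemma supp_in_bidisc:
  assumes F: "F \<subseteq> Hinf2" and scale: "\<And>f c. f \<in> F \<Longrightarrow> (\<lambda>p. c * f p) \<in> F"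
  shows "supp F \<inter> (\<D> \<times> \<D>) = zero_set F"
proof
  show "zero_set F \<subseteq> supp F \<inter> (\<D> \<times> \<D>)"
  proof clarify
    fix l m assume "(l, m) \<in> zero_set F"
    hence lm: "l \<in> \<D>" "m \<in> \<D>" and Z: "\<And>f. f \<in> F \<Longrightarrow> f (l, m) = 0" by (auto simp: zero_set_def)
    have "(l, m) \<in> supp F"
    proof (rule ccontr)
      assume "(l, m) \<notin> supp F"
      then obtain f g h where f: "f \<in> F"
        "\<forall>z\<in>\<D>. \<forall>w\<in>\<D>. 1 = f (z, w) + (z - l) * g (z, w) + (w - m) * h (z, w)"
        unfolding supp_def by blast
      have "1 = f (l, m) + (l - l) * g (l, m) + (m - m) * h (l, m)" using f(2) lm by blast
      thus False using Z[OF f(1)] by simp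
    qed
    thus "(l, m) \<in> supp F \<inter> (\<D> \<times> \<D>)" using lm by blast
  qed
  show "supp F \<inter> (\<D> \<times> \<D>) \<subseteq> zero_set F"
  proof clarify
    fix l m assume lm: "(l, m) \<in> supp F" "l \<in> \<D>" "m \<in> \<D>"
    have "f (l, m) = 0" if f: "f \<in> F" for f
    proof (rule ccontr)
      assume nz: "f (l, m) \<noteq> 0"
      obtain g h where "g \<in> Hinf2" "h \<in> Hinf2"
        "\<And>z w. z \<in> \<D> \<Longrightarrow> w \<in> \<D> \<Longrightarrow> f (z, w) = f (l, m) + (z - l) * g (z, w) + (w - m) * h (z, w)"
        by (rule Gleason_bidisc[of f l m]) (use f F lm in auto)
      hence "Bezout_value l m f (f (l, m))" by (intro Bezout_valueI)
      thus False using not_in_supp_of_Bezout_value[OF f scale _ nz] lm by blast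
    qed
    thus "(l, m) \<in> zero_set F" using lm by (auto simp: zero_set_def)
  qed
qed

text \<open>
  The characteristic function belongs to \<open>Ann(M)\<close>, hence to \<open>Ann(T)\<close>, and vanishes at \<open>(l, m)\<close>;
  so \<open>m\<close> is an eigenvalue of \<open>\<Psi>(l)\<close>.
\<close>

lemma zero_set_subset_taylor_spectrum:
  assumes a: "admissible d \<Psi>" and J: "isometry_into_hardy d (J :: 'h :: chilbert_space \<Rightarrow> _)"
  shows "zero_set (Ann_T d \<Psi> J) \<subseteq> taylor_spectrum d (K_space d \<Psi> J) (S1 d \<Psi> J) (S2 d \<Psi> J)"
proof clarify
  fix l m assume "(l, m) \<in> zero_set (Ann_T d \<Psi> J)"
  hence lm: "l \<in> \<D>" "m \<in> \<D>" and Z: "\<And>f. f \<in> Ann_T d \<Psi> J \<Longrightarrow> f (l, m) = 0"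
    by (auto simp: zero_set_def)
  have "det_fun d \<Psi> (l, m) = 0" using Z det_fun_Ann_M[OF a] Ann_M_subset_Ann_T[OF a J] by blast
  moreover have "\<Psi> l \<in> carrier_mat d d" by (rule Hinf_mat_carrier[OF admissibleD(1)[OF a] lm(1)])
  ultimately obtain v where v: "v \<in> carrier_vec d" "v \<noteq> 0\<^sub>v d"
    "\<And>j. j < d \<Longrightarrow> (\<Sum>i<d. v $ i * \<Psi> l $$ (i, j)) = m * v $ j"
    using det_fun_zero_left_eigenvector[of \<Psi> l d m] by blast
  show "(l, m) \<in> taylor_spectrum d (K_space d \<Psi> J) (S1 d \<Psi> J) (S2 d \<Psi> J)"
    using eigenvector_in_taylor_spectrum[of d \<Psi> l m J v] a lm Z v by blast
qed

theorem theorem3p11: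
  fixes T1 T2 :: "'h::chilbert_space \<Rightarrow> 'h"
    and J :: "'h \<Rightarrow> complex \<Rightarrow> complex vec"
    and \<Psi> :: "complex \<Rightarrow> complex mat"
    and d :: nat
  assumes "pure_contraction T1" and "pure_contraction T2"
    and "T1 \<circ> T2 = T2 \<circ> T1"
    and "finite_defect T1" and "finite_defect T2"
    and "d = defect_dim T1"
    and "isometry_into_hardy d J"
    and "\<And>x. J (cadjoint T1 x) = hadjoint d shift (J x)"
    and "rational_pure_inner d \<Psi>"
    and "\<And>x. J (cadjoint T2 x) = hadjoint d (mult_op d \<Psi>) (J x)"
  shows "taylor_spectrum d (K_space d \<Psi> J) (S1 d \<Psi> J) (S2 d \<Psi> J) \<subseteq> supp (Ann_T d \<Psi> J)
    \<and> supp (Ann_T d \<Psi> J) \<subseteq> closure (V_set d \<Psi>)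
    \<and> closure (V_set d \<Psi>) = supp (Ann_M d \<Psi>)
    \<and> taylor_spectrum d (K_space d \<Psi> J) (S1 d \<Psi> J) (S2 d \<Psi> J) \<inter> (\<D> \<times> \<D>)
        = supp (Ann_T d \<Psi> J) \<inter> (\<D> \<times> \<D>)
    \<and> supp (Ann_T d \<Psi> J) \<inter> (\<D> \<times> \<D>) = zero_set (Ann_T d \<Psi> J)"
proof -
  have J: "isometry_into_hardy d J" by fact
  have a: "admissible d \<Psi>" by (rule rational_pure_inner_admissible) fact
  have rat: "rational_entries d \<Psi>"
    using \<open>rational_pure_inner d \<Psi>\<close> by (simp add: rational_pure_inner_def)
  have 1: "taylor_spectrum d (K_space d \<Psi> J) (S1 d \<Psi> J) (S2 d \<Psi> J) \<subseteq> supp (Ann_T d \<Psi> J)"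
    by (rule taylor_spectrum_subset_supp[OF a])
  have 2: "closure (V_set d \<Psi>) = supp (Ann_M d \<Psi>)"
    using supp_Ann_M_subset_closure[OF a rat] closure_subset_supp_Ann_M[OF a] by blast
  have 3: "supp (Ann_T d \<Psi> J) \<subseteq> supp (Ann_M d \<Psi>)"
    by (rule supp_mono[OF Ann_M_subset_Ann_T[OF a J]])
  have 4: "supp (Ann_T d \<Psi> J) \<inter> (\<D> \<times> \<D>) = zero_set (Ann_T d \<Psi> J)"
    by (rule supp_in_bidisc[OF _ Ann_T_cmult[OF a J]]) (auto simp: Ann_T_def)
  have 5: "zero_set (Ann_T d \<Psi> J) \<subseteq> taylor_spectrum d (K_space d \<Psi> J) (S1 d \<Psi> J) (S2 d \<Psi> J)"
    by (rule zero_set_subset_taylor_spectrum[OF a J])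
  show ?thesis using 1 2 3 4 5 by blast
qed

end
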